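(* The set $\mathsf C_\tau(\mathcal D)=\{\mathsf C_\tau(X)\mid X\in\mathcal D\}$ is dense in $(\mathcal D_K,\Box)$. Moreover, $(\mathcal D_K,\Box)$ is the metric completion of $(\mathcal D,\Box_\tau)$ (via the map $\mathsf C_\tau$).
   Context: A geometric data set is a triple $(X,F_X,\mu_X)$ where $F_X$ is a nonempty family of real-valued functions (features) on $X$ such that $d_X(x,x'):=\sup_{f\in F_X}|f(x)-f(x')|$ is a (finite) complete separable metric on $X$, and $\mu_X$ is a Borel probability measure on $(X,d_X)$ with full support. $\overline{F_X}$ denotes the closure of $F_X$ in the set of real-valued functions on $X$ under pointwise convergence. $X$ and $Y$ are isomorphic if there is a Borel map $\phi:X\to Y$ with $\phi_*\mu_X=\mu_Y$ and $\overline{F_Y}\circ\phi=\overline{F_X}$. Isomorphic geometric data sets are identified; $\mathcal D$ is the set of isomorphism classes. $K=[-1/2,1/2]$ and $\mathcal D_K\subset\mathcal D$ is the set of classes whose features all take values in $K$. $\mathcal T(\mu,\nu)$ is the set of couplings of $\mu,\nu$ (Borel probability measures on the product with marginals $\mu,\nu$); $\mathrm{pr}_1,\mathrm{pr}_2$ are the coordinate projections; $(d)_H$ is the Hausdorff distance induced by $d$. Box distance. For a closed set $S\subset X\times Y$, $d_{\infty,S}(u,v):=\sup_{z\in S}|u(z)-v(z)|$ if $S\ne\varnothing$ and $d_{\infty,\varnothing}:=0$. Then \[\Box(X,Y):=\inf_{\pi\in\mathcal T(\mu_X,\mu_Y),\ S\subset X\times Y\text{ closed}}\max\{1-\pi(S),\,2(d_{\infty,S})_H(F_X\circ\mathrm{pr}_1,F_Y\circ\mathrm{pr}_2)\},\]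 which is a metric on $\mathcal D$. Compact screen. $\tau:\mathbb R\to(-1/2,1/2)$, $\tau(r)=\frac12\tanh r$. For $X\in\mathcal D$ let $d_X^\tau(x,x'):=\sup_{f\in F_X}|\tau(f(x))-\tau(f(x'))|$, let $\widehat X^\tau$ be the completion of $(X,d_X^\tau)$ with canonical map $e_X^\tau:X\to\widehat X^\tau$, let $\widehat{\tau\circ f}$ be the unique continuous extension of $\tau\circ f$ to $\widehat X^\tau$, and $X^\tau:=\operatorname{supp}((e_X^\tau)_*\mu_X)$. The compact screen is $\mathsf C_\tau(X):=(X^\tau,\{\widehat{\tau\circ f}|_{X^\tau}\mid f\in F_X\},(e_X^\tau)_*\mu_X|_{X^\tau})\in\mathcal D_K$; it is well defined on isomorphism classes. The pullback Box metric on $\mathcal D$ is $\Box_\tau(X,Y):=\Box(\mathsf C_\tau(X),\mathsf C_\tau(Y))$; it is a metric on $\mathcal D$. *)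

theory Defs
  imports "HOL-Probability.Probability"
begin

section \<open>Metric completions\<close>

definition is_metric_completion ::
  "'a set \<Rightarrow> ('a \<Rightarrow> 'a \<Rightarrow> real) \<Rightarrow> 'b set \<Rightarrow> ('b \<Rightarrow> 'b \<Rightarrow> real) \<Rightarrow> ('a \<Rightarrow> 'b) \<Rightarrow> bool" where
  "is_metric_completion M d M' d' e \<longleftrightarrow>
     Metric_space M d \<and> Metric_space M' d' \<and> Metric_space.mcomplete M' d' \<and>
     e \<in> M \<rightarrow> M' \<and> (\<forall>x\<in>M. \<forall>y\<in>M. d' (e x) (e y) = d x y) \<and>
     Metric_space.mtopology M' d' closure_of (e ` M) = M'"

text \<open>
  A concrete completion of an arbitrary metric space: the uniform closure of the set of
  distance functions \<^term>\<open>d x\<close>.  That it is a completion is lemma \<open>completion\<close>.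
\<close>

definition completion_pts :: "'a set \<Rightarrow> ('a \<Rightarrow> 'a \<Rightarrow> real) \<Rightarrow> ('a \<Rightarrow> real) set" where
  "completion_pts M d = {g \<in> extensional M. \<forall>\<epsilon>>0. \<exists>x\<in>M. \<forall>y\<in>M. \<bar>g y - d x y\<bar> \<le> \<epsilon>}"

definition completion_dist :: "'a set \<Rightarrow> ('a \<Rightarrow> 'a \<Rightarrow> real) \<Rightarrow> ('a \<Rightarrow> real) \<Rightarrow> ('a \<Rightarrow> real) \<Rightarrow> real" where
  "completion_dist M d g h =
     (if g \<in> completion_pts M d \<and> h \<in> completion_pts M d then (SUP y\<in>M. \<bar>g y - h y\<bar>) else 0)"

definition completion_map :: "'a set \<Rightarrow> ('a \<Rightarrow> 'a \<Rightarrow> real) \<Rightarrow> 'a \<Rightarrow> ('a \<Rightarrow> real)" where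
  "completion_map M d x = restrict (d x) M"

context
  fixes M :: "'a set" and d
  assumes M: "Metric_space M d"
begin

interpretation Metric_space M d by (rule M)

lemma completion_ptsE:
  assumes "g \<in> completion_pts M d" "\<epsilon> > 0"
  obtains x where "x \<in> M" "\<And>y. y \<in> M \<Longrightarrow> \<bar>g y - d x y\<bar> \<le> \<epsilon>"
  using assms unfolding completion_pts_def by blast

lemma completion_bdd:
  assumes "g \<in> completion_pts M d" "h \<in> completion_pts M d"
  shows "bdd_above ((\<lambda>y. \<bar>g y - h y\<bar>) ` M)"
proof -
  obtain x where x: "x \<in> M" "\<And>y. y \<in> M \<Longrightarrow> \<bar>g y - d x y\<bar> \<le> 1"
    using completion_ptsE[OF assms(1), of 1] by auto
  obtain z where z: "z \<in> M" "\<And>y. y \<in> M \<Longrightarrow> \<bar>h y - d z y\<bar> \<le> 1"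
    using completion_ptsE[OF assms(2), of 1] by auto
  have "\<bar>g y - h y\<bar> \<le> d x z + 2" if "y \<in> M" for y
    using x(2)[OF that] z(2)[OF that] triangle[OF x(1) z(1) that]
      triangle[OF z(1) x(1) that] commute[of x z] by linarith
  then show ?thesis unfolding bdd_above_def by blast
qed

lemma completion_dist_upper:
  assumes "g \<in> completion_pts M d" "h \<in> completion_pts M d" "y \<in> M"
  shows "\<bar>g y - h y\<bar> \<le> completion_dist M d g h"
  using assms completion_bdd[OF assms(1,2)] by (auto simp: completion_dist_def intro: cSUP_upper)

lemma completion_dist_least:
  assumes "g \<in> completion_pts M d" "h \<in> completion_pts M d"
    "\<And>y. y \<in> M \<Longrightarrow> \<bar>g y - h y\<bar> \<le> c"
  shows "completion_dist M d g h \<le> c"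
proof -
  have "M \<noteq> {}" using completion_ptsE[OF assms(1), of 1] by auto
  with assms show ?thesis by (auto simp: completion_dist_def intro: cSUP_least)
qed

lemma completion_map_in: "x \<in> M \<Longrightarrow> completion_map M d x \<in> completion_pts M d"
  by (auto simp: completion_map_def completion_pts_def intro!: bexI[of _ x])

lemma completion_Metric_space: "Metric_space (completion_pts M d) (completion_dist M d)"
proof
  show nn: "0 \<le> completion_dist M d g h" for g h
  proof (cases "g \<in> completion_pts M d \<and> h \<in> completion_pts M d")
    case True
    then obtain x where "x \<in> M" using completion_ptsE[of g 1] by auto
    then show ?thesis using True completion_dist_upper[of g h x] by linarith
  qed (auto simp: completion_dist_def)
  show "completion_dist M d g h = completion_dist M d h g" for g h
    by (simp add: completion_dist_def abs_minus_commute)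
  fix g h assume gh: "g \<in> completion_pts M d" "h \<in> completion_pts M d"
  show "completion_dist M d g h = 0 \<longleftrightarrow> g = h"
  proof
    assume "completion_dist M d g h = 0"
    then have "g y = h y" if "y \<in> M" for y
      using completion_dist_upper[OF gh that] by simp
    moreover have "g \<in> extensional M" "h \<in> extensional M"
      using gh by (auto simp: completion_pts_def)
    ultimately show "g = h" by (meson extensionalityI)
  next
    assume "g = h"
    then show "completion_dist M d g h = 0"
      using completion_dist_least[OF gh, of 0] nn[of g h] by simp
  qed
  fix k assume k: "k \<in> completion_pts M d"
  show "completion_dist M d g k \<le> completion_dist M d g h + completion_dist M d h k"
  proof (rule completion_dist_least[OF gh(1) k])
    fix y assume "y \<in> M"
    then show "\<bar>g y - k y\<bar> \<le> completion_dist M d g h + completion_dist M d h k"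
      using completion_dist_upper[OF gh] completion_dist_upper[OF gh(2) k]
      by (smt (verit))
  qed
qed

lemma completion_dist_map:
  assumes g: "g \<in> completion_pts M d" and x: "x \<in> M"
    and le: "\<And>y. y \<in> M \<Longrightarrow> \<bar>g y - d x y\<bar> \<le> \<epsilon>"
  shows "completion_dist M d g (completion_map M d x) \<le> \<epsilon>"
  by (rule completion_dist_least[OF g completion_map_in[OF x]])
     (auto simp: completion_map_def le)

lemma completion_isometry:
  assumes "x \<in> M" "y \<in> M"
  shows "completion_dist M d (completion_map M d x) (completion_map M d y) = d x y"
proof (rule antisym)
  show "completion_dist M d (completion_map M d x) (completion_map M d y) \<le> d x y"
  proof (rule completion_dist_map)
    fix z assume z: "z \<in> M"
    show "\<bar>completion_map M d x z - d y z\<bar> \<le> d x y"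
      using z triangle[OF assms z] triangle[OF assms(2,1) z] commute[of x y]
      by (auto simp: completion_map_def)
  qed (use assms completion_map_in in auto)
  show "d x y \<le> completion_dist M d (completion_map M d x) (completion_map M d y)"
    using completion_dist_upper[OF completion_map_in[OF assms(1)] completion_map_in[OF assms(2)] assms(2)]
      assms by (simp add: completion_map_def)
qed

lemma completion: 
  "is_metric_completion M d (completion_pts M d) (completion_dist M d) (completion_map M d)"
proof -
  interpret C: Metric_space "completion_pts M d" "completion_dist M d"
    by (rule completion_Metric_space)
  have "C.mtopology closure_of (completion_map M d ` M) = completion_pts M d"
  proof (intro equalityI subsetI)
    fix g assume g: "g \<in> completion_pts M d"
    have "\<exists>x\<in>M. completion_dist M d g (completion_map M d x) < r" if r: "r > 0" for r
    proof -
      obtain x where "x \<in> M" "\<And>y. y \<in> M \<Longrightarrow> \<bar>g y - d x y\<bar> \<le> r/2"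
        using completion_ptsE[OF g half_gt_zero[OF r]] by blast
      then have "completion_dist M d g (completion_map M d x) \<le> r/2"
        using completion_dist_map g by blast
      with \<open>x \<in> M\<close> r show ?thesis by (intro bexI[of _ x]) auto
    qed
    with g show "g \<in> C.mtopology closure_of (completion_map M d ` M)"
      by (auto simp: C.metric_closure_of completion_map_in)
  qed (auto simp: C.metric_closure_of)
  moreover have C.mcomplete
    unfolding C.mcomplete_def
  proof (intro allI impI)
    fix \<sigma> assume "C.MCauchy \<sigma>"
    then have \<sigma>: "\<And>n. \<sigma> n \<in> completion_pts M d"
      and cau: "\<And>r. r > 0 \<Longrightarrow> \<exists>N. \<forall>m\<ge>N. \<forall>n\<ge>N. completion_dist M d (\<sigma> m) (\<sigma> n) < r"
      by (auto simp: C.MCauchy_def)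
    have conv: "convergent (\<lambda>n. \<sigma> n y)" if "y \<in> M" for y
    proof (rule Cauchy_convergent, rule metric_CauchyI)
      fix r :: real assume "r > 0"
      from cau[OF this] obtain N where
        "\<forall>m\<ge>N. \<forall>n\<ge>N. completion_dist M d (\<sigma> m) (\<sigma> n) < r" by blast
      then show "\<exists>N. \<forall>m\<ge>N. \<forall>n\<ge>N. dist (\<sigma> m y) (\<sigma> n y) < r"
        using le_less_trans[OF completion_dist_upper[OF \<sigma> \<sigma> that]]
        unfolding dist_real_def by blast
    qed
    define g where "g = (\<lambda>y\<in>M. lim (\<lambda>n. \<sigma> n y))"
    have lim: "(\<lambda>n. \<sigma> n y) \<longlonglongrightarrow> g y" if "y \<in> M" for y
      using conv[OF that] that by (simp add: g_def convergent_LIMSEQ_iff)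
    have unif: "\<exists>N. \<forall>n\<ge>N. \<forall>y\<in>M. \<bar>\<sigma> n y - g y\<bar> \<le> r" if "r > 0" for r
    proof -
      from cau[OF that] obtain N where
        N: "\<forall>m\<ge>N. \<forall>n\<ge>N. completion_dist M d (\<sigma> m) (\<sigma> n) < r" by blast
      have "\<bar>\<sigma> n y - g y\<bar> \<le> r" if "n \<ge> N" "y \<in> M" for n y
      proof (rule Lim_bounded)
        show "(\<lambda>m. \<bar>\<sigma> n y - \<sigma> m y\<bar>) \<longlonglongrightarrow> \<bar>\<sigma> n y - g y\<bar>"
          by (intro tendsto_intros lim that)
        show "\<forall>m\<ge>N. \<bar>\<sigma> n y - \<sigma> m y\<bar> \<le> r"
          using order_trans[OF completion_dist_upper[OF \<sigma> \<sigma> that(2)] less_imp_le]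
            N that(1) by blast
      qed
      then show ?thesis by blast
    qed
    have g: "g \<in> completion_pts M d"
      unfolding completion_pts_def
    proof (intro CollectI conjI allI impI)
      show "g \<in> extensional M" by (simp add: g_def)
      fix \<epsilon> :: real assume \<epsilon>: "\<epsilon> > 0"
      obtain n where n: "\<And>y. y \<in> M \<Longrightarrow> \<bar>\<sigma> n y - g y\<bar> \<le> \<epsilon>/2"
        using unif[of "\<epsilon>/2"] \<epsilon> by auto
      obtain x where "x \<in> M" "\<And>y. y \<in> M \<Longrightarrow> \<bar>\<sigma> n y - d x y\<bar> \<le> \<epsilon>/2"
        using completion_ptsE[OF \<sigma> half_gt_zero[OF \<epsilon>]] by blast
      moreover from this n have "\<bar>g y - d x y\<bar> \<le> \<epsilon>" if "y \<in> M" for y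
        using that by (smt (verit) field_sum_of_halves)
      ultimately show "\<exists>x\<in>M. \<forall>y\<in>M. \<bar>g y - d x y\<bar> \<le> \<epsilon>" by blast
    qed
    have "\<exists>N. \<forall>n\<ge>N. completion_dist M d (\<sigma> n) g < r" if r: "r > 0" for r
    proof -
      obtain N where N: "\<forall>n\<ge>N. \<forall>y\<in>M. \<bar>\<sigma> n y - g y\<bar> \<le> r/2"
        using unif[of "r/2"] \<open>r > 0\<close> by auto
      have "completion_dist M d (\<sigma> n) g \<le> r/2" if "n \<ge> N" for n
        using completion_dist_least[OF \<sigma> g] N that by blast
      moreover have "r/2 < r" using r by simp
      ultimately show ?thesis using le_less_trans by blast
    qed
    with g \<sigma> show "\<exists>g. limitin C.mtopology \<sigma> g sequentially"
      by (auto simp: C.limit_metric_sequentially)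
  qed
  ultimately show ?thesis
    by (auto simp: is_metric_completion_def M completion_Metric_space completion_map_in
        completion_isometry)
qed

end


section \<open>Geometric data sets\<close>

text \<open>
  Real-valued functions on a carrier \<open>X\<close> are represented by elements of \<^term>\<open>extensional X\<close>.
\<close>

record 'a data_set =
  pts :: "'a set"
  feats :: "('a \<Rightarrow> real) set"
  meas :: "'a measure"

text \<open>
  The value off the carrier is fixed to be \<open>0\<close> because \<^locale>\<open>Metric_space\<close> demands
  symmetry and nonnegativity on the whole type.
\<close>

definition feature_dist :: "'a set \<Rightarrow> ('a \<Rightarrow> real) set \<Rightarrow> 'a \<Rightarrow> 'a \<Rightarrow> real" where
  "feature_dist M F x y = (if x \<in> M \<and> y \<in> M then (SUP f\<in>F. \<bar>f x - f y\<bar>) else 0)"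

abbreviation data_dist :: "'a data_set \<Rightarrow> 'a \<Rightarrow> 'a \<Rightarrow> real" where
  "data_dist X \<equiv> feature_dist (pts X) (feats X)"

abbreviation data_top :: "'a data_set \<Rightarrow> 'a topology" where
  "data_top X \<equiv> Metric_space.mtopology (pts X) (data_dist X)"

definition borel_of :: "'a topology \<Rightarrow> 'a measure" where
  "borel_of T = sigma (topspace T) {U. openin T U}"

definition geometric_data_set :: "'a data_set \<Rightarrow> bool" where
  "geometric_data_set X \<longleftrightarrow>
     feats X \<noteq> {} \<and> feats X \<subseteq> extensional (pts X) \<and>
     (\<forall>x\<in>pts X. \<forall>y\<in>pts X. bdd_above ((\<lambda>f. \<bar>f x - f y\<bar>) ` feats X)) \<and>
     Metric_space (pts X) (data_dist X) \<and>
     Metric_space.mcomplete (pts X) (data_dist X) \<and>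
     separable_space (data_top X) \<and>
     sets (meas X) = sets (borel_of (data_top X)) \<and>
     prob_space (meas X) \<and>
     (\<forall>U. openin (data_top X) U \<and> U \<noteq> {} \<longrightarrow> emeasure (meas X) U > 0)"

definition feats_closure :: "'a data_set \<Rightarrow> ('a \<Rightarrow> real) set" where
  "feats_closure X = product_topology (\<lambda>_. euclideanreal) (pts X) closure_of (feats X)"

definition data_iso :: "'a data_set \<Rightarrow> 'b data_set \<Rightarrow> bool" where
  "data_iso X Y \<longleftrightarrow>
     (\<exists>\<phi> \<in> measurable (meas X) (meas Y).
        distr (meas X) (meas Y) \<phi> = meas Y \<and>
        (\<lambda>g. compose (pts X) g \<phi>) ` feats_closure Y = feats_closure X)"


section \<open>Isomorphism classes\<close>

text \<open>
  A separable metric space has at most the cardinality of the continuum, so every isomorphism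
  class of geometric data sets, over whatever type, has a representative whose carrier is a
  subset of \<^typ>\<open>nat \<Rightarrow> real\<close> (lemma \<open>iso_class_nonempty\<close>).  An isomorphism class is
  therefore identified with the set of its members over this type.
\<close>

type_synonym data_class = "(nat \<Rightarrow> real) data_set set"

definition iso_class :: "'a data_set \<Rightarrow> data_class" where
  "iso_class X = {Y. geometric_data_set Y \<and> data_iso X Y}"

lemma carrier_injection:
  assumes "geometric_data_set (X :: 'a data_set)"
  obtains j :: "'a \<Rightarrow> (nat \<Rightarrow> real)" where "inj_on j (pts X)"
proof -
  interpret Metric_space "pts X" "data_dist X"
    using assms by (simp add: geometric_data_set_def)
  obtain C where C: "countable C" "C \<subseteq> pts X" "mtopology closure_of C = pts X"
    using assms by (auto simp: geometric_data_set_def separable_space_def)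
  have "inj_on (\<lambda>x n. data_dist X x (from_nat_into C n)) (pts X)"
  proof (rule inj_onI, rule ccontr)
    fix x y assume xy: "x \<in> pts X" "y \<in> pts X" "x \<noteq> y"
      and eq: "(\<lambda>n. data_dist X x (from_nat_into C n)) = (\<lambda>n. data_dist X y (from_nat_into C n))"
    define r where "r = data_dist X x y / 2"
    have "r > 0" using xy nonneg[of x y] zero[of x y] unfolding r_def by linarith
    moreover have "x \<in> mtopology closure_of C" using C xy by simp
    ultimately obtain c where c: "c \<in> C" "data_dist X x c < r"
      by (force simp: metric_closure_of)
    then obtain n where "from_nat_into C n = c"
      using C(1) from_nat_into_surj by metis
    then have "data_dist X y c < r" using c(2) fun_cong[OF eq, of n] by simp
    then show False
      using c C(2) triangle[of x c y] xy commute[of c y] by (auto simp: r_def)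
  qed
  then show ?thesis by (rule that)
qed

lemma iso_class_nonempty:
  assumes X: "geometric_data_set (X :: 'a data_set)"
  shows "iso_class X \<noteq> {}"
proof -
  let ?P = "pts X"
  obtain j :: "'a \<Rightarrow> (nat \<Rightarrow> real)" where j: "inj_on j ?P"
    using carrier_injection[OF X] .
  let ?Q = "j ` ?P"
  define k where "k = inv_into ?P j"
  have kj [simp]: "k (j x) = x" if "x \<in> ?P" for x
    using that j by (simp add: k_def)
  define G where "G = (\<lambda>f. restrict (f \<circ> k) ?Q) ` feats X"
  define D where "D = feature_dist ?Q G"
  interpret X: Metric_space ?P "data_dist X"
    using X by (simp add: geometric_data_set_def)
  have ext: "feats X \<subseteq> extensional ?P" and ne: "feats X \<noteq> {}"
    and bdd: "\<And>x y. x \<in> ?P \<Longrightarrow> y \<in> ?P \<Longrightarrow> bdd_above ((\<lambda>f. \<bar>f x - f y\<bar>) ` feats X)"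
    and sep: "separable_space X.mtopology" and compl: "X.mcomplete"
    and sets: "sets (meas X) = sets (borel_of X.mtopology)" and pr: "prob_space (meas X)"
    and supp: "\<And>U. openin X.mtopology U \<Longrightarrow> U \<noteq> {} \<Longrightarrow> emeasure (meas X) U > 0"
    using X by (auto simp: geometric_data_set_def)
  have G_img: "(\<lambda>g. \<bar>g (j x) - g (j y)\<bar>) ` G = (\<lambda>f. \<bar>f x - f y\<bar>) ` feats X"
    if "x \<in> ?P" "y \<in> ?P" for x y
    using that by (auto simp: G_def image_image)
  have D: "D (j x) (j y) = data_dist X x y" if "x \<in> ?P" "y \<in> ?P" for x y
    using that G_img[OF that] by (simp add: D_def feature_dist_def)
  have D_off: "D u v = 0" if "\<not> (u \<in> ?Q \<and> v \<in> ?Q)" for u v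
    using that unfolding D_def feature_dist_def by auto
  interpret Y: Metric_space ?Q D
  proof
    show "0 \<le> D u v" for u v
      using D D_off[of u v] by (cases "u \<in> ?Q \<and> v \<in> ?Q") auto
    show "D u v = D v u" for u v
      by (simp add: D_def feature_dist_def abs_minus_commute)
    show "D u v = 0 \<longleftrightarrow> u = v" if "u \<in> ?Q" "v \<in> ?Q" for u v
      using that D X.zero by auto
    show "D u w \<le> D u v + D v w" if "u \<in> ?Q" "v \<in> ?Q" "w \<in> ?Q" for u v w
      using that D X.triangle by auto
  qed
  have cont_j: "continuous_map X.mtopology Y.mtopology j"
    unfolding X.metric_continuous_map[OF Y.Metric_space_axioms]
    using D by (auto intro!: exI)
  define \<nu> where "\<nu> = distr (meas X) (borel_of Y.mtopology) j"
  define Y where "Y = \<lparr>pts = ?Q, feats = G, meas = \<nu>\<rparr>"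
  have Y_simps [simp]: "pts Y = ?Q" "feats Y = G" "meas Y = \<nu>"
    by (auto simp: Y_def)
  have sp: "space (meas X) = ?P"
    using sets_eq_imp_space_eq[OF sets] by (simp add: borel_of_def space_measure_of_conv)
  have sets_borel: "sets (borel_of T) = sigma_sets (topspace T) {U. openin T U}" for T :: "'z topology"
    unfolding borel_of_def by (rule sets_measure_of) (auto dest: openin_subset)
  have meas_j: "j \<in> measurable (meas X) (borel_of Y.mtopology)"
    unfolding borel_of_def
  proof (rule measurable_measure_of)
    show "{U. openin Y.mtopology U} \<subseteq> Pow (topspace Y.mtopology)"
      using openin_subset by blast
    show "j \<in> space (meas X) \<rightarrow> topspace Y.mtopology" by (auto simp: sp)
    fix V assume "V \<in> {U. openin Y.mtopology U}"
    then have "openin X.mtopology {x \<in> topspace X.mtopology. j x \<in> V}"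
      by (intro openin_continuous_map_preimage[OF cont_j]) simp
    moreover have "j -` V \<inter> space (meas X) = {x \<in> topspace X.mtopology. j x \<in> V}"
      by (auto simp: sp)
    ultimately show "j -` V \<inter> space (meas X) \<in> sets (meas X)"
      unfolding sets sets_borel by auto
  qed
  have gY: "geometric_data_set Y"
    unfolding geometric_data_set_def Y_simps D_def[symmetric]
  proof (intro conjI allI impI ballI)
    show "G \<noteq> {}" "G \<subseteq> extensional ?Q" using ne by (auto simp: G_def)
    show "bdd_above ((\<lambda>g. \<bar>g u - g v\<bar>) ` G)" if "u \<in> ?Q" "v \<in> ?Q" for u v
      using that G_img bdd by auto
    show "Metric_space ?Q D" by (rule Y.Metric_space_axioms)
    show "Y.mcomplete"
      unfolding Y.mcomplete_def
    proof (intro allI impI)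
      fix \<sigma> assume "Y.MCauchy \<sigma>"
      then have \<sigma>: "\<And>n. \<sigma> n \<in> ?Q"
        and cau: "\<forall>r>0. \<exists>N. \<forall>m n. N \<le> m \<longrightarrow> N \<le> n \<longrightarrow> D (\<sigma> m) (\<sigma> n) < r"
        by (auto simp: Y.MCauchy_def)
      define \<rho> where "\<rho> = k \<circ> \<sigma>"
      have \<rho>: "\<rho> n \<in> ?P" "\<sigma> n = j (\<rho> n)" for n
        using \<sigma>[of n] by (auto simp: \<rho>_def)
      have "X.MCauchy \<rho>"
        using cau \<rho> D by (auto simp: X.MCauchy_def)
      then obtain x where "limitin X.mtopology \<rho> x sequentially"
        using compl by (auto simp: X.mcomplete_def)
      then have "limitin Y.mtopology (j \<circ> \<rho>) (j x) sequentially"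
        by (rule continuous_map_limit[OF cont_j])
      moreover have "j \<circ> \<rho> = \<sigma>" using \<rho> by auto
      ultimately show "\<exists>x. limitin Y.mtopology \<sigma> x sequentially" by auto
    qed
    show "separable_space Y.mtopology"
      by (rule separable_space_continuous_map_image[OF sep cont_j]) simp
    show "sets \<nu> = sets (borel_of Y.mtopology)" by (simp add: \<nu>_def)
    show "prob_space \<nu>"
      unfolding \<nu>_def by (rule prob_space.prob_space_distr[OF pr meas_j])
    fix V assume V: "openin Y.mtopology V \<and> V \<noteq> {}"
    then have VQ: "V \<subseteq> ?Q" using openin_subset by fastforce
    have "openin X.mtopology {x \<in> topspace X.mtopology. j x \<in> V}"
      by (intro openin_continuous_map_preimage[OF cont_j]) (simp add: V)
    moreover have eq: "{x \<in> topspace X.mtopology. j x \<in> V} = j -` V \<inter> space (meas X)"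
      by (auto simp: sp)
    moreover have "j -` V \<inter> space (meas X) \<noteq> {}" using V VQ sp by auto
    ultimately have "emeasure (meas X) (j -` V \<inter> space (meas X)) > 0"
      using supp by simp
    moreover have "V \<in> sets (borel_of Y.mtopology)"
      using V unfolding sets_borel by auto
    ultimately show "emeasure \<nu> V > 0"
      using meas_j by (simp add: \<nu>_def emeasure_distr)
  qed
  let ?TX = "product_topology (\<lambda>_. euclideanreal) ?P"
  let ?TY = "product_topology (\<lambda>_. euclideanreal) ?Q"
  define R where "R = (\<lambda>g :: (nat \<Rightarrow> real) \<Rightarrow> real. compose ?P g j)"
  have "homeomorphic_maps ?TY ?TX R (\<lambda>f :: _ \<Rightarrow> real. compose ?Q f k)"
    unfolding homeomorphic_maps_def
  proof (intro conjI ballI)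
    show "continuous_map ?TY ?TX R"
      by (auto simp: continuous_map_componentwise R_def compose_def
          intro!: continuous_map_product_projection)
    show "continuous_map ?TX ?TY (\<lambda>f :: _ \<Rightarrow> real. compose ?Q f k)"
      by (auto simp: continuous_map_componentwise compose_def
          intro!: continuous_map_product_projection)
  qed (auto simp: R_def compose_def PiE_def extensional_def fun_eq_iff)
  then have hom: "homeomorphic_map ?TY ?TX R"
    by (rule homeomorphic_maps_imp_map)
  have "R ` G = feats X"
  proof -
    have "R (restrict (f \<circ> k) ?Q) = f" if "f \<in> feats X" for f
    proof (rule extensionalityI)
      show "f \<in> extensional ?P" using ext that by blast
    qed (auto simp: R_def compose_def)
    then show ?thesis by (force simp: G_def image_image)
  qed
  then have "R ` feats_closure Y = feats_closure X"
    using homeomorphic_map_closure_of[OF hom, of G]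
    by (simp add: feats_closure_def G_def image_subset_iff)
  moreover have "distr (meas X) \<nu> j = \<nu>"
    unfolding \<nu>_def by (rule distr_cong) auto
  moreover have "j \<in> measurable (meas X) \<nu>"
    using meas_j by (simp add: \<nu>_def)
  ultimately have "data_iso X Y"
    unfolding data_iso_def R_def by (intro bexI[of _ j]) auto
  with gY show ?thesis by (auto simp: iso_class_def)
qed

definition data_classes :: "data_class set" where
  "data_classes = {iso_class X |X :: (nat \<Rightarrow> real) data_set. geometric_data_set X}"

definition data_classes_K :: "data_class set" where
  "data_classes_K = {iso_class X |X :: (nat \<Rightarrow> real) data_set. geometric_data_set X \<and>
     (\<forall>f\<in>feats X. \<forall>x\<in>pts X. f x \<in> {-1/2..1/2})}"


section \<open>The box distance\<close>

definition couplings :: "'a data_set \<Rightarrow> 'b data_set \<Rightarrow> ('a \<times> 'b) measure set" where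
  "couplings X Y = {\<pi>. prob_space \<pi> \<and>
     sets \<pi> = sets (borel_of (prod_topology (data_top X) (data_top Y))) \<and>
     distr \<pi> (meas X) fst = meas X \<and> distr \<pi> (meas Y) snd = meas Y}"

text \<open>For \<open>S = {}\<close> the supremum in \<^typ>\<open>ennreal\<close> is \<open>0\<close>, as required.\<close>

definition sup_dist_on :: "'c set \<Rightarrow> ('c \<Rightarrow> real) \<Rightarrow> ('c \<Rightarrow> real) \<Rightarrow> ennreal" where
  "sup_dist_on S u v = (SUP z\<in>S. ennreal \<bar>u z - v z\<bar>)"

definition hausdorff_dist :: "('c \<Rightarrow> 'c \<Rightarrow> ennreal) \<Rightarrow> 'c set \<Rightarrow> 'c set \<Rightarrow> ennreal" where
  "hausdorff_dist d A B = max (SUP a\<in>A. INF b\<in>B. d a b) (SUP b\<in>B. INF a\<in>A. d a b)"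

definition box_data :: "'a data_set \<Rightarrow> 'b data_set \<Rightarrow> ennreal" where
  "box_data X Y =
     (INF (\<pi>, S) \<in> couplings X Y \<times> {S. closedin (prod_topology (data_top X) (data_top Y)) S}.
        max (1 - emeasure \<pi> S)
            (2 * hausdorff_dist (sup_dist_on S)
                   ((\<lambda>f. f \<circ> fst) ` feats X) ((\<lambda>g. g \<circ> snd) ` feats Y)))"

text \<open>
  The common value of \<^const>\<open>box_data\<close> on the members of two isomorphism classes.  It is at most
  \<open>1\<close> (take \<open>S = {}\<close>), so that passing to \<^typ>\<open>real\<close> loses nothing.
\<close>

definition box_dist :: "data_class \<Rightarrow> data_class \<Rightarrow> real" where
  "box_dist a b =
     (if a \<in> data_classes \<and> b \<in> data_classes
      then enn2real (the_elem (\<Union>X\<in>a. \<Union>Y\<in>b. {box_data X Y})) else 0)"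


section \<open>The compact screen\<close>

definition tau :: "real \<Rightarrow> real" where
  "tau r = tanh r / 2"

definition tau_dist :: "'a data_set \<Rightarrow> 'a \<Rightarrow> 'a \<Rightarrow> real" where
  "tau_dist X = feature_dist (pts X) ((\<lambda>f. tau \<circ> f) ` feats X)"

abbreviation screen_top :: "'a data_set \<Rightarrow> ('a \<Rightarrow> real) topology" where
  "screen_top X \<equiv> Metric_space.mtopology
     (completion_pts (pts X) (tau_dist X)) (completion_dist (pts X) (tau_dist X))"

abbreviation screen_map :: "'a data_set \<Rightarrow> 'a \<Rightarrow> ('a \<Rightarrow> real)" where
  "screen_map X \<equiv> completion_map (pts X) (tau_dist X)"

definition screen_extension :: "'a data_set \<Rightarrow> ('a \<Rightarrow> real) \<Rightarrow> (('a \<Rightarrow> real) \<Rightarrow> real)" where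
  "screen_extension X f =
     (THE h. h \<in> extensional (topspace (screen_top X)) \<and>
             continuous_map (screen_top X) euclideanreal h \<and>
             (\<forall>x\<in>pts X. h (screen_map X x) = tau (f x)))"

definition measure_support :: "'a topology \<Rightarrow> 'a measure \<Rightarrow> 'a set" where
  "measure_support T \<nu> = {x \<in> topspace T. \<forall>U. openin T U \<and> x \<in> U \<longrightarrow> emeasure \<nu> U > 0}"

definition screen :: "'a data_set \<Rightarrow> ('a \<Rightarrow> real) data_set" where
  "screen X =
     (let \<nu> = distr (meas X) (borel_of (screen_top X)) (screen_map X);
          S = measure_support (screen_top X) \<nu>
      in \<lparr> pts = S,
           feats = (\<lambda>f. restrict (screen_extension X f) S) ` feats X,
           meas = restrict_space \<nu> S \<rparr>)"

text \<open>The union is over equal sets, since isomorphic data sets have isomorphic screens.\<close>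

definition screen_class :: "data_class \<Rightarrow> data_class" where
  "screen_class a = (\<Union>X\<in>a. iso_class (screen X))"

definition box_tau_dist :: "data_class \<Rightarrow> data_class \<Rightarrow> real" where
  "box_tau_dist a b = box_dist (screen_class a) (screen_class b)"

end

theory Submission
  imports Defs
begin

text \<open>
  Everything is read off from laws of feature sequences. A sequence of features dense for pointwise
  convergence embeds a data set isometrically into sequence space with the supremum distance, and
  the law of this embedding determines the isomorphism class: this yields the invariance and the
  injectivity of the compact screen.

  An upper bound for the box distance only requires random points of the two data sets at which
  dense feature sequences are uniformly close with high probability. Couplings are glued
  along countable partitions into small cells, which gives the triangle inequality. If
  the box distance of two \<open>K\<close>-valued data sets vanishes, matching features converge along a
  subsequence by compactness of \<open>K\<close>, and the limits have the same law.

  A \<open>K\<close>-valued data set is approximated by the screen of the data set whose features are the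
  preimages under \<open>tau\<close> of slightly contracted features. For completeness, the couplings of
  a rapidly converging sequence of data sets are discretized and composed to a Markov chain; along
  it the values of a countable family of chains of matching features converge almost
  surely, and the law of the limiting sequence is the law of the limit data set.
\<close>

text \<open>Countable sequences of features suffice because all features are 1-Lipschitz: agreement
  at finitely many points spreads to small balls around them. The law of such a sequence also
  recovers the points, through full support and completeness. The contraction in the density
  argument is forced by features that approach \<plusminus>1/2, whose preimages under
  \<open>tau\<close> would be infinite or at uncontrolled distances. Values confined to a smaller
  interval make the new distance equivalent to the old one, which preserves completeness. For
  completeness of the space of classes, infinitely many couplings have to be composed. On countable
  state spaces conditional probabilities are elementary quotients, so the composition is carried out
  for cells instead of points; cells shrinking like 2^-n make the discretization error summable
  together with the box distances. The chains of matching features must pass through a dense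
  sequence at every level, and are therefore extended both forwards and backwards, since bounding
  the Box distance to the limit requires dense features at each level.\<close>

section \<open>Pointwise closures and dense sequences of features\<close>

text \<open>
  Adherence for pointwise convergence on \<open>A\<close>, blind to the values off \<open>A\<close>; compositions with maps
  into \<open>A\<close> therefore need no restriction to a carrier.
\<close>

definition pw_adherent :: "'a set \<Rightarrow> ('a \<Rightarrow> real) set \<Rightarrow> ('a \<Rightarrow> real) \<Rightarrow> bool" where
  "pw_adherent A G h \<longleftrightarrow> (\<forall>B \<epsilon>. finite B \<longrightarrow> B \<subseteq> A \<longrightarrow> \<epsilon> > 0 \<longrightarrow> (\<exists>f\<in>G. \<forall>b\<in>B. \<bar>f b - h b\<bar> < \<epsilon>))"

lemma pw_adherentE:
  assumes "pw_adherent A G h" "finite B" "B \<subseteq> A" "\<epsilon> > 0"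
  obtains f where "f \<in> G" "\<And>b. b \<in> B \<Longrightarrow> \<bar>f b - h b\<bar> < \<epsilon>"
proof -
  from assms(1)[unfolded pw_adherent_def, rule_format, OF assms(2-4)] show ?thesis using that by blast
qed

lemma pw_adherent_superset: "h \<in> G \<Longrightarrow> pw_adherent A G h"
  unfolding pw_adherent_def by (intro allI impI bexI[of _ h]) auto

lemma pw_adherent_trans:
  assumes "pw_adherent A G h" "\<And>g. g \<in> G \<Longrightarrow> pw_adherent A H g"
  shows "pw_adherent A H h"
  unfolding pw_adherent_def
proof (intro allI impI)
  fix B \<epsilon> assume B: "finite B" "B \<subseteq> A" "(\<epsilon>::real) > 0"
  obtain g where g: "g \<in> G" "\<And>b. b \<in> B \<Longrightarrow> \<bar>g b - h b\<bar> < \<epsilon>/2"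
    using pw_adherentE[OF assms(1) B(1,2) half_gt_zero[OF B(3)]] by blast
  obtain f where "f \<in> H" "\<And>b. b \<in> B \<Longrightarrow> \<bar>f b - g b\<bar> < \<epsilon>/2"
    using pw_adherentE[OF assms(2)[OF g(1)] B(1,2) half_gt_zero[OF B(3)]] by blast
  with g(2) show "\<exists>f\<in>H. \<forall>b\<in>B. \<bar>f b - h b\<bar> < \<epsilon>"
    by (smt (verit) field_sum_of_halves)
qed

lemma pw_adherent_cong:
  assumes "pw_adherent A G h" "\<And>a. a \<in> A \<Longrightarrow> h a = h' a"
  shows "pw_adherent A G h'"
  unfolding pw_adherent_def
proof (intro allI impI)
  fix B \<epsilon> assume B: "finite B" "B \<subseteq> A" "(\<epsilon>::real) > 0"
  obtain g where g: "g \<in> G" "\<And>b. b \<in> B \<Longrightarrow> \<bar>g b - h b\<bar> < \<epsilon>"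
    using pw_adherentE[OF assms(1) B] by blast
  moreover have "h' b = h b" if "b \<in> B" for b using assms(2) B(2) that by auto
  ultimately show "\<exists>f\<in>G. \<forall>b\<in>B. \<bar>f b - h' b\<bar> < \<epsilon>"
    by (intro bexI[of _ g]) auto
qed

text \<open>Precomposition with \<open>\<phi>\<close> is continuous for pointwise convergence,
  because finitely many test points have finitely many images.\<close>

lemma pw_adherent_transfer:
  assumes "pw_adherent A G h" "\<phi> ` A' \<subseteq> A" "\<And>g. g \<in> G \<Longrightarrow> \<exists>g'\<in>G'. \<forall>a\<in>A'. g' a = g (\<phi> a)"
  shows "pw_adherent A' G' (\<lambda>a. h (\<phi> a))"
  unfolding pw_adherent_def
proof (intro allI impI)
  fix B \<epsilon> assume B: "finite B" "B \<subseteq> A'" "(\<epsilon>::real) > 0"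
  obtain g where g: "g \<in> G" "\<And>b. b \<in> \<phi> ` B \<Longrightarrow> \<bar>g b - h b\<bar> < \<epsilon>"
    using pw_adherentE[OF assms(1) finite_imageI[OF B(1)] _ B(3), of \<phi>] assms(2) B(2) by blast
  obtain g' where "g'\<in>G'" "\<forall>a\<in>A'. g' a = g (\<phi> a)" using assms(3)[OF g(1)] by blast
  with B(2) g(2) show "\<exists>f\<in>G'. \<forall>b\<in>B. \<bar>f b - h (\<phi> b)\<bar> < \<epsilon>"
    by (intro bexI[of _ g']) auto
qed

lemma pw_adherent_closed_range:
  assumes "pw_adherent A G h" "\<And>g. g \<in> G \<Longrightarrow> g a \<in> K" "a \<in> A" "closed K"
  shows "h a \<in> K"
proof -
  have "\<exists>k\<in>K. dist k (h a) < e" if "e > 0" for e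
    using pw_adherentE[OF assms(1), of "{a}" e] that assms(2,3) by (auto simp: dist_real_def)
  then show ?thesis using closed_approachable[OF assms(4)] by blast
qed

text \<open>A basic neighbourhood in the product constrains finitely many coordinates, each by an
  open set that contains a ball; the smallest of the radii gives the \<epsilon>-criterion. This
  connects \<open>pw_adherent\<close> with \<open>feats_closure\<close>.\<close>

lemma closure_of_product_real:
  assumes "G \<subseteq> extensional A"
  shows "product_topology (\<lambda>_. euclideanreal) A closure_of G = {h \<in> extensional A. pw_adherent A G h}"
    (is "?T closure_of G = _")
proof (intro equalityI subsetI)
  fix h assume h: "h \<in> ?T closure_of G"
  then have ext: "h \<in> extensional A" by (auto simp: in_closure_of PiE_def)
  have "pw_adherent A G h"
    unfolding pw_adherent_def
  proof (intro allI impI)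
    fix B \<epsilon> assume B: "finite B" "B \<subseteq> A" "(\<epsilon>::real) > 0"
    define U where "U = (\<lambda>a. if a \<in> B then ball (h a) \<epsilon> else UNIV)"
    have "finite {i \<in> A. U i \<noteq> topspace euclideanreal}"
      by (rule finite_subset[OF _ B(1)]) (auto simp: U_def)
    then have "openin ?T (Pi\<^sub>E A U)"
      by (subst openin_PiE_gen) (auto simp: U_def)
    moreover have "h \<in> Pi\<^sub>E A U" using ext B(3) by (auto simp: U_def PiE_iff)
    ultimately obtain f where "f \<in> G" "f \<in> Pi\<^sub>E A U" using h by (auto simp: in_closure_of)
    then show "\<exists>f\<in>G. \<forall>b\<in>B. \<bar>f b - h b\<bar> < \<epsilon>"
      using B(2) by (intro bexI[of _ f]) (auto simp: U_def PiE_iff dist_real_def subset_eq abs_minus_commute split: if_splits)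
  qed
  with ext show "h \<in> {h \<in> extensional A. pw_adherent A G h}" by simp
next
  fix h assume "h \<in> {h \<in> extensional A. pw_adherent A G h}"
  then have h: "h \<in> extensional A" "pw_adherent A G h" by auto
  show "h \<in> ?T closure_of G"
    unfolding in_closure_of
  proof (intro conjI allI impI)
    show "h \<in> topspace ?T" using h by (simp add: PiE_def)
    fix T assume T: "h \<in> T \<and> openin ?T T"
    then obtain U where U: "finite {i \<in> A. U i \<noteq> UNIV}" "\<forall>i\<in>A. open (U i)" "h \<in> Pi\<^sub>E A U" "Pi\<^sub>E A U \<subseteq> T"
      by (auto simp: openin_product_topology_alt)
    define B where "B = {i \<in> A. U i \<noteq> UNIV}"
    have "\<forall>i\<in>B. \<exists>e>0. ball (h i) e \<subseteq> U i"
      using U by (auto simp: B_def open_contains_ball PiE_iff)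
    then obtain e where e: "\<And>i. i \<in> B \<Longrightarrow> e i > (0::real) \<and> ball (h i) (e i) \<subseteq> U i" by metis
    \<comment> \<open>The extra \<open>1\<close> keeps the minimum meaningful when \<open>B\<close>
      is empty.\<close>
    define \<epsilon> where "\<epsilon> = Min (insert 1 (e ` B))"
    have B: "finite B" using U by (simp add: B_def)
    have "\<epsilon> > 0" using B e by (auto simp: \<epsilon>_def)
    moreover have "\<epsilon> \<le> e b" if "b \<in> B" for b using B that by (auto simp: \<epsilon>_def)
    moreover have "B \<subseteq> A" by (auto simp: B_def)
    ultimately obtain f where "f \<in> G" "\<And>b. b \<in> B \<Longrightarrow> \<bar>f b - h b\<bar> < \<epsilon>"
      using pw_adherentE[OF h(2) B] by blast
    with \<open>\<And>b. b \<in> B \<Longrightarrow> \<epsilon> \<le> e b\<close>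
    have f: "f \<in> G" "\<And>b. b \<in> B \<Longrightarrow> \<bar>f b - h b\<bar> < e b" by force+
    have "f i \<in> U i" if i: "i \<in> A" for i
    proof (cases "i \<in> B")
      case True
      then have "f i \<in> ball (h i) (e i)" using f(2)[of i] by (simp add: dist_real_def abs_minus_commute)
      with e True show ?thesis by blast
    qed (use i in \<open>simp add: B_def\<close>)
    then have "f \<in> Pi\<^sub>E A U" using assms f(1) by (auto simp: PiE_iff)
    then show "\<exists>y. y \<in> G \<and> y \<in> T" using U(4) f(1) by blast
  qed
qed

text \<open>
  The terms may be pointwise limits of features: this is what survives transport along an
  isomorphism, which only identifies the closures of the feature sets.
\<close>

definition dense_features :: "'a data_set \<Rightarrow> (nat \<Rightarrow> 'a \<Rightarrow> real) \<Rightarrow> bool" where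
  "dense_features X f \<longleftrightarrow> (\<forall>k. pw_adherent (pts X) (feats X) (f k)) \<and> (\<forall>h\<in>feats X. pw_adherent (pts X) (range f) h)"

definition feature_law :: "'a data_set \<Rightarrow> (nat \<Rightarrow> 'a \<Rightarrow> real) \<Rightarrow> (nat \<Rightarrow> real) measure" where
  "feature_law X f = distr (meas X) (PiM UNIV (\<lambda>_. borel)) (\<lambda>x k. f k x)"

section \<open>Borel sets and measurability for abstract topologies\<close>

lemma sets_borel_of: "sets (borel_of T) = sigma_sets (topspace T) {U. openin T U}"
  unfolding borel_of_def by (rule sets_measure_of) (auto dest: openin_subset)

lemma space_borel_of [simp]: "space (borel_of T) = topspace T"
  by (simp add: borel_of_def space_measure_of_conv)

lemma borel_of_open: "openin T U \<Longrightarrow> U \<in> sets (borel_of T)"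
  by (simp add: sets_borel_of sigma_sets.Basic)

lemma borel_of_closed:
  assumes "closedin T S" shows "S \<in> sets (borel_of T)"
proof -
  have "topspace T - S \<in> sets (borel_of T)"
    using assms by (intro borel_of_open) auto
  then have "space (borel_of T) - (topspace T - S) \<in> sets (borel_of T)" by (rule sets.compl_sets)
  moreover have "space (borel_of T) - (topspace T - S) = S"
    using closedin_subset[OF assms] by auto
  ultimately show ?thesis by simp
qed

lemma measurable_borel_of:
  assumes "g \<in> space N \<rightarrow> topspace T"
    "\<And>U. openin T U \<Longrightarrow> {\<omega>\<in>space N. g \<omega> \<in> U} \<in> sets N"
  shows "g \<in> measurable N (borel_of T)"
  unfolding borel_of_def
proof (rule measurable_measure_of)
  show "{U. openin T U} \<subseteq> Pow (topspace T)" by (auto dest: openin_subset)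
  fix U assume "U \<in> {U. openin T U}"
  moreover have "g -` U \<inter> space N = {\<omega>\<in>space N. g \<omega> \<in> U}" by auto
  ultimately show "g -` U \<inter> space N \<in> sets N" using assms(2) by simp
qed (use assms in auto)

lemma measurable_continuous_borel_of:
  assumes "continuous_map T T' g"
  shows "g \<in> measurable (borel_of T) (borel_of T')"
proof (rule measurable_borel_of)
  show "g \<in> space (borel_of T) \<rightarrow> topspace T'"
    using assms by (simp add: continuous_map_def)
  fix U assume "openin T' U"
  from openin_continuous_map_preimage[OF assms this]
  show "{\<omega>\<in>space (borel_of T). g \<omega> \<in> U} \<in> sets (borel_of T)"
    by (simp add: borel_of_open)
qed

lemma sets_borel_of_euclidean: "sets (borel_of euclidean) = sets borel"
  by (simp add: sets_borel_of borel_def sets_measure_of)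

text \<open>By separability every open set is a countable union of closed balls with centres
  \<open>s n\<close> and radii 1/(m+1). Closed balls are used because for a supremum distance they
  are countable intersections of conditions on single features.\<close>

lemma (in Metric_space) measurable_borel_of_mtopology:
  assumes s: "\<And>n::nat. s n \<in> M" "\<And>x r. x \<in> M \<Longrightarrow> r > 0 \<Longrightarrow> \<exists>n. d (s n) x < r"
    and g: "g \<in> space N \<rightarrow> M"
    and m: "\<And>x r. x \<in> M \<Longrightarrow> {\<omega>\<in>space N. d x (g \<omega>) \<le> r} \<in> sets N"
  shows "g \<in> measurable N (borel_of mtopology)"
proof (rule measurable_borel_of)
  show "g \<in> space N \<rightarrow> topspace mtopology" using g by simp
  fix U assume U: "openin mtopology U"
  define I where "I = {(n, m). mcball (s n) (1 / real (Suc m)) \<subseteq> U}"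
  have "{\<omega>\<in>space N. g \<omega> \<in> U} = (\<Union>(n,m)\<in>I. {\<omega>\<in>space N. d (s n) (g \<omega>) \<le> 1 / real (Suc m)})"
  proof (intro equalityI subsetI)
    fix \<omega> assume "\<omega> \<in> {\<omega>\<in>space N. g \<omega> \<in> U}"
    then have w: "\<omega> \<in> space N" "g \<omega> \<in> U" "g \<omega> \<in> M" using g by auto
    then obtain r where r: "r > 0" "mball (g \<omega>) r \<subseteq> U" using U by (auto simp: openin_mtopology)
    obtain m where m: "1 / real (Suc m) < r/2"
      using reals_Archimedean[OF half_gt_zero[OF r(1)]] by (auto simp: inverse_eq_divide)
    obtain n where n: "d (s n) (g \<omega>) < 1 / real (Suc m)"
      using s(2)[OF w(3), of "1 / real (Suc m)"] by auto
    have "mcball (s n) (1 / real (Suc m)) \<subseteq> mball (g \<omega>) r"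
    proof
      fix y assume "y \<in> mcball (s n) (1 / real (Suc m))"
      then have y: "y \<in> M" "d (s n) y \<le> 1 / real (Suc m)" by auto
      then show "y \<in> mball (g \<omega>) r"
        using triangle[OF w(3) s(1)[of n] y(1)] n m w(3) commute[of "s n" "g \<omega>"] by simp
    qed
    with r have "(n, m) \<in> I" by (auto simp: I_def)
    with w n show "\<omega> \<in> (\<Union>(n,m)\<in>I. {\<omega>\<in>space N. d (s n) (g \<omega>) \<le> 1 / real (Suc m)})"
      by (intro UN_I[of "(n,m)"]) auto
  next
    fix \<omega> assume "\<omega> \<in> (\<Union>(n,m)\<in>I. {\<omega>\<in>space N. d (s n) (g \<omega>) \<le> 1 / real (Suc m)})"
    then obtain n m where "(n,m) \<in> I" "\<omega> \<in> space N" "d (s n) (g \<omega>) \<le> 1 / real (Suc m)" by auto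
    moreover have "g \<omega> \<in> mcball (s n) (1 / real (Suc m))"
      using g s(1) calculation(2,3) by auto
    ultimately show "\<omega> \<in> {\<omega>\<in>space N. g \<omega> \<in> U}"
      by (auto simp: I_def)
  qed
  also have "\<dots> \<in> sets N"
    by (intro sets.countable_UN'') (auto intro!: m s)
  finally show "{\<omega>\<in>space N. g \<omega> \<in> U} \<in> sets N" .
qed

lemma (in Metric_space) lip_continuous:
  assumes "\<And>x y. x \<in> M \<Longrightarrow> y \<in> M \<Longrightarrow> \<bar>h x - h y\<bar> \<le> d x y"
  shows "continuous_map mtopology euclideanreal h"
proof -
  have "continuous_map mtopology (Met_TC.mtopology) h"
    unfolding metric_continuous_map[OF Met_TC.Metric_space_axioms]
  proof (intro conjI ballI allI impI)
    fix a \<epsilon> assume "a \<in> M" "(\<epsilon>::real) > 0"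
    then show "\<exists>\<delta>>0. \<forall>x. x \<in> M \<and> d a x < \<delta> \<longrightarrow> dist (h a) (h x) < \<epsilon>"
      using assms by (intro exI[of _ \<epsilon>]) (auto simp: dist_real_def intro: order_le_less_trans)
  qed auto
  then show ?thesis by simp
qed

section \<open>Distances given by a family of functions\<close>

lemma feature_dist_upper:
  assumes "bdd_above ((\<lambda>f. \<bar>f x - f y\<bar>) ` F)" "f \<in> F" "x \<in> M" "y \<in> M"
  shows "\<bar>f x - f y\<bar> \<le> feature_dist M F x y"
  using assms by (auto simp: feature_dist_def intro: cSUP_upper)

lemma feature_dist_least:
  assumes "F \<noteq> {}" "x \<in> M" "y \<in> M" "\<And>f. f \<in> F \<Longrightarrow> \<bar>f x - f y\<bar> \<le> c"
  shows "feature_dist M F x y \<le> c"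
  using assms by (auto simp: feature_dist_def intro: cSUP_least)

lemma Metric_space_feature_dist:
  assumes F: "F \<noteq> {}" and bdd: "\<And>x y. x \<in> M \<Longrightarrow> y \<in> M \<Longrightarrow> bdd_above ((\<lambda>f. \<bar>f x - f y\<bar>) ` F)"
    and sep: "\<And>x y. x \<in> M \<Longrightarrow> y \<in> M \<Longrightarrow> (\<And>f. f \<in> F \<Longrightarrow> f x = f y) \<Longrightarrow> x = y"
  shows "Metric_space M (feature_dist M F)"
proof
  obtain f where f: "f \<in> F" using F by blast
  have up: "\<bar>f x - f y\<bar> \<le> feature_dist M F x y" if "f \<in> F" "x \<in> M" "y \<in> M" for f x y
    by (rule feature_dist_upper[OF bdd[OF that(2,3)] that])
  have off: "feature_dist M F x y = 0" if "\<not> (x \<in> M \<and> y \<in> M)" for x y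
    using that by (auto simp: feature_dist_def)
  show nn: "0 \<le> feature_dist M F x y" for x y
    using up[OF f, of x y] off[of x y] by (cases "x \<in> M \<and> y \<in> M") auto
  show "feature_dist M F x y = feature_dist M F y x" for x y
    by (simp add: feature_dist_def abs_minus_commute)
  fix x y assume xy: "x \<in> M" "y \<in> M"
  show "feature_dist M F x y = 0 \<longleftrightarrow> x = y"
  proof
    assume "feature_dist M F x y = 0"
    then have "f x = f y" if "f \<in> F" for f using up[OF that xy] by simp
    then show "x = y" by (rule sep[OF xy])
  next
    assume "x = y"
    then have "feature_dist M F x y \<le> 0" by (intro feature_dist_least[OF F xy]) simp
    then show "feature_dist M F x y = 0" using nn[of x y] by simp
  qed
  fix z assume z: "z \<in> M"
  show "feature_dist M F x z \<le> feature_dist M F x y + feature_dist M F y z"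
  proof (rule feature_dist_least[OF F xy(1) z])
    fix f assume "f \<in> F"
    from up[OF this xy] up[OF this xy(2) z]
    show "\<bar>f x - f z\<bar> \<le> feature_dist M F x y + feature_dist M F y z" by argo
  qed
qed

section \<open>Geometric data sets as separable complete metric spaces with a measure of full
  support\<close>

locale geom_data =
  fixes X :: "'a data_set"
  assumes geom_data: "geometric_data_set X"
begin

sublocale Metric_space "pts X" "data_dist X"
  using geom_data by (simp add: geometric_data_set_def)

sublocale P: prob_space "meas X"
  using geom_data by (simp add: geometric_data_set_def)

lemma feats_ne: "feats X \<noteq> {}" and feats_ext: "feats X \<subseteq> extensional (pts X)"
  and complete: mcomplete and separable: "separable_space mtopology"
  and sets_meas: "sets (meas X) = sets (borel_of mtopology)"
  and full: "\<And>U. openin mtopology U \<Longrightarrow> U \<noteq> {} \<Longrightarrow> emeasure (meas X) U > 0"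
  and bdd: "\<And>x y. x \<in> pts X \<Longrightarrow> y \<in> pts X \<Longrightarrow> bdd_above ((\<lambda>f. \<bar>f x - f y\<bar>) ` feats X)"
  using geom_data by (auto simp: geometric_data_set_def)

lemma space_meas [simp]: "space (meas X) = pts X"
  using sets_eq_imp_space_eq[OF sets_meas] by simp

lemma pts_ne: "pts X \<noteq> {}"
  using P.not_empty by simp

lemma closed_sets: "closedin mtopology S \<Longrightarrow> S \<in> sets (meas X)"
  by (simp add: sets_meas borel_of_closed)

lemma open_sets: "openin mtopology S \<Longrightarrow> S \<in> sets (meas X)"
  by (simp add: sets_meas borel_of_open)

lemma feat_lip: "f \<in> feats X \<Longrightarrow> x \<in> pts X \<Longrightarrow> y \<in> pts X \<Longrightarrow> \<bar>f x - f y\<bar> \<le> data_dist X x y"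
  by (rule feature_dist_upper[OF bdd])

lemma pw_adherent_lip:
  assumes "pw_adherent (pts X) (feats X) h" "x \<in> pts X" "y \<in> pts X"
  shows "\<bar>h x - h y\<bar> \<le> data_dist X x y"
proof (rule field_le_epsilon)
  fix e :: real assume "e > 0"
  then obtain f where f: "f \<in> feats X" "\<And>b. b \<in> {x,y} \<Longrightarrow> \<bar>f b - h b\<bar> < e/2"
    using pw_adherentE[OF assms(1), of "{x,y}" "e/2"] assms(2,3) by auto
  show "\<bar>h x - h y\<bar> \<le> data_dist X x y + e"
    using feat_lip[OF f(1) assms(2,3)] f(2)[of x] f(2)[of y] by (simp add: abs_if split: if_splits)
qed

text \<open>Distances can be bounded through any family whose pointwise closure contains the
  features, since each estimate tests only two points.\<close>

lemma dist_le:
  assumes "\<And>f. f \<in> feats X \<Longrightarrow> pw_adherent (pts X) G f" "x \<in> pts X" "y \<in> pts X"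
    "\<And>g. g \<in> G \<Longrightarrow> \<bar>g x - g y\<bar> \<le> c"
  shows "data_dist X x y \<le> c"
proof -
  have "\<bar>f x - f y\<bar> \<le> c" if f: "f \<in> feats X" for f
  proof (rule field_le_epsilon)
    fix e :: real assume "e > 0"
    then obtain g where g: "g \<in> G" "\<And>b. b \<in> {x,y} \<Longrightarrow> \<bar>g b - f b\<bar> < e/2"
      using pw_adherentE[OF assms(1)[OF f], of "{x,y}" "e/2"] assms(2,3) by auto
    show "\<bar>f x - f y\<bar> \<le> c + e"
      using assms(4)[OF g(1)] g(2)[of x] g(2)[of y] by (simp add: abs_if split: if_splits)
  qed
  then show ?thesis by (rule feature_dist_least[OF feats_ne assms(2,3)])
qed

lemma dense_features_dist_le:
  assumes "dense_features X f" "x \<in> pts X" "y \<in> pts X" "\<And>k. \<bar>f k x - f k y\<bar> \<le> c"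
  shows "data_dist X x y \<le> c"
  by (rule dist_le[of "range f"]) (use assms in \<open>auto simp: dense_features_def\<close>)

lemma dense_features_lip: "dense_features X f \<Longrightarrow> x \<in> pts X \<Longrightarrow> y \<in> pts X \<Longrightarrow> \<bar>f k x - f k y\<bar> \<le> data_dist X x y"
  using pw_adherent_lip by (simp add: dense_features_def)

lemma pw_adherent_continuous: "pw_adherent (pts X) (feats X) h \<Longrightarrow> continuous_map mtopology euclideanreal h"
  using lip_continuous pw_adherent_lip by blast

lemma continuous_measurable:
  "continuous_map mtopology euclideanreal h \<Longrightarrow> h \<in> borel_measurable (meas X)"
  using measurable_continuous_borel_of[of mtopology euclideanreal h]
  by (simp add: measurable_cong_sets[OF sets_meas] measurable_cong_sets[OF refl sets_borel_of_euclidean])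

lemma pw_adherent_measurable: "pw_adherent (pts X) (feats X) h \<Longrightarrow> h \<in> borel_measurable (meas X)"
  using pw_adherent_continuous continuous_measurable by blast

lemma dense_features_measurable: "dense_features X f \<Longrightarrow> f k \<in> borel_measurable (meas X)"
  by (simp add: dense_features_def pw_adherent_measurable)

lemma dense_seq:
  obtains s :: "nat \<Rightarrow> 'a" where "\<And>n. s n \<in> pts X"
    "\<And>x r. x \<in> pts X \<Longrightarrow> r > 0 \<Longrightarrow> \<exists>n. data_dist X (s n) x < r"
proof -
  obtain C where C: "countable C" "C \<subseteq> pts X" "mtopology closure_of C = pts X"
    using separable by (auto simp: separable_space_def)
  have "C \<noteq> {}" using C(3) pts_ne by auto
  show ?thesis
  proof (rule that[of "from_nat_into C"])
    show "from_nat_into C n \<in> pts X" for n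
      using from_nat_into[OF \<open>C \<noteq> {}\<close>] C(2) by blast
    fix x r assume "x \<in> pts X" "(r::real) > 0"
    then have "x \<in> mtopology closure_of C" using C by simp
    then obtain c where "c \<in> C" "data_dist X x c < r"
      using \<open>r > 0\<close> by (force simp: metric_closure_of)
    then show "\<exists>n. data_dist X (from_nat_into C n) x < r"
      using C(1) from_nat_into_surj commute by metis
  qed
qed

lemma measurable_into:
  assumes "g \<in> space N \<rightarrow> pts X"
    "\<And>x r. x \<in> pts X \<Longrightarrow> {\<omega>\<in>space N. data_dist X x (g \<omega>) \<le> r} \<in> sets N"
  shows "g \<in> measurable N (meas X)"
proof -
  obtain s :: "nat \<Rightarrow> 'a" where s: "\<And>n. s n \<in> pts X"
    "\<And>x r. x \<in> pts X \<Longrightarrow> r > 0 \<Longrightarrow> \<exists>n. data_dist X (s n) x < r"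
    using dense_seq by blast
  show ?thesis
    unfolding measurable_cong_sets[OF refl sets_meas]
    by (rule measurable_borel_of_mtopology[OF s assms])
qed

lemma measurable_into_dense_features:
  assumes f: "dense_features X f" and g: "g \<in> space N \<rightarrow> pts X"
    and m: "\<And>k. (\<lambda>\<omega>. f k (g \<omega>)) \<in> borel_measurable N"
  shows "g \<in> measurable N (meas X)"
proof (rule measurable_into[OF g])
  fix x r assume x: "x \<in> pts X"
  have "{\<omega>\<in>space N. data_dist X x (g \<omega>) \<le> r} = {\<omega>\<in>space N. \<forall>k. \<bar>f k x - f k (g \<omega>)\<bar> \<le> r}"
    using g by (intro Collect_cong conj_cong refl)
      (auto intro!: dense_features_dist_le[OF f x] intro: order_trans[OF dense_features_lip[OF f x]])
  also have "\<dots> \<in> sets N" using m by measurable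
  finally show "{\<omega>\<in>space N. data_dist X x (g \<omega>) \<le> r} \<in> sets N" .
qed

text \<open>Evaluated along a dense sequence of points, the features form a subset of the second
  countable space of real sequences and so contain a countable dense part. The common Lipschitz
  bound carries the approximation from the dense points to all points.\<close>

lemma dense_features_exists:
  obtains f where "dense_features X f" "\<And>k. f k \<in> feats X"
proof -
  obtain s :: "nat \<Rightarrow> 'a" where s: "\<And>n. s n \<in> pts X"
    "\<And>x r. x \<in> pts X \<Longrightarrow> r > 0 \<Longrightarrow> \<exists>n. data_dist X (s n) x < r"
    using dense_seq by blast
  let ?R = "\<lambda>f n. f (s n)"
  obtain T where T: "countable T" "T \<subseteq> ?R ` feats X" "?R ` feats X \<subseteq> closure T"
    using Topology_Euclidean_Space.separable[of "?R ` feats X"] by blast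
  \<comment> \<open>Injectivity lets the countability of \<open>T\<close> pass back to the chosen
    features.\<close>
  from T(2) obtain T' where T': "T' \<subseteq> feats X" "T = ?R ` T'" "inj_on ?R T'"
    using subset_image_inj[of T ?R "feats X"] by auto
  have "countable T'" using T(1) T'(2,3) countable_image_inj_on by blast
  have "T' \<noteq> {}" using T T'(2) feats_ne by auto
  define f where "f = from_nat_into T'"
  have rf: "range f = T'" using \<open>countable T'\<close> \<open>T' \<noteq> {}\<close> by (simp add: f_def)
  have "pw_adherent (pts X) T' h" if h: "h \<in> feats X" for h
    unfolding pw_adherent_def
  proof (intro allI impI)
    fix B \<epsilon> assume B: "finite B" "B \<subseteq> pts X" "(\<epsilon>::real) > 0"
    have "\<forall>b\<in>B. \<exists>n. data_dist X (s n) b < \<epsilon>/3" by (intro ballI s(2)) (use B in auto)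
    then obtain n where n: "\<And>b. b \<in> B \<Longrightarrow> data_dist X (s (n b)) b < \<epsilon>/3" by metis
    define U where "U = (\<Inter>b\<in>B. {w :: nat \<Rightarrow> real. \<bar>w (n b) - h (s (n b))\<bar> < \<epsilon>/3})"
    have "open U" unfolding U_def
      by (intro open_INT B(1) ballI open_Collect_less continuous_intros continuous_on_product_coordinates)
    moreover have "?R h \<in> U" using B(3) by (auto simp: U_def)
    moreover have "?R h \<in> closure T" using T(3) h by blast
    ultimately obtain w where "w \<in> T" "w \<in> U"
      using closure_iff_nhds_not_empty[of "?R h" T] by blast
    then obtain g where g: "g \<in> T'" "\<And>b. b \<in> B \<Longrightarrow> \<bar>g (s (n b)) - h (s (n b))\<bar> < \<epsilon>/3"
      using T'(2) by (auto simp: U_def)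
    have "\<bar>g b - h b\<bar> < \<epsilon>" if b: "b \<in> B" for b
    proof -
      have "b \<in> pts X" "g \<in> feats X" using b B g T' by auto
      then show ?thesis
        using feat_lip[OF _ s(1)[of "n b"], of g b] feat_lip[OF h s(1)[of "n b"], of b] n[OF b] g(2)[OF b]
        by linarith
    qed
    with g(1) show "\<exists>f\<in>T'. \<forall>b\<in>B. \<bar>f b - h b\<bar> < \<epsilon>" by blast
  qed
  then have "dense_features X f"
    unfolding dense_features_def rf using rf T'(1) by (auto intro!: pw_adherent_superset)
  with T'(1) rf show ?thesis using that by blast
qed

text \<open>A substitute for tightness: the closed \<eta>-balls around a dense sequence of points
  cover the space, so by continuity from below finitely many of them have mass above 1 - \<delta>.
  Closedness of their union allows it to enter the closed set \<open>S\<close> of the Box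
  distance.\<close>

lemma net:
  assumes "\<eta> > 0" "\<delta> > 0"
  obtains A where "finite A" "A \<subseteq> pts X" "closedin mtopology (\<Union>a\<in>A. mcball a \<eta>)"
    "P.prob (\<Union>a\<in>A. mcball a \<eta>) > 1 - \<delta>"
proof -
  obtain s :: "nat \<Rightarrow> 'a" where s: "\<And>n. s n \<in> pts X"
    "\<And>x r. x \<in> pts X \<Longrightarrow> r > 0 \<Longrightarrow> \<exists>n. data_dist X (s n) x < r"
    using dense_seq by blast
  define C where "C n = (\<Union>a\<in>s ` {..<n}. mcball a \<eta>)" for n
  have cl: "closedin mtopology (C n)" for n unfolding C_def by (intro closedin_Union) auto
  have "(\<lambda>n. P.prob (C n)) \<longlonglongrightarrow> P.prob (\<Union>n. C n)"
    by (rule P.finite_Lim_measure_incseq) (auto intro!: closed_sets cl simp: incseq_def, auto simp: C_def)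
  also have "(\<Union>n. C n) = space (meas X)"
  proof (intro equalityI subsetI)
    fix x assume "x \<in> space (meas X)"
    then obtain n where "data_dist X (s n) x < \<eta>" "x \<in> pts X" using s(2) assms by auto
    then have "x \<in> C (Suc n)" using s(1) by (auto simp: C_def intro!: bexI[of _ n])
    then show "x \<in> (\<Union>n. C n)" by blast
  qed (auto simp: C_def)
  finally have "(\<lambda>n. P.prob (C n)) \<longlonglongrightarrow> 1" by (simp only: P.prob_space)
  then have "\<exists>n. P.prob (C n) > 1 - \<delta>"
    using order_tendstoD(1)[of "\<lambda>n. P.prob (C n)" 1 sequentially "1 - \<delta>"] assms(2)
    by (auto simp: eventually_sequentially)
  then obtain n where "P.prob (C n) > 1 - \<delta>" ..
  then show ?thesis using that[of "s ` {..<n}"] cl[of n] s(1) by (auto simp: C_def)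
qed

end


section \<open>Laws of dense feature sequences determine the isomorphism class\<close>

lemma feats_closure_eq:
  assumes "geom_data X"
  shows "feats_closure X = {h \<in> extensional (pts X). pw_adherent (pts X) (feats X) h}"
  using closure_of_product_real[OF geom_data.feats_ext[OF assms]] by (simp add: feats_closure_def)

lemma (in geom_data) feature_law_measurable:
  "dense_features X f \<Longrightarrow> (\<lambda>x k. f k x) \<in> measurable (meas X) (PiM UNIV (\<lambda>_. borel))"
  by (rule measurable_PiM_single') (auto simp: space_PiM dense_features_measurable)

lemma (in geom_data) dense_features_closure:
  assumes "dense_features X f" "pw_adherent (pts X) (feats X) h"
  shows "pw_adherent (pts X) (range f) h"
  by (rule pw_adherent_trans[OF assms(2)]) (use assms(1) in \<open>auto simp: dense_features_def\<close>)

text \<open>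
  A closed ball around \<open>x\<close> is the preimage of a box in sequence space. Its mass is positive by full
  support, and by equality of the laws the same box has positive mass for \<open>Y\<close>. Letting the radius
  tend to \<open>0\<close>, completeness of \<open>Y\<close> provides the matching point.
\<close>

lemma feature_law_eq_match:
  assumes "geom_data X" "geom_data Y" "dense_features X f" "dense_features Y g" "feature_law X f = feature_law Y g" "x \<in> pts X"
  shows "\<exists>y\<in>pts Y. \<forall>k. g k y = f k x"
proof -
  interpret X: geom_data X by fact
  interpret Y: geom_data Y by fact
  have "\<exists>y\<in>pts Y. \<forall>k. \<bar>f k x - g k y\<bar> \<le> r" if "r > 0" for r
  proof -
    define B where "B = {w\<in>space (PiM UNIV (\<lambda>_. borel)). \<forall>k. \<bar>f k x - w k\<bar> \<le> r}"
    have B: "B \<in> sets (PiM UNIV (\<lambda>_::nat. borel :: real measure))" unfolding B_def by measurable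
    have "X.mball x r \<subseteq> (\<lambda>x k. f k x) -` B \<inter> space (meas X)"
      by (auto simp: B_def space_PiM intro!: order_trans[OF X.dense_features_lip[OF assms(3)] less_imp_le])
    then have "emeasure (meas X) (X.mball x r) \<le> emeasure (meas X) ((\<lambda>x k. f k x) -` B \<inter> space (meas X))"
      by (rule emeasure_mono) (rule measurable_sets[OF X.feature_law_measurable[OF assms(3)] B])
    also have "\<dots> = emeasure (feature_law X f) B"
      unfolding feature_law_def by (rule emeasure_distr[symmetric, OF X.feature_law_measurable[OF assms(3)] B])
    also have "\<dots> = emeasure (feature_law Y g) B" using assms by simp
    also have "\<dots> = emeasure (meas Y) ((\<lambda>x k. g k x) -` B \<inter> space (meas Y))"
      unfolding feature_law_def by (rule emeasure_distr[OF Y.feature_law_measurable[OF assms(4)] B])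
    finally have "emeasure (meas Y) ((\<lambda>x k. g k x) -` B \<inter> space (meas Y)) > 0"
      using X.full[of "X.mball x r"] assms(6) that X.centre_in_mball_iff by fastforce
    then have "(\<lambda>x k. g k x) -` B \<inter> space (meas Y) \<noteq> {}" by auto
    then show ?thesis by (auto simp: B_def)
  qed
  then have "\<forall>n. \<exists>y\<in>pts Y. \<forall>k. \<bar>f k x - g k y\<bar> \<le> inverse (real (Suc n))" by simp
  then obtain y where y: "\<And>n. y n \<in> pts Y" "\<And>n k. \<bar>f k x - g k (y n)\<bar> \<le> inverse (real (Suc n))"
    by metis
  have d: "data_dist Y (y m) (y n) \<le> inverse (real (Suc m)) + inverse (real (Suc n))" for m n
  proof (rule Y.dense_features_dist_le[OF assms(4) y(1) y(1)])
    fix k show "\<bar>g k (y m) - g k (y n)\<bar> \<le> inverse (real (Suc m)) + inverse (real (Suc n))"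
      using y(2)[of k m] y(2)[of k n] by linarith
  qed
  have "Y.MCauchy y"
    unfolding Y.MCauchy_def
  proof (intro conjI allI impI)
    fix e :: real assume "e > 0"
    then obtain N where N: "inverse (real (Suc N)) < e/2" using reals_Archimedean half_gt_zero by blast
    show "\<exists>N. \<forall>n n'. N \<le> n \<longrightarrow> N \<le> n' \<longrightarrow> data_dist Y (y n) (y n') < e"
    proof (intro exI[of _ N] allI impI)
      fix n n' assume n: "N \<le> n" "N \<le> n'"
      have "inverse (real (Suc m)) \<le> inverse (real (Suc N))" if "N \<le> m" for m
        using that by (intro le_imp_inverse_le) auto
      from this[OF n(1)] this[OF n(2)] d[of n n'] N show "data_dist Y (y n) (y n') < e" by linarith
    qed
  qed (use y in auto)
  then obtain z where z: "limitin Y.mtopology y z sequentially"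
    using Y.complete by (auto simp: Y.mcomplete_def)
  then have zY: "z \<in> pts Y" using limitin_topspace by fastforce
  have "g k z = f k x" for k
  proof -
    have "limitin euclideanreal (g k \<circ> y) (g k z) sequentially"
      by (rule continuous_map_limit[OF Y.pw_adherent_continuous z]) (use assms(4) in \<open>simp add: dense_features_def\<close>)
    then have 1: "(\<lambda>n. g k (y n)) \<longlonglongrightarrow> g k z" by (simp add: o_def)
    have "(\<lambda>n. g k (y n)) \<longlonglongrightarrow> f k x"
    proof (rule LIMSEQ_I)
      fix e :: real assume "e > 0"
      then obtain N where N: "inverse (real (Suc N)) < e" using reals_Archimedean by blast
      have "norm (g k (y n) - f k x) < e" if "n \<ge> N" for n
      proof -
        have "inverse (real (Suc n)) \<le> inverse (real (Suc N))"
          using that by (intro le_imp_inverse_le) auto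
        then show ?thesis using y(2)[of k n] N
          unfolding real_norm_def abs_minus_commute[of "g k (y n)"] by linarith
      qed
      then show "\<exists>no. \<forall>n\<ge>no. norm (g k (y n) - f k x) < e" by blast
    qed
    with 1 show ?thesis using LIMSEQ_unique by blast
  qed
  with zY show ?thesis by blast
qed

text \<open>Matching points by equal coordinates gives the map. Its measurability, the transport of
  the measure and the transport of the feature closures are all read off from coordinates, because
  these generate the Borel sets and are dense among the features.\<close>

theorem feature_law_eq_imp_iso:
  assumes "geom_data X" "geom_data Y" and f: "dense_features X f" and g: "dense_features Y g" and eq: "feature_law X f = feature_law Y g"
  shows "data_iso X Y"
proof -
  interpret X: geom_data X by fact
  interpret Y: geom_data Y by fact
  have "\<forall>x\<in>pts X. \<exists>y\<in>pts Y. \<forall>k. g k y = f k x"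
    using feature_law_eq_match[OF assms] by blast
  then obtain \<phi> where \<phi>: "\<And>x. x \<in> pts X \<Longrightarrow> \<phi> x \<in> pts Y" "\<And>x k. x \<in> pts X \<Longrightarrow> g k (\<phi> x) = f k x"
    by metis
  have "\<forall>y\<in>pts Y. \<exists>x\<in>pts X. \<forall>k. f k x = g k y"
    using feature_law_eq_match[OF assms(2,1,4,3) eq[symmetric]] by blast
  then obtain \<psi> where \<psi>: "\<And>y. y \<in> pts Y \<Longrightarrow> \<psi> y \<in> pts X" "\<And>y k. y \<in> pts Y \<Longrightarrow> f k (\<psi> y) = g k y"
    by metis
  \<comment> \<open>Points with equal coordinates coincide, because dense features determine the
    distance.\<close>
  have \<psi>\<phi>: "\<psi> (\<phi> x) = x" if "x \<in> pts X" for x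
  proof -
    have "data_dist X (\<psi> (\<phi> x)) x \<le> 0"
      by (rule X.dense_features_dist_le[OF f]) (use that \<phi> \<psi> in auto)
    then show ?thesis using X.nonneg[of "\<psi> (\<phi> x)" x] X.zero[of "\<psi> (\<phi> x)" x] that \<phi> \<psi> by force
  qed
  have m: "\<phi> \<in> measurable (meas X) (meas Y)"
  proof (rule Y.measurable_into_dense_features[OF g])
    show "(\<lambda>\<omega>. g k (\<phi> \<omega>)) \<in> borel_measurable (meas X)" for k
      using X.dense_features_measurable[OF f, of k] measurable_cong[of "meas X" "\<lambda>\<omega>. g k (\<phi> \<omega>)" "f k"] \<phi> by simp
  qed (use \<phi> in auto)
  \<comment> \<open>The sigma-algebra generated by the coordinates \<open>g k\<close>. Measurability
    of the identity from \<open>?N\<close> shows that every Borel set of \<open>Y\<close> is the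
    preimage of a measurable set of sequences, where the two laws can be compared.\<close>
  let ?N = "vimage_algebra (pts Y) (\<lambda>y k. g k y) (PiM UNIV (\<lambda>_. borel))"
  have id: "(\<lambda>y. y) \<in> measurable ?N (meas Y)"
  proof (rule Y.measurable_into_dense_features[OF g])
    fix k
    have "(\<lambda>y k. g k y) \<in> measurable ?N (PiM UNIV (\<lambda>_. borel))"
      by (rule measurable_vimage_algebra1) (auto simp: space_PiM)
    from measurable_compose[OF this measurable_component_singleton[of k]]
    show "g k \<in> borel_measurable ?N" by simp
  qed simp
  have "distr (meas X) (meas Y) \<phi> = meas Y"
  proof (rule measure_eqI)
    fix A assume "A \<in> sets (distr (meas X) (meas Y) \<phi>)"
    then have A: "A \<in> sets (meas Y)" by simp
    from measurable_sets[OF id this] have "A \<inter> pts Y \<in> sets ?N" by simp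
    moreover have "A \<inter> pts Y = A" using sets.sets_into_space[OF A] by auto
    ultimately obtain B where B: "B \<in> sets (PiM UNIV (\<lambda>_. borel))" "A = (\<lambda>y k. g k y) -` B \<inter> pts Y"
      by (auto simp: sets_vimage_algebra2 space_PiM)
    have "emeasure (distr (meas X) (meas Y) \<phi>) A = emeasure (meas X) (\<phi> -` A \<inter> pts X)"
      using emeasure_distr[OF m A] by simp
    also have "\<phi> -` A \<inter> pts X = (\<lambda>x k. f k x) -` B \<inter> space (meas X)"
      using \<phi> B(2) by auto
    also have "emeasure (meas X) \<dots> = emeasure (feature_law X f) B"
      unfolding feature_law_def by (rule emeasure_distr[symmetric, OF X.feature_law_measurable[OF f] B(1)])
    also have "\<dots> = emeasure (feature_law Y g) B" by (simp add: eq)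
    also have "\<dots> = emeasure (meas Y) A"
      unfolding feature_law_def B(2) using emeasure_distr[OF Y.feature_law_measurable[OF g] B(1)] by simp
    finally show "emeasure (distr (meas X) (meas Y) \<phi>) A = emeasure (meas Y) A" .
  qed simp
  moreover have "(\<lambda>g. compose (pts X) g \<phi>) ` feats_closure Y = feats_closure X"
    unfolding feats_closure_eq[OF assms(1)] feats_closure_eq[OF assms(2)]
  proof (intro equalityI subsetI)
    fix h assume "h \<in> (\<lambda>g. compose (pts X) g \<phi>) ` {h \<in> extensional (pts Y). pw_adherent (pts Y) (feats Y) h}"
    then obtain h' where h': "pw_adherent (pts Y) (feats Y) h'" "h = compose (pts X) h' \<phi>" by blast
    have "pw_adherent (pts X) (range f) (\<lambda>x. h' (\<phi> x))"
      by (rule pw_adherent_transfer[OF Y.dense_features_closure[OF g h'(1)]]) (use \<phi> in auto)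
    then have "pw_adherent (pts X) (feats X) (\<lambda>x. h' (\<phi> x))"
      by (rule pw_adherent_trans) (use f in \<open>auto simp: dense_features_def\<close>)
    then have "pw_adherent (pts X) (feats X) h"
      by (rule pw_adherent_cong) (simp add: h'(2) compose_def)
    then show "h \<in> {h \<in> extensional (pts X). pw_adherent (pts X) (feats X) h}"
      by (simp add: h'(2))
  next
    fix h assume h: "h \<in> {h \<in> extensional (pts X). pw_adherent (pts X) (feats X) h}"
    have "pw_adherent (pts Y) (range g) (\<lambda>x. h (\<psi> x))"
      by (rule pw_adherent_transfer[OF X.dense_features_closure[OF f]]) (use \<psi> h in auto)
    then have "pw_adherent (pts Y) (feats Y) (\<lambda>x. h (\<psi> x))"
      by (rule pw_adherent_trans) (use g in \<open>auto simp: dense_features_def\<close>)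
    then have "pw_adherent (pts Y) (feats Y) (restrict (\<lambda>x. h (\<psi> x)) (pts Y))"
      by (rule pw_adherent_cong) simp
    moreover have "h = compose (pts X) (restrict (\<lambda>x. h (\<psi> x)) (pts Y)) \<phi>"
      using h \<phi>(1) \<psi>\<phi> by (auto simp: compose_def fun_eq_iff restrict_def extensional_def)
    ultimately show "h \<in> (\<lambda>g. compose (pts X) g \<phi>) ` {h \<in> extensional (pts Y). pw_adherent (pts Y) (feats Y) h}"
      by blast
  qed
  ultimately show ?thesis using m by (auto simp: data_iso_def)
qed

text \<open>Together with \<open>feature_law_eq_imp_iso\<close> this turns isomorphism into equality
  of laws, so that symmetry and transitivity require no inverse or composite maps.\<close>

lemma data_isoE:
  assumes "geom_data X" "geom_data Y" "data_iso X Y" and g: "dense_features Y g"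
  obtains \<phi> where "\<phi> \<in> measurable (meas X) (meas Y)" "distr (meas X) (meas Y) \<phi> = meas Y"
    "dense_features X (\<lambda>k x. g k (\<phi> x))" "feature_law X (\<lambda>k x. g k (\<phi> x)) = feature_law Y g"
proof -
  interpret X: geom_data X by fact
  interpret Y: geom_data Y by fact
  obtain \<phi> where \<phi>: "\<phi> \<in> measurable (meas X) (meas Y)" "distr (meas X) (meas Y) \<phi> = meas Y"
    "(\<lambda>g. compose (pts X) g \<phi>) ` feats_closure Y = feats_closure X"
    using assms(3) unfolding data_iso_def by (elim bexE conjE)
  have \<phi>Y: "\<phi> ` pts X \<subseteq> pts Y" using measurable_space[OF \<phi>(1)] by auto
  define f where "f = (\<lambda>k x. g k (\<phi> x))"
  have "pw_adherent (pts X) (feats X) (f k)" for k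
  proof -
    have "pw_adherent (pts Y) (feats Y) (restrict (g k) (pts Y))"
      by (rule pw_adherent_cong[of _ _ "g k"]) (use g in \<open>auto simp: dense_features_def\<close>)
    then have "compose (pts X) (restrict (g k) (pts Y)) \<phi> \<in> feats_closure X"
      unfolding \<phi>(3)[symmetric] feats_closure_eq[OF assms(2)] 
      by (intro imageI CollectI conjI restrict_extensional)
    then have "pw_adherent (pts X) (feats X) (compose (pts X) (restrict (g k) (pts Y)) \<phi>)"
      by (simp add: feats_closure_eq[OF assms(1)])
    then show ?thesis
      by (rule pw_adherent_cong) (use \<phi>Y in \<open>auto simp: f_def compose_def\<close>)
  qed
  moreover have "pw_adherent (pts X) (range f) h" if "h \<in> feats X" for h
  proof -
    have "h \<in> feats_closure X" 
      using pw_adherent_superset[OF that] subsetD[OF X.feats_ext that] by (simp add: feats_closure_eq[OF assms(1)])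
    then have "h \<in> (\<lambda>g. compose (pts X) g \<phi>) ` {h \<in> extensional (pts Y). pw_adherent (pts Y) (feats Y) h}"
      by (simp add: \<phi>(3)[symmetric] feats_closure_eq[OF assms(2)])
    then obtain h' where h': "pw_adherent (pts Y) (feats Y) h'" "h = compose (pts X) h' \<phi>"
      by blast
    have "pw_adherent (pts X) (range f) (\<lambda>x. h' (\<phi> x))"
      by (rule pw_adherent_transfer[OF Y.dense_features_closure[OF g h'(1)] \<phi>Y]) (auto simp: f_def)
    then show ?thesis by (rule pw_adherent_cong) (simp add: h'(2) compose_def)
  qed
  ultimately have "dense_features X f" by (auto simp: dense_features_def)
  moreover have "feature_law X f = feature_law Y g"
  proof -
    have "feature_law Y g = distr (distr (meas X) (meas Y) \<phi>) (PiM UNIV (\<lambda>_. borel)) (\<lambda>x k. g k x)"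
      by (simp add: \<phi>(2) feature_law_def)
    also have "\<dots> = feature_law X f"
      unfolding feature_law_def by (subst distr_distr[OF Y.feature_law_measurable[OF g] \<phi>(1)]) (simp add: f_def o_def)
    finally show ?thesis ..
  qed
  ultimately show ?thesis using that[OF \<phi>(1,2)] by (simp add: f_def)
qed

lemma iso_imp_feature_law_eq:
  assumes "geom_data X" "geom_data Y" "data_iso X Y" "dense_features Y g"
  obtains f where "dense_features X f" "feature_law X f = feature_law Y g"
  using data_isoE[OF assms] by blast

lemma data_iso_refl:
  assumes "geom_data X" shows "data_iso X X"
proof -
  obtain f where f: "dense_features X f" using geom_data.dense_features_exists[OF assms] by blast
  show ?thesis by (rule feature_law_eq_imp_iso[OF assms assms f f refl])
qed

lemma data_iso_sym:
  assumes "geom_data X" "geom_data Y" "data_iso X Y" shows "data_iso Y X"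
proof -
  obtain g where g: "dense_features Y g" using geom_data.dense_features_exists[OF assms(2)] by blast
  obtain f where "dense_features X f" "feature_law X f = feature_law Y g" using iso_imp_feature_law_eq[OF assms g] .
  then show ?thesis using feature_law_eq_imp_iso[OF assms(2,1) g] by simp
qed

lemma data_iso_trans:
  assumes "geom_data X" "geom_data Y" "geom_data Z" "data_iso X Y" "data_iso Y Z" shows "data_iso X Z"
proof -
  obtain h where h: "dense_features Z h" using geom_data.dense_features_exists[OF assms(3)] by blast
  obtain g where g: "dense_features Y g" "feature_law Y g = feature_law Z h" using iso_imp_feature_law_eq[OF assms(2,3,5) h] .
  obtain f where f: "dense_features X f" "feature_law X f = feature_law Y g" using iso_imp_feature_law_eq[OF assms(1,2,4) g(1)] .
  show ?thesis using feature_law_eq_imp_iso[OF assms(1,3) f(1) h] f g by simp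
qed


section \<open>Couplings and upper bounds for the box distance\<close>

abbreviation prod_top :: "'a data_set \<Rightarrow> 'b data_set \<Rightarrow> ('a \<times> 'b) topology" where
  "prod_top X Y \<equiv> prod_topology (data_top X) (data_top Y)"

text \<open>\<open>couplings\<close> refers to the Borel sets of the product topology. By
  separability each of its open sets is a countable union of products of balls around two dense
  sequences, so measurability of the two components is enough.\<close>

lemma measurable_Pair_prod_top:
  fixes X :: "'a data_set" and Y :: "'b data_set"
  assumes "geom_data X" "geom_data Y" and \<alpha>: "\<alpha> \<in> measurable N (meas X)" and \<beta>: "\<beta> \<in> measurable N (meas Y)"
  shows "(\<lambda>\<omega>. (\<alpha> \<omega>, \<beta> \<omega>)) \<in> measurable N (borel_of (prod_top X Y))"
proof -
  interpret X: geom_data X by fact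
  interpret Y: geom_data Y by fact
  have sp: "\<alpha> \<omega> \<in> pts X" "\<beta> \<omega> \<in> pts Y" if "\<omega> \<in> space N" for \<omega>
    using measurable_space[OF \<alpha> that] measurable_space[OF \<beta> that] by auto
  show ?thesis
  proof (rule measurable_borel_of)
    fix U assume U: "openin (prod_top X Y) U"
    obtain s :: "nat \<Rightarrow> 'a" where s: "\<And>n. s n \<in> pts X"
      "\<And>x r. x \<in> pts X \<Longrightarrow> r > 0 \<Longrightarrow> \<exists>n. data_dist X (s n) x < r"
      using X.dense_seq by blast
    obtain t :: "nat \<Rightarrow> 'b" where t: "\<And>n. t n \<in> pts Y"
      "\<And>x r. x \<in> pts Y \<Longrightarrow> r > 0 \<Longrightarrow> \<exists>n. data_dist Y (t n) x < r"
      using Y.dense_seq by blast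
    define \<rho> where "\<rho> k = inverse (real (Suc k))" for k
    have \<rho>: "\<rho> k > 0" for k by (simp add: \<rho>_def)
    have \<rho>E: "\<exists>k. \<rho> k < r" if "r > 0" for r using reals_Archimedean[OF that] by (simp add: \<rho>_def)
    define I where "I = {(n, m, k). X.mball (s n) (\<rho> k) \<times> Y.mball (t m) (\<rho> k) \<subseteq> U}"
    have "{\<omega>\<in>space N. (\<alpha> \<omega>, \<beta> \<omega>) \<in> U} =
      (\<Union>(n,m,k)\<in>I. (\<alpha> -` X.mball (s n) (\<rho> k) \<inter> space N) \<inter> (\<beta> -` Y.mball (t m) (\<rho> k) \<inter> space N))"
    proof (intro equalityI subsetI)
      fix \<omega> assume "\<omega> \<in> {\<omega>\<in>space N. (\<alpha> \<omega>, \<beta> \<omega>) \<in> U}"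
      then have w: "\<omega> \<in> space N" "(\<alpha> \<omega>, \<beta> \<omega>) \<in> U" by auto
      obtain V W where VW: "openin X.mtopology V" "openin Y.mtopology W" "\<alpha> \<omega> \<in> V" "\<beta> \<omega> \<in> W" "V \<times> W \<subseteq> U"
        using U[unfolded openin_prod_topology_alt, rule_format, OF w(2)] by (elim exE conjE)
      obtain r where r: "r > 0" "X.mball (\<alpha> \<omega>) r \<subseteq> V" using VW by (auto simp: X.openin_mtopology)
      obtain r' where r': "r' > 0" "Y.mball (\<beta> \<omega>) r' \<subseteq> W" using VW by (auto simp: Y.openin_mtopology)
      obtain k where k: "\<rho> k < min r r' / 2" using \<rho>E[of "min r r' / 2"] r r' by auto
      obtain n where n: "data_dist X (s n) (\<alpha> \<omega>) < \<rho> k" using s(2)[OF sp(1)[OF w(1)] \<rho>] by blast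
      obtain m where m: "data_dist Y (t m) (\<beta> \<omega>) < \<rho> k" using t(2)[OF sp(2)[OF w(1)] \<rho>] by blast
      have "X.mball (s n) (\<rho> k) \<subseteq> X.mball (\<alpha> \<omega>) r"
      proof
        fix y assume y: "y \<in> X.mball (s n) (\<rho> k)"
        then show "y \<in> X.mball (\<alpha> \<omega>) r"
          using X.triangle[OF sp(1)[OF w(1)] s(1)[of n], of y] n k sp(1)[OF w(1)] X.commute[of "s n" "\<alpha> \<omega>"] by auto
      qed
      moreover have "Y.mball (t m) (\<rho> k) \<subseteq> Y.mball (\<beta> \<omega>) r'"
      proof
        fix y assume y: "y \<in> Y.mball (t m) (\<rho> k)"
        then show "y \<in> Y.mball (\<beta> \<omega>) r'"
          using Y.triangle[OF sp(2)[OF w(1)] t(1)[of m], of y] m k sp(2)[OF w(1)] Y.commute[of "t m" "\<beta> \<omega>"] by auto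
      qed
      ultimately have "(n,m,k) \<in> I" using r(2) r'(2) VW(5) unfolding I_def by blast
      with w n m s(1) t(1) sp[OF w(1)] show "\<omega> \<in> (\<Union>(n,m,k)\<in>I. (\<alpha> -` X.mball (s n) (\<rho> k) \<inter> space N) \<inter> (\<beta> -` Y.mball (t m) (\<rho> k) \<inter> space N))"
        by (intro UN_I[of "(n,m,k)"]) auto
    next
      fix \<omega> assume "\<omega> \<in> (\<Union>(n,m,k)\<in>I. (\<alpha> -` X.mball (s n) (\<rho> k) \<inter> space N) \<inter> (\<beta> -` Y.mball (t m) (\<rho> k) \<inter> space N))"
      then obtain n m k where "(n,m,k) \<in> I" "\<alpha> \<omega> \<in> X.mball (s n) (\<rho> k)" "\<beta> \<omega> \<in> Y.mball (t m) (\<rho> k)" "\<omega> \<in> space N"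
        by blast
      then show "\<omega> \<in> {\<omega>\<in>space N. (\<alpha> \<omega>, \<beta> \<omega>) \<in> U}" unfolding I_def by blast
    qed
    also have "\<dots> \<in> sets N"
      by (intro sets.countable_UN'')
         (auto intro!: sets.Int measurable_sets[OF \<alpha>] measurable_sets[OF \<beta>] X.open_sets Y.open_sets)
    finally show "{\<omega>\<in>space N. (\<alpha> \<omega>, \<beta> \<omega>) \<in> U} \<in> sets N" .
  qed (use sp in auto)
qed

lemma measurable_fst_prod_top: "geom_data X \<Longrightarrow> fst \<in> measurable (borel_of (prod_top X Y)) (meas X)"
  using measurable_continuous_borel_of[OF continuous_map_fst]
  by (simp add: measurable_cong_sets[OF refl geom_data.sets_meas])

lemma measurable_snd_prod_top: "geom_data Y \<Longrightarrow> snd \<in> measurable (borel_of (prod_top X Y)) (meas Y)"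
  using measurable_continuous_borel_of[OF continuous_map_snd]
  by (simp add: measurable_cong_sets[OF refl geom_data.sets_meas])

lemma coupling_distr:
  assumes "geom_data X" "geom_data Y" "prob_space N"
    and \<alpha>: "\<alpha> \<in> measurable N (meas X)" "distr N (meas X) \<alpha> = meas X"
    and \<beta>: "\<beta> \<in> measurable N (meas Y)" "distr N (meas Y) \<beta> = meas Y"
  shows "distr N (borel_of (prod_top X Y)) (\<lambda>\<omega>. (\<alpha> \<omega>, \<beta> \<omega>)) \<in> couplings X Y"
proof -
  note m = measurable_Pair_prod_top[OF assms(1,2) \<alpha>(1) \<beta>(1)]
  have "distr (distr N (borel_of (prod_top X Y)) (\<lambda>\<omega>. (\<alpha> \<omega>, \<beta> \<omega>))) (meas X) fst = meas X"
    by (subst distr_distr[OF measurable_fst_prod_top[OF assms(1)] m]) (simp add: o_def \<alpha>(2))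
  moreover have "distr (distr N (borel_of (prod_top X Y)) (\<lambda>\<omega>. (\<alpha> \<omega>, \<beta> \<omega>))) (meas Y) snd = meas Y"
    by (subst distr_distr[OF measurable_snd_prod_top[OF assms(2)] m]) (simp add: o_def \<beta>(2))
  ultimately show ?thesis
    using prob_space.prob_space_distr[OF assms(3) m] by (simp add: couplings_def)
qed

text \<open>
  Features are \<open>1\<close>-Lipschitz, so on the \<open>\<eta>\<close>-neighbourhood of a finite set pointwise approximations are
  uniform. As such neighbourhoods carry almost all the mass, features and their pointwise limits
  are interchangeable in the box distance.
\<close>

lemma feature_partner:
  assumes "geom_data X" "geom_data Y" and f: "dense_features X f" and g: "dense_features Y g" and f0: "f0 \<in> feats X"
    and A: "finite A" "A \<subseteq> pts X" and B: "finite B" "B \<subseteq> pts Y" and \<eta>: "\<eta> > 0"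
  shows "\<exists>g0\<in>feats Y. \<forall>x\<in>pts X. \<forall>y\<in>pts Y. (\<exists>a\<in>A. data_dist X a x \<le> \<eta>) \<longrightarrow> (\<exists>b\<in>B. data_dist Y b y \<le> \<eta>) \<longrightarrow>
       (\<forall>k. \<bar>f k x - g k y\<bar> \<le> e) \<longrightarrow> \<bar>f0 x - g0 y\<bar> \<le> e + 6 * \<eta>"
proof -
  interpret X: geom_data X by fact
  interpret Y: geom_data Y by fact
  have cf: "pw_adherent (pts X) (range f) f0" using f f0 by (simp add: dense_features_def)
  obtain k where k: "\<And>a. a \<in> A \<Longrightarrow> \<bar>f k a - f0 a\<bar> < \<eta>"
    using cf[unfolded pw_adherent_def, rule_format, OF A \<eta>] by blast
  have "pw_adherent (pts Y) (feats Y) (g k)" using g by (simp add: dense_features_def)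
  then obtain g0 where g0: "g0 \<in> feats Y" "\<And>b. b \<in> B \<Longrightarrow> \<bar>g0 b - g k b\<bar> < \<eta>"
    using pw_adherentE[OF _ B \<eta>] by blast
  show ?thesis
  proof (intro bexI[OF _ g0(1)] ballI impI)
    fix x y assume xy: "x \<in> pts X" "y \<in> pts Y" and "\<exists>a\<in>A. data_dist X a x \<le> \<eta>" "\<exists>b\<in>B. data_dist Y b y \<le> \<eta>"
      and e: "\<forall>k. \<bar>f k x - g k y\<bar> \<le> e"
    then obtain a b where ab: "a \<in> A" "b \<in> B" "data_dist X a x \<le> \<eta>" "data_dist Y b y \<le> \<eta>" by blast
    then have ab': "a \<in> pts X" "b \<in> pts Y" using A B by auto
    \<comment> \<open>Besides \<open>e\<close> there are six errors of size \<eta>: on each side two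
      for moving between the point and its net point, and one for the approximation at the net
      point.\<close>
    show "\<bar>f0 x - g0 y\<bar> \<le> e + 6 * \<eta>"
      using X.dense_features_lip[OF f ab'(1) xy(1), of k] X.feat_lip[OF f0 ab'(1) xy(1)] k[OF ab(1)]
        Y.dense_features_lip[OF g ab'(2) xy(2), of k] Y.feat_lip[OF g0(1) ab'(2) xy(2)] g0(2)[OF ab(2)]
        e[rule_format, of k] ab by linarith
  qed
qed

lemma hausdorff_dist_le:
  assumes "\<And>a. a \<in> A \<Longrightarrow> \<exists>b\<in>B. d a b \<le> c" "\<And>b. b \<in> B \<Longrightarrow> \<exists>a\<in>A. d a b \<le> c"
  shows "hausdorff_dist d A B \<le> c"
  unfolding hausdorff_dist_def using assms by (intro max.boundedI SUP_least) (blast intro: INF_lower2)+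

lemma hausdorff_dist_lessE:
  assumes "hausdorff_dist d A B < c"
  shows "a \<in> A \<Longrightarrow> \<exists>b\<in>B. d a b < c" "b \<in> B \<Longrightarrow> \<exists>a\<in>A. d a b < c"
proof -
  have 1: "(SUP a\<in>A. INF b\<in>B. d a b) < c" and 2: "(SUP b\<in>B. INF a\<in>A. d a b) < c"
    using assms by (auto simp: hausdorff_dist_def)
  show "\<exists>b\<in>B. d a b < c" if "a \<in> A"
    using order_le_less_trans[OF SUP_upper[OF that] 1] by (simp add: INF_less_iff)
  show "\<exists>a\<in>A. d a b < c" if "b \<in> B"
    using order_le_less_trans[OF SUP_upper[OF that] 2] by (simp add: INF_less_iff)
qed

text \<open>The source of all upper bounds. The coupling is the joint law of \<open>\<alpha>\<close>
  and \<open>\<beta>\<close> on an arbitrary probability space, and \<open>S\<close> consists of the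
  pairs near two finite nets at which all coordinates differ by at most \<open>e\<close>. On
  \<open>S\<close> every feature has a partner by \<open>feature_partner\<close>, although the terms
  of \<open>f\<close> and \<open>g\<close> may be mere limits of features.\<close>

lemma box_data_upper:
  fixes X :: "'a data_set" and Y :: "'b data_set"
  assumes "geom_data X" "geom_data Y" "prob_space N"
    and \<alpha>: "\<alpha> \<in> measurable N (meas X)" "distr N (meas X) \<alpha> = meas X"
    and \<beta>: "\<beta> \<in> measurable N (meas Y)" "distr N (meas Y) \<beta> = meas Y"
    and f: "dense_features X f" and g: "dense_features Y g"
    and ev: "measure N {\<omega>\<in>space N. \<forall>k. \<bar>f k (\<alpha> \<omega>) - g k (\<beta> \<omega>)\<bar> \<le> e} \<ge> 1 - c"
    and c: "2 * e \<le> c"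
  shows "box_data X Y \<le> ennreal c"
proof (rule ennreal_le_epsilon)
  interpret X: geom_data X by fact
  interpret Y: geom_data Y by fact
  interpret N: prob_space N by fact
  have sp: "\<alpha> \<omega> \<in> pts X" "\<beta> \<omega> \<in> pts Y" if "\<omega> \<in> space N" for \<omega>
    using measurable_space[OF \<alpha>(1) that] measurable_space[OF \<beta>(1) that] by auto
  have mf: "(\<lambda>\<omega>. f k (\<alpha> \<omega>)) \<in> borel_measurable N" for k
    using measurable_compose[OF \<alpha>(1) X.dense_features_measurable[OF f]] .
  have mg: "(\<lambda>\<omega>. g k (\<beta> \<omega>)) \<in> borel_measurable N" for k
    using measurable_compose[OF \<beta>(1) Y.dense_features_measurable[OF g]] .
  let ?E = "{\<omega>\<in>space N. \<forall>k. \<bar>f k (\<alpha> \<omega>) - g k (\<beta> \<omega>)\<bar> \<le> e}"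
  have E: "?E \<in> sets N" using mf mg by measurable
  \<comment> \<open>If \<open>c\<close> were negative, so would be \<open>e\<close>, and the event
    in \<open>ev\<close> would be empty.\<close>
  have c0: "c \<ge> 0"
  proof (rule ccontr)
    assume "\<not> c \<ge> 0"
    with c have "?E = {}" by (auto simp: not_le)
    then have "measure N ?E = 0" by (simp only: measure_empty)
    moreover have "measure N ?E > 1" using ev \<open>\<not> c \<ge> 0\<close> by linarith
    ultimately show False by simp
  qed
  fix \<delta> :: real assume "\<delta> > 0"
  \<comment> \<open>The partner estimate loses 6\<eta>, which the factor 2 in the Box distance turns
    into \<delta>; the two nets lose mass at most 2\<eta>, which is below \<delta> as well.\<close>
  define \<eta> where "\<eta> = \<delta> / 12"
  have \<eta>: "\<eta> > 0" using \<open>\<delta> > 0\<close> by (simp add: \<eta>_def)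
  obtain A where A: "finite A" "A \<subseteq> pts X" "closedin X.mtopology (\<Union>a\<in>A. X.mcball a \<eta>)"
    "X.P.prob (\<Union>a\<in>A. X.mcball a \<eta>) > 1 - \<eta>" using X.net[OF \<eta> \<eta>] .
  obtain B where B: "finite B" "B \<subseteq> pts Y" "closedin Y.mtopology (\<Union>a\<in>B. Y.mcball a \<eta>)"
    "Y.P.prob (\<Union>a\<in>B. Y.mcball a \<eta>) > 1 - \<eta>" using Y.net[OF \<eta> \<eta>] .
  let ?A = "\<Union>a\<in>A. X.mcball a \<eta>" and ?B = "\<Union>a\<in>B. Y.mcball a \<eta>"
  define S where "S = (\<Inter>k. {z \<in> topspace (prod_top X Y). norm (f k (fst z) - g k (snd z)) \<in> {..e}}) \<inter> ?A \<times> ?B"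
  have cl: "closedin (prod_top X Y) S"
    unfolding S_def
  proof (intro closedin_Int closedin_INT)
    fix k
    have "continuous_map (prod_top X Y) euclideanreal (\<lambda>z. norm (f k (fst z) - g k (snd z)))"
      using continuous_map_compose[OF continuous_map_fst[of X.mtopology Y.mtopology] X.pw_adherent_continuous[of "f k"]]
        continuous_map_compose[OF continuous_map_snd[of X.mtopology Y.mtopology] Y.pw_adherent_continuous[of "g k"]] f g
      by (intro continuous_map_norm continuous_map_diff) (auto simp: dense_features_def o_def)
    then show "closedin (prod_top X Y) {z \<in> topspace (prod_top X Y). norm (f k (fst z) - g k (snd z)) \<in> {..e}}"
      by (rule closedin_continuous_map_preimage) simp
  qed (use A(3) B(3) in \<open>auto simp: closedin_prod_Times_iff\<close>)
  let ?\<pi> = "distr N (borel_of (prod_top X Y)) (\<lambda>\<omega>. (\<alpha> \<omega>, \<beta> \<omega>))"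
  have \<pi>: "?\<pi> \<in> couplings X Y" by (rule coupling_distr) fact+
  have "emeasure ?\<pi> S = emeasure N ((\<lambda>\<omega>. (\<alpha> \<omega>, \<beta> \<omega>)) -` S \<inter> space N)"
    by (rule emeasure_distr[OF measurable_Pair_prod_top[OF assms(1,2) \<alpha>(1) \<beta>(1)] borel_of_closed[OF cl]])
  also have "(\<lambda>\<omega>. (\<alpha> \<omega>, \<beta> \<omega>)) -` S \<inter> space N = ?E \<inter> (\<alpha> -` ?A \<inter> space N) \<inter> (\<beta> -` ?B \<inter> space N)"
    using sp by (auto simp: S_def)
  finally have eS: "emeasure ?\<pi> S = ennreal (N.prob (?E \<inter> (\<alpha> -` ?A \<inter> space N) \<inter> (\<beta> -` ?B \<inter> space N)))"
    by (simp add: N.emeasure_eq_measure)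
  have mA: "\<alpha> -` ?A \<inter> space N \<in> sets N" and mB: "\<beta> -` ?B \<inter> space N \<in> sets N"
    by (rule measurable_sets[OF \<alpha>(1) X.closed_sets[OF A(3)]], rule measurable_sets[OF \<beta>(1) Y.closed_sets[OF B(3)]])
  have pA: "N.prob (\<alpha> -` ?A \<inter> space N) > 1 - \<eta>"
    using A(4) measure_distr[OF \<alpha>(1) X.closed_sets[OF A(3)]] by (simp add: \<alpha>(2))
  have pB: "N.prob (\<beta> -` ?B \<inter> space N) > 1 - \<eta>"
    using B(4) measure_distr[OF \<beta>(1) Y.closed_sets[OF B(3)]] by (simp add: \<beta>(2))
  have "N.prob (?E \<inter> (\<alpha> -` ?A \<inter> space N) \<inter> (\<beta> -` ?B \<inter> space N)) \<ge> 1 - c - 2 * \<eta>"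
  proof -
    let ?P = "\<alpha> -` ?A \<inter> space N" and ?Q = "\<beta> -` ?B \<inter> space N"
    have int2: "N.prob (U \<inter> V) \<ge> N.prob U + N.prob V - 1" if "U \<in> sets N" "V \<in> sets N" for U V
      using N.finite_measure_Union'[OF that] N.finite_measure_Diff'[OF that(2,1)] N.prob_le_1[of "U \<union> V"]
      by (simp add: Int_commute)
    show ?thesis using int2[OF sets.Int[OF E mA] mB] int2[OF E mA] pA pB ev by linarith
  qed
  then have "1 - emeasure ?\<pi> S \<le> ennreal (c + 2 * \<eta>)"
    unfolding eS by (simp add: ennreal_minus ennreal_1[symmetric] ennreal_leI del: ennreal_1)
  also have "\<dots> \<le> ennreal (c + \<delta>)" using \<open>\<delta> > 0\<close> by (intro ennreal_leI) (simp add: \<eta>_def)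
  finally have m1: "1 - emeasure ?\<pi> S \<le> ennreal (c + \<delta>)" .
  have S: "x \<in> pts X" "y \<in> pts Y" "\<exists>a\<in>A. data_dist X a x \<le> \<eta>" "\<exists>b\<in>B. data_dist Y b y \<le> \<eta>"
     "\<forall>k. \<bar>f k x - g k y\<bar> \<le> e" "\<forall>k. \<bar>g k y - f k x\<bar> \<le> e" if "(x,y) \<in> S" for x y
    using that by (auto simp: S_def abs_minus_commute)
  have "hausdorff_dist (sup_dist_on S) ((\<lambda>f. f \<circ> fst) ` feats X) ((\<lambda>g. g \<circ> snd) ` feats Y) \<le> ennreal (e + 6 * \<eta>)"
  proof (rule hausdorff_dist_le)
    fix u :: "'a \<times> 'b \<Rightarrow> real" assume "u \<in> (\<lambda>f. f \<circ> fst) ` feats X"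
    then obtain f0 where f0: "f0 \<in> feats X" "u = f0 \<circ> fst" by blast
    obtain g0 where g0: "g0 \<in> feats Y"
      "\<forall>x\<in>pts X. \<forall>y\<in>pts Y. (\<exists>a\<in>A. data_dist X a x \<le> \<eta>) \<longrightarrow> (\<exists>b\<in>B. data_dist Y b y \<le> \<eta>) \<longrightarrow>
       (\<forall>k. \<bar>f k x - g k y\<bar> \<le> e) \<longrightarrow> \<bar>f0 x - g0 y\<bar> \<le> e + 6 * \<eta>"
      using feature_partner[OF assms(1,2) f g f0(1) A(1,2) B(1,2) \<eta>, where e=e] by (elim bexE)
    have "sup_dist_on S u (g0 \<circ> snd) \<le> ennreal (e + 6 * \<eta>)"
      unfolding sup_dist_on_def f0(2)
    proof (intro SUP_least ennreal_leI)
      fix z assume "z \<in> S"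
      then obtain x y where z: "z = (x, y)" "(x, y) \<in> S" by (cases z) auto
      show "\<bar>(f0 \<circ> fst) z - (g0 \<circ> snd) z\<bar> \<le> e + 6 * \<eta>"
        using g0(2)[rule_format, OF S(1)[OF z(2)] S(2)[OF z(2)] S(3)[OF z(2)] S(4)[OF z(2)] S(5)[OF z(2), rule_format]]
        by (simp add: z(1))
    qed
    then show "\<exists>v\<in>(\<lambda>g. g \<circ> snd) ` feats Y. sup_dist_on S u v \<le> ennreal (e + 6 * \<eta>)"
      using g0(1) by blast
  next
    fix v :: "'a \<times> 'b \<Rightarrow> real" assume "v \<in> (\<lambda>f. f \<circ> snd) ` feats Y"
    then obtain g0 where g0: "g0 \<in> feats Y" "v = g0 \<circ> snd" by blast
    obtain f0 where f0: "f0 \<in> feats X"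
      "\<forall>y\<in>pts Y. \<forall>x\<in>pts X. (\<exists>b\<in>B. data_dist Y b y \<le> \<eta>) \<longrightarrow> (\<exists>a\<in>A. data_dist X a x \<le> \<eta>) \<longrightarrow>
       (\<forall>k. \<bar>g k y - f k x\<bar> \<le> e) \<longrightarrow> \<bar>g0 y - f0 x\<bar> \<le> e + 6 * \<eta>"
      using feature_partner[OF assms(2,1) g f g0(1) B(1,2) A(1,2) \<eta>, where e=e] by (elim bexE)
    have "sup_dist_on S (f0 \<circ> fst) v \<le> ennreal (e + 6 * \<eta>)"
      unfolding sup_dist_on_def g0(2)
    proof (intro SUP_least ennreal_leI)
      fix z assume "z \<in> S"
      then obtain x y where z: "z = (x, y)" "(x, y) \<in> S" by (cases z) auto
      show "\<bar>(f0 \<circ> fst) z - (g0 \<circ> snd) z\<bar> \<le> e + 6 * \<eta>"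
        using f0(2)[rule_format, OF S(2)[OF z(2)] S(1)[OF z(2)] S(4)[OF z(2)] S(3)[OF z(2)] S(6)[OF z(2), rule_format]]
        by (simp add: z(1) abs_minus_commute)
    qed
    then show "\<exists>u\<in>(\<lambda>g. g \<circ> fst) ` feats X. sup_dist_on S u v \<le> ennreal (e + 6 * \<eta>)"
      using f0(1) by blast
  qed
  then have "2 * hausdorff_dist (sup_dist_on S) ((\<lambda>f. f \<circ> fst) ` feats X) ((\<lambda>g. g \<circ> snd) ` feats Y) \<le> 2 * ennreal (e + 6 * \<eta>)"
    by (rule mult_left_mono) simp
  also have "\<dots> = ennreal (2 * (e + 6 * \<eta>))" using ennreal_mult'[of 2 "e + 6 * \<eta>"] by simp
  also have "\<dots> \<le> ennreal (c + \<delta>)" using c by (intro ennreal_leI) (simp add: \<eta>_def)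
  finally have "max (1 - emeasure ?\<pi> S) (2 * hausdorff_dist (sup_dist_on S)
                   ((\<lambda>f. f \<circ> fst) ` feats X) ((\<lambda>g. g \<circ> snd) ` feats Y)) \<le> ennreal (c + \<delta>)"
    using m1 by simp
  then have "box_data X Y \<le> ennreal (c + \<delta>)"
    unfolding box_data_def using \<pi> cl by (intro INF_lower2[of "(?\<pi>, S)"]) auto
  then show "box_data X Y \<le> ennreal c + ennreal \<delta>"
    using c0 \<open>\<delta> > 0\<close> by (simp add: ennreal_plus)
qed

abbreviation close_on :: "('a \<times> 'b) set \<Rightarrow> real \<Rightarrow> ('a \<Rightarrow> real) \<Rightarrow> ('b \<Rightarrow> real) \<Rightarrow> bool" where
  "close_on S c f g \<equiv> \<forall>x y. (x,y) \<in> S \<longrightarrow> \<bar>f x - g y\<bar> \<le> c"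

text \<open>A strict bound selects a coupling and a set from the infimum, and then a partner for
  each single feature from the Hausdorff distance. The partner bound is \<open>c / 2\<close> because
  of the factor 2 in the Box distance.\<close>

lemma box_dataE:
  fixes X :: "'a data_set" and Y :: "'b data_set"
  assumes "box_data X Y < ennreal c"
  obtains \<pi> S where "\<pi> \<in> couplings X Y" "closedin (prod_top X Y) S" "measure \<pi> S \<ge> 1 - c"
    "\<forall>f\<in>feats X. \<exists>g\<in>feats Y. close_on S (c / 2) f g"
    "\<forall>g\<in>feats Y. \<exists>f\<in>feats X. close_on S (c / 2) f g"
proof -
  have c: "c > 0" using assms by (cases "c > 0") (auto simp: ennreal_neg)
  from assms obtain \<pi> S where \<pi>: "\<pi> \<in> couplings X Y" "closedin (prod_top X Y) S"
    and 1: "1 - emeasure \<pi> S < ennreal c" and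
     2: "2 * hausdorff_dist (sup_dist_on S) ((\<lambda>f. f \<circ> fst) ` feats X) ((\<lambda>g. g \<circ> snd) ` feats Y) < ennreal c"
    unfolding box_data_def INF_less_iff by auto
  interpret \<pi>: prob_space \<pi> using \<pi>(1) by (simp add: couplings_def)
  have "ennreal (1 - \<pi>.prob S) < ennreal c"
    using 1 by (simp add: \<pi>.emeasure_eq_measure ennreal_minus ennreal_1[symmetric] del: ennreal_1)
  then have m: "measure \<pi> S \<ge> 1 - c" using c by (simp add: ennreal_less_iff)
  have h: "hausdorff_dist (sup_dist_on S) ((\<lambda>f. f \<circ> fst) ` feats X) ((\<lambda>g. g \<circ> snd) ` feats Y) < ennreal (c/2)" (is "?h < _")
  proof (rule ccontr)
    assume "\<not> ?h < ennreal (c/2)"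
    then have "2 * ?h \<ge> 2 * ennreal (c/2)" by (intro mult_left_mono) auto
    also have "2 * ennreal (c/2) = ennreal c" using ennreal_mult'[of 2 "c/2"] by simp
    finally show False using 2 leD by blast
  qed
  have sd: "\<bar>u z - v z\<bar> \<le> c/2" if "sup_dist_on S u v < ennreal (c/2)" "z \<in> S" for u v z
  proof -
    have "ennreal \<bar>u z - v z\<bar> < ennreal (c/2)"
      using that(1) SUP_upper[OF that(2), of "\<lambda>z. ennreal \<bar>u z - v z\<bar>"] unfolding sup_dist_on_def by simp
    then show ?thesis by (simp add: ennreal_less_iff)
  qed
  show ?thesis
  proof (rule that[OF \<pi> m]; intro ballI)
    fix f assume "f \<in> feats X"
    then obtain g where g: "g \<in> feats Y" "sup_dist_on S (f \<circ> fst) (g \<circ> snd) < ennreal (c/2)"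
      using hausdorff_dist_lessE(1)[OF h, of "f \<circ> fst"] by blast
    then show "\<exists>g\<in>feats Y. close_on S (c / 2) f g"
      using sd[OF g(2)] by (intro bexI[of _ g]) fastforce+
  next
    fix g assume "g \<in> feats Y"
    then obtain f where f: "f \<in> feats X" "sup_dist_on S (f \<circ> fst) (g \<circ> snd) < ennreal (c/2)"
      using hausdorff_dist_lessE(2)[OF h, of "g \<circ> snd"] by blast
    then show "\<exists>f\<in>feats X. close_on S (c / 2) f g"
      using sd[OF f(2)] by (intro bexI[of _ f]) fastforce+
  qed
qed


section \<open>Gluing of couplings and the triangle inequality\<close>

text \<open>
  Gluing along maps with countably many values is given by an explicit density, so that no
  disintegration of measures is needed.
\<close>

lemma glue:
  fixes p :: "'a \<Rightarrow> nat" and q :: "'b \<Rightarrow> nat"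
  assumes "prob_space M1" "prob_space M2"
    and p[measurable]: "p \<in> measurable M1 (count_space UNIV)"
    and q[measurable]: "q \<in> measurable M2 (count_space UNIV)"
    and eq: "distr M1 (count_space UNIV) p = distr M2 (count_space UNIV) q"
  obtains N where "prob_space N" "sets N = sets (M1 \<Otimes>\<^sub>M M2)" "distr N M1 fst = M1" "distr N M2 snd = M2"
    "AE z in N. p (fst z) = q (snd z)"
proof -
  interpret M1: prob_space M1 by fact
  interpret M2: prob_space M2 by fact
  interpret PP: pair_prob_space M1 M2 ..
  define w where "w i = emeasure M1 {x\<in>space M1. p x = i}" for i
  have w2: "w i = emeasure M2 {x\<in>space M2. q x = i}" for i
  proof -
    have "w i = emeasure (distr M1 (count_space UNIV) p) {i}"
      by (subst emeasure_distr) (auto simp: w_def intro!: arg_cong[where f="emeasure M1"])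
    also have "\<dots> = emeasure M2 {x\<in>space M2. q x = i}"
      unfolding eq by (subst emeasure_distr) (auto intro!: arg_cong[where f="emeasure M2"])
    finally show ?thesis .
  qed
  \<comment> \<open>Under this density the two points are independent given their common cell. The
    inverse of weight \<open>0\<close> is \<open>top\<close> in \<open>ennreal\<close>, but by
    \<open>AE1\<close> and \<open>AE2\<close> such cells are null for both marginals.\<close>
  define \<kappa> where "\<kappa> i j = (if i = j then inverse (w i) else 0)" for i j :: nat
  define N where "N = density (M1 \<Otimes>\<^sub>M M2) (\<lambda>z. \<kappa> (p (fst z)) (q (snd z)))"
  have m\<kappa>[measurable]: "(\<lambda>z. \<kappa> (p (fst z)) (q (snd z))) \<in> borel_measurable (M1 \<Otimes>\<^sub>M M2)"
  proof -
    have "(\<lambda>z. (p (fst z), q (snd z))) \<in> measurable (M1 \<Otimes>\<^sub>M M2) (count_space UNIV)" by measurable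
    from measurable_compose[OF this, of "\<lambda>(i,j). \<kappa> i j" borel] show ?thesis by simp
  qed
  have winv: "inverse (w i) * w i = 1" if "w i \<noteq> 0" for i
  proof -
    have "w i < top" by (simp add: w_def less_top[symmetric])
    then have "w i / w i = 1" using that by (simp add: ennreal_divide_self)
    then show ?thesis by (simp add: divide_ennreal_def mult.commute)
  qed
  have AE1: "AE x in M1. w (p x) \<noteq> 0"
  proof -
    have "AE x in M1. p x = i \<longrightarrow> w i \<noteq> 0" for i
    proof (cases "w i = 0")
      case True
      then show ?thesis by (subst AE_iff_measurable[OF _ refl]) (auto simp: w_def)
    qed auto
    then have "AE x in M1. \<forall>i. p x = i \<longrightarrow> w i \<noteq> 0"
      by (intro AE_all_countable[THEN iffD2] allI)
    then show ?thesis by eventually_elim auto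
  qed
  have AE2: "AE x in M2. w (q x) \<noteq> 0"
  proof -
    have "AE x in M2. q x = i \<longrightarrow> w i \<noteq> 0" for i
    proof (cases "w i = 0")
      case True
      then show ?thesis by (subst AE_iff_measurable[OF _ refl]) (auto simp: w2)
    qed auto
    then have "AE x in M2. \<forall>i. q x = i \<longrightarrow> w i \<noteq> 0"
      by (intro AE_all_countable[THEN iffD2] allI)
    then show ?thesis by eventually_elim auto
  qed
  have int1: "(\<integral>\<^sup>+y. \<kappa> i (q y) \<partial>M2) = 1" if "w i \<noteq> 0" for i
  proof -
    have "(\<integral>\<^sup>+y. \<kappa> i (q y) \<partial>M2) = (\<integral>\<^sup>+y. inverse (w i) * indicator {x\<in>space M2. q x = i} y \<partial>M2)"
      by (intro nn_integral_cong) (auto simp: \<kappa>_def)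
    also have "\<dots> = inverse (w i) * w i"
      by (subst nn_integral_cmult_indicator) (auto simp: w2)
    finally show ?thesis using winv[OF that] by simp
  qed
  have int2: "(\<integral>\<^sup>+x. \<kappa> (p x) i \<partial>M1) = 1" if "w i \<noteq> 0" for i
  proof -
    have "(\<integral>\<^sup>+x. \<kappa> (p x) i \<partial>M1) = (\<integral>\<^sup>+y. inverse (w i) * indicator {x\<in>space M1. p x = i} y \<partial>M1)"
      by (intro nn_integral_cong) (auto simp: \<kappa>_def)
    also have "\<dots> = inverse (w i) * w i"
      by (subst nn_integral_cmult_indicator) (auto simp: w_def)
    finally show ?thesis using winv[OF that] by simp
  qed
  have sN: "sets N = sets (M1 \<Otimes>\<^sub>M M2)" by (simp add: N_def)
  have f: "fst \<in> measurable N M1" and s: "snd \<in> measurable N M2"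
    by (simp_all add: measurable_cong_sets[OF sN refl])
  have d1: "distr N M1 fst = M1"
  proof (rule measure_eqI)
    fix A assume "A \<in> sets (distr N M1 fst)"
    then have A[measurable]: "A \<in> sets M1" by simp
    have "emeasure (distr N M1 fst) A = emeasure N (fst -` A \<inter> space N)"
      by (rule emeasure_distr[OF f A])
    also have "fst -` A \<inter> space N = A \<times> space M2"
      using sets.sets_into_space[OF A] by (auto simp: N_def space_pair_measure)
    also have "emeasure N \<dots> = (\<integral>\<^sup>+z. \<kappa> (p (fst z)) (q (snd z)) * indicator (A \<times> space M2) z \<partial>(M1 \<Otimes>\<^sub>M M2))"
      unfolding N_def by (rule emeasure_density) auto
    also have "\<dots> = (\<integral>\<^sup>+x. \<integral>\<^sup>+y. \<kappa> (p x) (q y) * indicator (A \<times> space M2) (x,y) \<partial>M2 \<partial>M1)"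
      by (subst M2.nn_integral_fst[symmetric]) auto
    also have "\<dots> = (\<integral>\<^sup>+x. indicator A x \<partial>M1)"
    proof (rule nn_integral_cong_AE)
      show "AE x in M1. (\<integral>\<^sup>+y. \<kappa> (p x) (q y) * indicator (A \<times> space M2) (x,y) \<partial>M2) = indicator A x"
        using AE1
      proof (eventually_elim)
        fix x assume "w (p x) \<noteq> 0"
        have "(\<integral>\<^sup>+y. \<kappa> (p x) (q y) * indicator (A \<times> space M2) (x,y) \<partial>M2) = (\<integral>\<^sup>+y. indicator A x * \<kappa> (p x) (q y) \<partial>M2)"
          by (intro nn_integral_cong) (auto simp: indicator_def)
        also have "\<dots> = indicator A x * (\<integral>\<^sup>+y. \<kappa> (p x) (q y) \<partial>M2)"
          by (rule nn_integral_cmult) (simp add: \<kappa>_def)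
        finally show "(\<integral>\<^sup>+y. \<kappa> (p x) (q y) * indicator (A \<times> space M2) (x,y) \<partial>M2) = indicator A x"
          using int1[OF \<open>w (p x) \<noteq> 0\<close>] by simp
      qed
    qed
    finally show "emeasure (distr N M1 fst) A = emeasure M1 A" by simp
  qed simp
  have d2: "distr N M2 snd = M2"
  proof (rule measure_eqI)
    fix A assume "A \<in> sets (distr N M2 snd)"
    then have A[measurable]: "A \<in> sets M2" by simp
    have "emeasure (distr N M2 snd) A = emeasure N (snd -` A \<inter> space N)"
      by (rule emeasure_distr[OF s A])
    also have "snd -` A \<inter> space N = space M1 \<times> A"
      using sets.sets_into_space[OF A] by (auto simp: N_def space_pair_measure)
    also have "emeasure N \<dots> = (\<integral>\<^sup>+z. \<kappa> (p (fst z)) (q (snd z)) * indicator (space M1 \<times> A) z \<partial>(M1 \<Otimes>\<^sub>M M2))"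
      unfolding N_def by (rule emeasure_density) auto
    also have "\<dots> = (\<integral>\<^sup>+y. \<integral>\<^sup>+x. \<kappa> (p x) (q y) * indicator (space M1 \<times> A) (x,y) \<partial>M1 \<partial>M2)"
      by (subst PP.nn_integral_snd[symmetric]) auto
    also have "\<dots> = (\<integral>\<^sup>+x. indicator A x \<partial>M2)"
    proof (rule nn_integral_cong_AE)
      show "AE y in M2. (\<integral>\<^sup>+x. \<kappa> (p x) (q y) * indicator (space M1 \<times> A) (x,y) \<partial>M1) = indicator A y"
        using AE2
      proof (eventually_elim)
        fix y assume "w (q y) \<noteq> 0"
        have "(\<integral>\<^sup>+x. \<kappa> (p x) (q y) * indicator (space M1 \<times> A) (x,y) \<partial>M1) = (\<integral>\<^sup>+x. indicator A y * \<kappa> (p x) (q y) \<partial>M1)"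
          by (intro nn_integral_cong) (auto simp: indicator_def)
        also have "\<dots> = indicator A y * (\<integral>\<^sup>+x. \<kappa> (p x) (q y) \<partial>M1)"
          by (rule nn_integral_cmult) (simp add: \<kappa>_def)
        finally show "(\<integral>\<^sup>+x. \<kappa> (p x) (q y) * indicator (space M1 \<times> A) (x,y) \<partial>M1) = indicator A y"
          using int2[OF \<open>w (q y) \<noteq> 0\<close>] by simp
      qed
    qed
    finally show "emeasure (distr N M2 snd) A = emeasure M2 A" by simp
  qed simp
  have "prob_space N"
    by (rule prob_space_distrD[OF f]) (simp add: d1 assms(1))
  moreover have "AE z in N. p (fst z) = q (snd z)"
    unfolding N_def by (subst AE_density[OF m\<kappa>]) (auto simp: \<kappa>_def)
  ultimately show ?thesis using that sN d1 d2 by blast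
qed

text \<open>Each point is assigned to the first member of a dense sequence within distance \<eta>.
  Gluing requires exactly equal values, so closeness of two points is replaced by membership in the
  same cell.\<close>

lemma (in geom_data) cells:
  assumes "\<eta> > 0"
  obtains p :: "'a \<Rightarrow> nat" and s where "p \<in> measurable (meas X) (count_space UNIV)" "\<And>n. s n \<in> pts X"
    "\<And>x. x \<in> pts X \<Longrightarrow> data_dist X (s (p x)) x \<le> \<eta>"
proof -
  obtain s :: "nat \<Rightarrow> 'a" where s: "\<And>n. s n \<in> pts X"
    "\<And>x r. x \<in> pts X \<Longrightarrow> r > 0 \<Longrightarrow> \<exists>n. data_dist X (s n) x < r"
    using dense_seq by blast
  define p where "p x = (LEAST n. data_dist X (s n) x \<le> \<eta>)" for x
  have "data_dist X (s (p x)) x \<le> \<eta>" if "x \<in> pts X" for x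
    unfolding p_def using s(2)[OF that assms] by (metis (mono_tags, lifting) LeastI_ex less_imp_le)
  moreover have "p \<in> measurable (meas X) (count_space UNIV)"
    unfolding p_def
  proof (rule measurable_Least)
    fix n
    have "{x \<in> space (meas X). data_dist X (s n) x \<le> \<eta>} = mcball (s n) \<eta>" using s by auto
    moreover have "mcball (s n) \<eta> \<in> sets (meas X)" by (rule closed_sets) simp
    ultimately have "{x \<in> space (meas X). data_dist X (s n) x \<le> \<eta>} \<in> sets (meas X)" by simp
    then show "Measurable.pred (meas X) (\<lambda>x. data_dist X (s n) x \<le> \<eta>)"
      by (subst pred_def)
  qed
  ultimately show ?thesis using that s(1) by blast
qed

lemma dense_features_superseq:
  assumes "dense_features X f" "range f \<subseteq> range F" "\<And>k. F k \<in> feats X"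
  shows "dense_features X F"
proof -
  have "pw_adherent (pts X) (range F) h" if "h \<in> feats X" for h
    by (rule pw_adherent_trans[of _ "range f"]) (use assms that in \<open>auto simp: dense_features_def intro!: pw_adherent_superset\<close>)
  then show ?thesis using assms(3) by (auto simp: dense_features_def intro: pw_adherent_superset)
qed

lemma prob_Int_ge:
  assumes "prob_space N" "U \<in> sets N" "V \<in> sets N"
  shows "measure N (U \<inter> V) \<ge> measure N U + measure N V - 1"
proof -
  interpret N: prob_space N by fact
  show ?thesis
    using N.finite_measure_Union'[OF assms(2,3)] N.finite_measure_Diff'[OF assms(3,2)] N.prob_le_1[of "U \<union> V"]
    by (simp add: Int_commute)
qed

lemma couplingD:
  assumes "geom_data X" "geom_data Y" "\<pi> \<in> couplings X Y"
  shows "prob_space \<pi>" "fst \<in> measurable \<pi> (meas X)" "snd \<in> measurable \<pi> (meas Y)"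
    "distr \<pi> (meas X) fst = meas X" "distr \<pi> (meas Y) snd = meas Y" "space \<pi> = pts X \<times> pts Y"
    "\<And>S. closedin (prod_top X Y) S \<Longrightarrow> S \<in> sets \<pi>"
proof -
  have s: "sets \<pi> = sets (borel_of (prod_top X Y))" using assms(3) by (simp add: couplings_def)
  interpret X: geom_data X by fact
  interpret Y: geom_data Y by fact
  show "prob_space \<pi>" "distr \<pi> (meas X) fst = meas X" "distr \<pi> (meas Y) snd = meas Y"
    using assms(3) by (auto simp: couplings_def)
  show "fst \<in> measurable \<pi> (meas X)" "snd \<in> measurable \<pi> (meas Y)"
    using measurable_fst_prod_top[OF assms(1)] measurable_snd_prod_top[OF assms(2)]
    by (auto simp: measurable_cong_sets[OF s refl])
  show "space \<pi> = pts X \<times> pts Y" using sets_eq_imp_space_eq[OF s] by simp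
  show "S \<in> sets \<pi>" if "closedin (prod_top X Y) S" for S
    using borel_of_closed[OF that] by (simp add: s)
qed

lemma distr_comp_marginal:
  assumes "\<alpha> \<in> measurable N M" "distr N M \<alpha> = M" "p \<in> measurable M L"
  shows "distr N L (\<lambda>z. p (\<alpha> z)) = distr M L p"
  using distr_distr[OF assms(3,1)] by (simp add: assms(2) o_def)

text \<open>\<open>T\<close> will consist of tuples of matched features and \<open>F\<close> of a
  projection. Density is claimed for every sequence whose range lies between \<open>C\<close> and
  \<open>T\<close>, so that the sets \<open>C\<close> for several projections can be united and one
  enumeration of tuples becomes dense in all components at once.\<close>

lemma (in geom_data) countable_dense_subfamily:
  assumes "\<And>t. t \<in> T \<Longrightarrow> F t \<in> feats X" and sur: "\<And>f. f \<in> feats X \<Longrightarrow> \<exists>t\<in>T. F t = f"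
  shows "\<exists>C\<subseteq>T. countable C \<and> C \<noteq> {} \<and> (\<forall>t. C \<subseteq> range t \<and> range t \<subseteq> T \<longrightarrow> dense_features X (\<lambda>k. F (t k)))"
proof -
  obtain f where f: "dense_features X f" "\<And>k. f k \<in> feats X" using dense_features_exists by blast
  have "\<forall>k. \<exists>t\<in>T. F t = f k" using sur f(2) by blast
  then obtain u where u: "\<And>k. u k \<in> T" "\<And>k. F (u k) = f k" by metis
  have "dense_features X (\<lambda>k. F (t k))" if t: "range u \<subseteq> range t" "range t \<subseteq> T" for t
  proof (rule dense_features_superseq[OF f(1)])
    show "range f \<subseteq> range (\<lambda>k. F (t k))"
    proof (intro image_subsetI)
      fix k
      obtain j where "u k = t j" using t(1) by blast
      then show "f k \<in> range (\<lambda>k. F (t k))" unfolding u(2)[symmetric] by simp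
    qed
  qed (use assms(1) t(2) in blast)
  then show ?thesis using u(1) by (intro exI[of _ "range u"]) auto
qed

text \<open>Features are matched in triples, so that one index links all three spaces, and the two
  couplings are glued along small cells of the middle space. The two middle points then differ
  slightly, which costs the additional \<delta>.\<close>

lemma box_data_sum_le:
  fixes X :: "'a data_set" and Y :: "'b data_set" and Z :: "'c data_set"
  assumes "geom_data X" "geom_data Y" "geom_data Z" and a: "box_data X Y < ennreal a" and b: "box_data Y Z < ennreal b"
  shows "box_data X Z \<le> ennreal (a + b)"
proof (rule ennreal_le_epsilon)
  fix \<delta> :: real assume "\<delta> > 0"
  interpret X: geom_data X by fact
  interpret Y: geom_data Y by fact
  interpret Z: geom_data Z by fact
  have ab: "a > 0" "b > 0" using a b by (auto simp: not_le[symmetric] ennreal_neg)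
  obtain \<pi> S where \<pi>: "\<pi> \<in> couplings X Y" and S: "closedin (prod_top X Y) S" and mS: "measure \<pi> S \<ge> 1 - a"
    and XY: "\<forall>f\<in>feats X. \<exists>g\<in>feats Y. close_on S (a / 2) f g"
    and YX: "\<forall>g\<in>feats Y. \<exists>f\<in>feats X. close_on S (a / 2) f g"
    using box_dataE[OF a] .
  obtain \<pi>' S' where \<pi>': "\<pi>' \<in> couplings Y Z" and S': "closedin (prod_top Y Z) S'" and mS': "measure \<pi>' S' \<ge> 1 - b"
    and YZ: "\<forall>f\<in>feats Y. \<exists>g\<in>feats Z. close_on S' (b / 2) f g"
    and ZY: "\<forall>g\<in>feats Z. \<exists>f\<in>feats Y. close_on S' (b / 2) f g"
    using box_dataE[OF b] .
  define T where "T = {(f,g,h). f \<in> feats X \<and> g \<in> feats Y \<and> h \<in> feats Z \<and>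
    (close_on S (a / 2) f g) \<and> (close_on S' (b / 2) g h)}"
  have t1: "\<exists>t\<in>T. fst t = f" if "f \<in> feats X" for f
  proof -
    obtain g where g: "g \<in> feats Y" "close_on S (a / 2) f g" using XY[rule_format, OF \<open>f \<in> feats X\<close>] by blast
    obtain h where h: "h \<in> feats Z" "close_on S' (b / 2) g h" using YZ[rule_format, OF g(1)] by blast
    show ?thesis using that g h by (intro bexI[of _ "(f,g,h)"]) (auto simp: T_def)
  qed
  have t2: "\<exists>t\<in>T. fst (snd t) = g" if "g \<in> feats Y" for g
  proof -
    obtain f where f: "f \<in> feats X" "close_on S (a / 2) f g" using YX[rule_format, OF \<open>g \<in> feats Y\<close>] by blast
    obtain h where h: "h \<in> feats Z" "close_on S' (b / 2) g h" using YZ[rule_format, OF \<open>g \<in> feats Y\<close>] by blast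
    show ?thesis using that f h by (intro bexI[of _ "(f,g,h)"]) (auto simp: T_def)
  qed
  have t3: "\<exists>t\<in>T. snd (snd t) = h" if "h \<in> feats Z" for h
  proof -
    obtain g where g: "g \<in> feats Y" "close_on S' (b / 2) g h" using ZY[rule_format, OF \<open>h \<in> feats Z\<close>] by blast
    obtain f where f: "f \<in> feats X" "close_on S (a / 2) f g" using YX[rule_format, OF g(1)] by blast
    show ?thesis using that g f by (intro bexI[of _ "(f,g,h)"]) (auto simp: T_def)
  qed
  have TF: "fst t \<in> feats X" "fst (snd t) \<in> feats Y" "snd (snd t) \<in> feats Z" if "t \<in> T" for t
    using that by (auto simp: T_def)
  obtain C1 where C1: "C1 \<subseteq> T" "countable C1" "\<And>t. C1 \<subseteq> range t \<and> range t \<subseteq> T \<Longrightarrow> dense_features X (\<lambda>k. fst (t k))"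
    using X.countable_dense_subfamily[of T fst, OF TF(1) t1] by blast
  obtain C2 where C2: "C2 \<subseteq> T" "countable C2" "\<And>t. C2 \<subseteq> range t \<and> range t \<subseteq> T \<Longrightarrow> dense_features Y (\<lambda>k. fst (snd (t k)))"
    using Y.countable_dense_subfamily[of T "\<lambda>t. fst (snd t)", OF TF(2) t2] by blast
  obtain C3 where C3: "C3 \<subseteq> T" "countable C3" "C3 \<noteq> {}" "\<And>t. C3 \<subseteq> range t \<and> range t \<subseteq> T \<Longrightarrow> dense_features Z (\<lambda>k. snd (snd (t k)))"
    using Z.countable_dense_subfamily[of T "\<lambda>t. snd (snd t)", OF TF(3) t3] by blast
  define t where "t = from_nat_into (C1 \<union> C2 \<union> C3)"
  have rt: "range t = C1 \<union> C2 \<union> C3" unfolding t_def by (rule range_from_nat_into) (use C1 C2 C3 in auto)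
  then have tT: "t k \<in> T" for k using C1(1) C2(1) C3(1) by blast
  define f g h where "f = (\<lambda>k. fst (t k))" and "g = (\<lambda>k. fst (snd (t k)))" and "h = (\<lambda>k. snd (snd (t k)))"
  have T: "\<And>x y. (x,y) \<in> S \<Longrightarrow> \<bar>f k x - g k y\<bar> \<le> a / 2" "\<And>x y. (x,y) \<in> S' \<Longrightarrow> \<bar>g k x - h k y\<bar> \<le> b / 2" for k
    using tT[of k] by (auto simp: T_def f_def g_def h_def)
  have pf: "dense_features X f" and pg: "dense_features Y g" and ph: "dense_features Z h"
    unfolding f_def g_def h_def using rt C1(1) C2(1) C3(1) by (auto intro!: C1(3) C2(3) C3(4))
  \<comment> \<open>Two points of a common cell are within 2\<eta> = \<delta>/2, which is the room
    left in the bound (a + b + \<delta>) / 2.\<close>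
  define \<eta> where "\<eta> = \<delta> / 4"
  have "\<eta> > 0" using \<open>\<delta> > 0\<close> by (simp add: \<eta>_def)
  then obtain p :: "'b \<Rightarrow> nat" and s where p: "p \<in> measurable (meas Y) (count_space UNIV)" "\<And>n. s n \<in> pts Y"
    "\<And>x. x \<in> pts Y \<Longrightarrow> data_dist Y (s (p x)) x \<le> \<eta>" using Y.cells by blast
  note c = couplingD[OF assms(1,2) \<pi>] and c' = couplingD[OF assms(2,3) \<pi>']
  have eq: "distr \<pi> (count_space UNIV) (\<lambda>z. p (snd z)) = distr \<pi>' (count_space UNIV) (\<lambda>z. p (fst z))"
    using distr_comp_marginal[OF c(3,5) p(1)] distr_comp_marginal[OF c'(2,4) p(1)] by simp
  obtain N where N: "prob_space N" "sets N = sets (\<pi> \<Otimes>\<^sub>M \<pi>')" "distr N \<pi> fst = \<pi>" "distr N \<pi>' snd = \<pi>'"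
    "AE z in N. p (snd (fst z)) = p (fst (snd z))"
    using glue[OF c(1) c'(1) measurable_compose[OF c(3) p(1)] measurable_compose[OF c'(2) p(1)] eq] by blast
  interpret N: prob_space N by fact
  have fm: "fst \<in> measurable N \<pi>" and sm: "snd \<in> measurable N \<pi>'"
    by (simp_all add: measurable_cong_sets[OF N(2) refl])
  have \<alpha>: "(\<lambda>z. fst (fst z)) \<in> measurable N (meas X)" "distr N (meas X) (\<lambda>z. fst (fst z)) = meas X"
    using measurable_compose[OF fm c(2)] distr_comp_marginal[OF fm N(3) c(2)] c(4) by auto
  have \<beta>: "(\<lambda>z. snd (snd z)) \<in> measurable N (meas Z)" "distr N (meas Z) (\<lambda>z. snd (snd z)) = meas Z"
    using measurable_compose[OF sm c'(3)] distr_comp_marginal[OF sm N(4) c'(3)] c'(5) by auto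
  let ?E = "{\<omega>\<in>space N. \<forall>k. \<bar>f k (fst (fst \<omega>)) - h k (snd (snd \<omega>))\<bar> \<le> (a + b + \<delta>) / 2}"
  have mf: "(\<lambda>\<omega>. f k (fst (fst \<omega>))) \<in> borel_measurable N" for k
    using measurable_compose[OF \<alpha>(1) X.dense_features_measurable[OF pf]] .
  have mh: "(\<lambda>\<omega>. h k (snd (snd \<omega>))) \<in> borel_measurable N" for k
    using measurable_compose[OF \<beta>(1) Z.dense_features_measurable[OF ph]] .
  have E: "?E \<in> sets N" using mf mh by measurable
  let ?S = "fst -` S \<inter> space N" and ?S' = "snd -` S' \<inter> space N"
  have mS2: "?S \<in> sets N" "?S' \<in> sets N"
    using measurable_sets[OF fm c(7)[OF S]] measurable_sets[OF sm c'(7)[OF S']] .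
  have "measure N ?S = measure \<pi> S" using measure_distr[OF fm c(7)[OF S]] by (simp add: N(3))
  moreover have "measure N ?S' = measure \<pi>' S'" using measure_distr[OF sm c'(7)[OF S']] by (simp add: N(4))
  ultimately have "1 - (a + b) \<le> measure N (?S \<inter> ?S')"
    using prob_Int_ge[OF N(1) mS2] mS mS' by simp
  also have "\<dots> \<le> measure N ?E"
  proof (rule N.finite_measure_mono_AE)
    show "AE z in N. z \<in> ?S \<inter> ?S' \<longrightarrow> z \<in> ?E"
      using N(5)
    proof eventually_elim
      fix z :: "('a \<times> 'b) \<times> ('b \<times> 'c)" assume eqp: "p (snd (fst z)) = p (fst (snd z))"
      show "z \<in> ?S \<inter> ?S' \<longrightarrow> z \<in> ?E"
      proof
        assume z: "z \<in> ?S \<inter> ?S'"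
        obtain x y y' t where zz: "z = ((x,y),(y',t))" by (metis prod.collapse)
        have xy: "(x,y) \<in> S" "(y',t) \<in> S'" using z by (auto simp: zz)
        have yy: "y \<in> pts Y" "y' \<in> pts Y" using z measurable_space[OF fm, of z] measurable_space[OF sm, of z]
          by (auto simp: zz c(6) c'(6))
        have d: "data_dist Y (s (p y)) y \<le> \<eta>" "data_dist Y (s (p y)) y' \<le> \<eta>"
          using p(3)[OF yy(1)] p(3)[OF yy(2)] eqp by (auto simp: zz)
        have "\<bar>f k x - h k t\<bar> \<le> (a + b + \<delta>) / 2" for k
        proof -
          have "\<bar>g k y - g k y'\<bar> \<le> \<delta> / 2"
            using Y.dense_features_lip[OF pg p(2) yy(1), of k "p y"] Y.dense_features_lip[OF pg p(2) yy(2), of k "p y"] d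
            unfolding \<eta>_def by argo
          then show ?thesis using T(1)[OF xy(1), of k] T(2)[OF xy(2), of k] by argo
        qed
        then show "z \<in> ?E" using z by (simp add: zz)
      qed
    qed
  qed (rule E)
  finally have "1 - (a + b + \<delta>) \<le> measure N ?E" using \<open>\<delta> > 0\<close> by simp
  then have "box_data X Z \<le> ennreal (a + b + \<delta>)"
    by (intro box_data_upper[OF assms(1,3) N(1) \<alpha> \<beta> pf ph, where e = "(a + b + \<delta>) / 2"]) auto
  then show "box_data X Z \<le> ennreal (a + b) + ennreal \<delta>"
    using ab \<open>\<delta> > 0\<close> by (simp add: ennreal_plus)
qed

text \<open>Independent points form a coupling, and for c = 1 the probability bound of
  \<open>box_data_upper\<close> is void.\<close>

lemma box_data_le_1:
  assumes "geom_data X" "geom_data Y" shows "box_data X Y \<le> 1"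
proof -
  interpret X: geom_data X by fact
  interpret Y: geom_data Y by fact
  interpret XY: pair_prob_space "meas X" "meas Y" ..
  obtain f g where "dense_features X f" "dense_features Y g" using X.dense_features_exists Y.dense_features_exists by metis
  moreover have "distr (meas X \<Otimes>\<^sub>M meas Y) (meas X) fst = meas X"
    using Y.P.distr_pair_fst[of "meas X"] by simp
  moreover have "distr (meas X \<Otimes>\<^sub>M meas Y) (meas Y) snd = meas Y"
  proof (rule measure_eqI)
    fix A assume "A \<in> sets (distr (meas X \<Otimes>\<^sub>M meas Y) (meas Y) snd)"
    then have A: "A \<in> sets (meas Y)" by simp
    have "snd -` A \<inter> space (meas X \<Otimes>\<^sub>M meas Y) = space (meas X) \<times> A"
      using sets.sets_into_space[OF A] by (auto simp: space_pair_measure)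
    then show "emeasure (distr (meas X \<Otimes>\<^sub>M meas Y) (meas Y) snd) A = emeasure (meas Y) A"
      using A Y.P.emeasure_pair_measure_Times[OF sets.top A, of "meas X"] X.P.emeasure_space_1
      by (simp add: emeasure_distr del: X.space_meas)
  qed simp
  ultimately have "box_data X Y \<le> ennreal 1"
    by (intro box_data_upper[OF assms XY.prob_space_axioms measurable_fst _ measurable_snd, where e = 0]) auto
  then show ?thesis by simp
qed

text \<open>A converse to \<open>box_data_upper\<close>: the matched pairs of features are
  enumerated by one sequence that is dense in both components.\<close>

lemma box_data_dense_featuresE:
  fixes X :: "'a data_set" and Y :: "'b data_set"
  assumes "geom_data X" "geom_data Y" and c: "box_data X Y < ennreal c"
  obtains \<pi> f g where "\<pi> \<in> couplings X Y" "dense_features X f" "dense_features Y g"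
    "measure \<pi> {z\<in>space \<pi>. \<forall>k. \<bar>f k (fst z) - g k (snd z)\<bar> \<le> c/2} \<ge> 1 - c"
proof -
  interpret X: geom_data X by fact
  interpret Y: geom_data Y by fact
  obtain \<pi> S where \<pi>: "\<pi> \<in> couplings X Y" and S: "closedin (prod_top X Y) S" and mS: "measure \<pi> S \<ge> 1 - c"
    and XY: "\<forall>f\<in>feats X. \<exists>g\<in>feats Y. close_on S (c / 2) f g"
    and YX: "\<forall>g\<in>feats Y. \<exists>f\<in>feats X. close_on S (c / 2) f g"
    using box_dataE[OF c] .
  define T where "T = {(f,g). f \<in> feats X \<and> g \<in> feats Y \<and> (close_on S (c / 2) f g)}"
  have TF: "fst t \<in> feats X" "snd t \<in> feats Y" if "t \<in> T" for t using that by (auto simp: T_def)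
  have t1: "\<exists>t\<in>T. fst t = f" if "f \<in> feats X" for f using XY[rule_format, OF that] that by (force simp: T_def)
  have t2: "\<exists>t\<in>T. snd t = g" if "g \<in> feats Y" for g using YX[rule_format, OF that] that by (force simp: T_def)
  obtain C1 where C1: "C1 \<subseteq> T" "countable C1" "\<And>t. C1 \<subseteq> range t \<and> range t \<subseteq> T \<Longrightarrow> dense_features X (\<lambda>k. fst (t k))"
    using X.countable_dense_subfamily[of T fst, OF TF(1) t1] by blast
  obtain C2 where C2: "C2 \<subseteq> T" "countable C2" "C2 \<noteq> {}" "\<And>t. C2 \<subseteq> range t \<and> range t \<subseteq> T \<Longrightarrow> dense_features Y (\<lambda>k. snd (t k))"
    using Y.countable_dense_subfamily[of T snd, OF TF(2) t2] by blast
  define t where "t = from_nat_into (C1 \<union> C2)"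
  have rt: "range t = C1 \<union> C2" unfolding t_def by (rule range_from_nat_into) (use C1 C2 in auto)
  then have tT: "t k \<in> T" for k using C1(1) C2(1) by blast
  define f g where "f = (\<lambda>k. fst (t k))" and "g = (\<lambda>k. snd (t k))"
  have T: "\<And>x y. (x,y) \<in> S \<Longrightarrow> \<bar>f k x - g k y\<bar> \<le> c / 2" for k
    using tT[of k] by (auto simp: T_def f_def g_def)
  have pf: "dense_features X f" and pg: "dense_features Y g"
    unfolding f_def g_def using rt C1(1) C2(1) by (auto intro!: C1(3) C2(4))
  note cp = couplingD[OF assms(1,2) \<pi>]
  interpret \<pi>: prob_space \<pi> by (rule cp)
  have "measure \<pi> S \<le> measure \<pi> {z\<in>space \<pi>. \<forall>k. \<bar>f k (fst z) - g k (snd z)\<bar> \<le> c/2}"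
  proof (rule \<pi>.finite_measure_mono)
    show "S \<subseteq> {z\<in>space \<pi>. \<forall>k. \<bar>f k (fst z) - g k (snd z)\<bar> \<le> c/2}"
      using sets.sets_into_space[OF cp(7)[OF S]] T by auto
    have "(\<lambda>z. f k (fst z)) \<in> borel_measurable \<pi>" "(\<lambda>z. g k (snd z)) \<in> borel_measurable \<pi>" for k
      using measurable_compose[OF cp(2) X.dense_features_measurable[OF pf]]
        measurable_compose[OF cp(3) Y.dense_features_measurable[OF pg]] by auto
    then show "{z\<in>space \<pi>. \<forall>k. \<bar>f k (fst z) - g k (snd z)\<bar> \<le> c/2} \<in> sets \<pi>" by measurable
  qed
  then show ?thesis using that[OF \<pi> pf pg] mS by linarith
qed

text \<open>The coupling is not swapped as a measure; \<open>box_data_upper\<close> is applied to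
  the same probability space with the two projections exchanged.\<close>

lemma box_data_commute_le:
  assumes "geom_data X" "geom_data Y" 
  shows "box_data Y X \<le> box_data X Y"
proof (rule ennreal_le_epsilon)
  fix e :: real assume e: "e > 0" and fin: "box_data X Y < top"
  define c where "c = enn2real (box_data X Y) + e"
  have c: "box_data X Y + ennreal e = ennreal c"
    using fin e by (simp add: c_def ennreal_plus less_top)
  have "box_data X Y < ennreal c"
    unfolding c[symmetric] using fin e ennreal_add_left_cancel_less[of "box_data X Y" 0 "ennreal e"]
    by (simp add: less_top)
  then obtain \<pi> f g where p: "\<pi> \<in> couplings X Y" "dense_features X f" "dense_features Y g"
    "measure \<pi> {z\<in>space \<pi>. \<forall>k. \<bar>f k (fst z) - g k (snd z)\<bar> \<le> c/2} \<ge> 1 - c"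
    using box_data_dense_featuresE[OF assms] by blast
  note cp = couplingD[OF assms p(1)]
  show "box_data Y X \<le> box_data X Y + ennreal e"
    unfolding c using p(4)
    by (intro box_data_upper[OF assms(2,1) cp(1) cp(3,5) cp(2,4) p(3,2), where e = "c/2"])
      (auto simp: abs_minus_commute)
qed

lemma box_data_commute:
  assumes "geom_data X" "geom_data Y" shows "box_data X Y = box_data Y X"
  by (intro antisym box_data_commute_le assms)

lemma box_data_triangle:
  assumes "geom_data X" "geom_data Y" "geom_data Z"
  shows "box_data X Z \<le> box_data X Y + box_data Y Z"
proof (rule ennreal_le_epsilon)
  fix e :: real assume e: "e > 0"
  define a where "a = enn2real (box_data X Y)"
  define b where "b = enn2real (box_data Y Z)"
  have ab: "box_data X Y = ennreal a" "box_data Y Z = ennreal b" "a \<ge> 0" "b \<ge> 0"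
    using box_data_le_1[OF assms(1,2)] box_data_le_1[OF assms(2,3)]
    by (auto simp: a_def b_def ennreal_enn2real_if top_unique)
  have "box_data X Z \<le> ennreal ((a + e/2) + (b + e/2))"
    by (rule box_data_sum_le[OF assms]) (use ab e in \<open>auto simp: ennreal_less_iff\<close>)
  also have "\<dots> = box_data X Y + box_data Y Z + ennreal e"
    using ab e by (simp add: ennreal_plus[symmetric] del: ennreal_plus)
  finally show "box_data X Z \<le> box_data X Y + box_data Y Z + ennreal e" .
qed

text \<open>Coordinates transported along the isomorphism agree exactly, so e = 0 works on the whole
  space.\<close>

lemma box_data_iso:
  assumes "geom_data X" "geom_data Y" "data_iso X Y"
  shows "box_data X Y = 0"
proof -
  interpret X: geom_data X by fact
  interpret Y: geom_data Y by fact
  obtain g where g: "dense_features Y g" using Y.dense_features_exists by blast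
  obtain \<phi> where \<phi>: "\<phi> \<in> measurable (meas X) (meas Y)" "distr (meas X) (meas Y) \<phi> = meas Y"
    and f: "dense_features X (\<lambda>k x. g k (\<phi> x))"
    using data_isoE[OF assms g] by blast
  have "box_data X Y \<le> ennreal 0"
    by (rule box_data_upper[OF assms(1,2) X.P.prob_space_axioms _ _ \<phi>(1,2) f g, where \<alpha>="\<lambda>x. x" and e=0])
       (use X.P.prob_space in \<open>auto simp: distr_id2\<close>)
  then show ?thesis by simp
qed

lemma box_data_iso_cong:
  assumes "geom_data X" "geom_data X'" "geom_data Y" "geom_data Y'" "data_iso X X'" "data_iso Y Y'"
  shows "box_data X Y = box_data X' Y'"
proof (rule antisym)
  have z: "box_data X X' = 0" "box_data X' X = 0" "box_data Y Y' = 0" "box_data Y' Y = 0"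
    using box_data_iso assms data_iso_sym by blast+
  show "box_data X Y \<le> box_data X' Y'"
    using box_data_triangle[OF assms(1,2,3)] box_data_triangle[OF assms(2,4,3)] z by simp
  show "box_data X' Y' \<le> box_data X Y"
    using box_data_triangle[OF assms(2,1,4)] box_data_triangle[OF assms(1,3,4)] z by simp
qed


section \<open>Vanishing box distance\<close>

abbreviation seq_borel :: "(nat \<Rightarrow> real) measure" where
  "seq_borel \<equiv> PiM UNIV (\<lambda>_. borel)"

lemma sets_seq_borel: "sets seq_borel = sets borel"
  by (rule sets_PiM_equal_borel)

lemma tendsto_fun_iff:
  fixes f :: "nat \<Rightarrow> nat \<Rightarrow> real"
  shows "(f \<longlongrightarrow> l) F \<longleftrightarrow> (\<forall>i. ((\<lambda>n. f n i) \<longlongrightarrow> l i) F)"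
  unfolding limitin_canonical_iff[symmetric]
  by (simp add: euclidean_product_topology[symmetric] limitin_componentwise)

text \<open>A Prokhorov type closeness of two laws on sequences, tested on the first
  \<open>N\<close> coordinates.\<close>

abbreviation coupled_within :: "(nat \<Rightarrow> real) measure \<Rightarrow> (nat \<Rightarrow> real) measure \<Rightarrow> nat \<Rightarrow> real \<Rightarrow>
    'm measure \<Rightarrow> ('m \<Rightarrow> nat \<Rightarrow> real) \<Rightarrow> ('m \<Rightarrow> nat \<Rightarrow> real) \<Rightarrow> bool" where
  "coupled_within \<mu> \<nu> N \<eta> M U V \<equiv> prob_space M \<and> U \<in> measurable M seq_borel \<and> V \<in> measurable M seq_borel \<and>
     distr M seq_borel U = \<mu> \<and> distr M seq_borel V = \<nu> \<and> measure M {z\<in>space M. \<forall>k<N. \<bar>U z k - V z k\<bar> \<le> \<eta>} \<ge> 1 - \<eta>"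

text \<open>\<open>C\<close> is the decreasing intersection of the open sets \<open>W N\<close>, in
  which the first \<open>N\<close> coordinates lie within 1/(N+1) of those of some point of
  \<open>C\<close>. An approximate coupling compares the mass of \<open>C\<close> with that of
  \<open>W N\<close> up to an arbitrarily small error.\<close>

lemma closed_distr_le:
  assumes ap: "\<And>N \<eta>. \<eta> > 0 \<Longrightarrow> \<exists>(M :: 'm measure) U V. coupled_within \<mu> \<nu> N \<eta> M U V"
    and C: "closed C"
  shows "measure \<mu> C \<le> measure \<nu> C"
proof -
  define W where "W N = (\<Union>c\<in>C. {w :: nat \<Rightarrow> real. \<forall>k<N. \<bar>w k - c k\<bar> < inverse (real (Suc N))})" for N
  have "open {w :: nat \<Rightarrow> real. \<forall>k<N. \<bar>w k - c k\<bar> < inverse (real (Suc N))}" for N c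
  proof -
    have "{w :: nat \<Rightarrow> real. \<forall>k<N. \<bar>w k - c k\<bar> < inverse (real (Suc N))} =
      (\<Inter>k\<in>{..<N}. {w. \<bar>w k - c k\<bar> < inverse (real (Suc N))})" by auto
    also have "open \<dots>"
      by (intro open_INT ballI open_Collect_less continuous_intros continuous_on_product_coordinates) auto
    finally show ?thesis .
  qed
  then have "open (W N)" for N unfolding W_def by blast
  then have Wm: "W N \<in> sets seq_borel" for N by (simp add: sets_seq_borel)
  have Cm: "C \<in> sets seq_borel" using C by (simp add: sets_seq_borel)
  obtain M0 :: "'m measure" and U0 V0 where M0: "prob_space M0" "U0 \<in> measurable M0 seq_borel" "V0 \<in> measurable M0 seq_borel"
      "distr M0 seq_borel U0 = \<mu>" "distr M0 seq_borel V0 = \<nu>"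
    using ap[OF zero_less_one, of 0] by (elim exE conjE)
  have pr: "prob_space \<mu>" "prob_space \<nu>" "sets \<mu> = sets seq_borel" "sets \<nu> = sets seq_borel"
    using prob_space.prob_space_distr[OF M0(1,2)] prob_space.prob_space_distr[OF M0(1,3)]
      sets_distr[of M0 seq_borel U0] sets_distr[of M0 seq_borel V0] by (simp_all only: M0(4,5))
  interpret \<mu>: prob_space \<mu> by (rule pr)
  interpret \<nu>: prob_space \<nu> by (rule pr)
  have le: "measure \<mu> C \<le> measure \<nu> (W N)" for N
  proof (rule field_le_epsilon)
    fix e :: real assume "e > 0"
    \<comment> \<open>The half makes the distance strictly smaller than the radius in
      \<open>W N\<close>.\<close>
    define \<eta> where "\<eta> = min e (inverse (real (Suc N)) / 2)"
    have \<eta>: "\<eta> > 0" "\<eta> \<le> e" "\<eta> < inverse (real (Suc N))" using \<open>e > 0\<close> by (auto simp: \<eta>_def min_def)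
    obtain M :: "'m measure" and U V where M: "prob_space M" "U \<in> measurable M seq_borel" "V \<in> measurable M seq_borel"
      "distr M seq_borel U = \<mu>" "distr M seq_borel V = \<nu>" "measure M {z\<in>space M. \<forall>k<N. \<bar>U z k - V z k\<bar> \<le> \<eta>} \<ge> 1 - \<eta>"
      using ap[OF \<eta>(1), of N] by (elim exE conjE)
    interpret M: prob_space M by (rule M)
    let ?E = "{z\<in>space M. \<forall>k<N. \<bar>U z k - V z k\<bar> \<le> \<eta>}"
    have "(\<lambda>z. U z k) \<in> borel_measurable M" "(\<lambda>z. V z k) \<in> borel_measurable M" for k
      using measurable_compose[OF M(2) measurable_component_singleton[of k]]
       measurable_compose[OF M(3) measurable_component_singleton[of k]] by auto
    then have E: "?E \<in> sets M" by measurable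
    have mU: "U -` C \<inter> space M \<in> sets M" and mV: "V -` W N \<inter> space M \<in> sets M"
      using measurable_sets[OF M(2) Cm] measurable_sets[OF M(3) Wm] by auto
    have "measure \<mu> C = M.prob (U -` C \<inter> space M)"
      using measure_distr[OF M(2) Cm] by (simp add: M(4))
    also have "\<dots> \<le> M.prob ((U -` C \<inter> space M) \<inter> ?E) + \<eta>"
      using prob_Int_ge[OF M(1) mU E] M(6) by linarith
    also have "M.prob ((U -` C \<inter> space M) \<inter> ?E) \<le> M.prob (V -` W N \<inter> space M)"
    proof (rule M.finite_measure_mono[OF _ mV])
      show "(U -` C \<inter> space M) \<inter> ?E \<subseteq> V -` W N \<inter> space M"
      proof
        fix z assume z: "z \<in> (U -` C \<inter> space M) \<inter> ?E"
        have "\<bar>V z k - U z k\<bar> < inverse (real (Suc N))" if "k < N" for k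
          using z that \<eta>(3) by (auto simp: abs_minus_commute intro: le_less_trans)
        then show "z \<in> V -` W N \<inter> space M" using z by (auto simp: W_def)
      qed
    qed
    also have "M.prob (V -` W N \<inter> space M) = measure \<nu> (W N)"
      using measure_distr[OF M(3) Wm[of N]] by (simp add: M(5))
    finally show "measure \<mu> C \<le> measure \<nu> (W N) + e" using \<eta>(2) by linarith
  qed
  have dec: "decseq W"
  proof (rule decseq_SucI)
    fix N
    have i: "inverse (real (Suc (Suc N))) \<le> inverse (real (Suc N))" by (intro le_imp_inverse_le) auto
    show "W (Suc N) \<subseteq> W N"
    proof
      fix w assume "w \<in> W (Suc N)"
      then obtain c where c: "c \<in> C" "\<And>k. k < Suc N \<Longrightarrow> \<bar>w k - c k\<bar> < inverse (real (Suc (Suc N)))"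
        unfolding W_def by blast
      have "\<bar>w k - c k\<bar> < inverse (real (Suc N))" if "k < N" for k
        using c(2)[of k] that i by linarith
      with c(1) show "w \<in> W N" unfolding W_def by blast
    qed
  qed
  have "(\<lambda>N. measure \<nu> (W N)) \<longlonglongrightarrow> measure \<nu> (\<Inter>N. W N)"
    by (rule \<nu>.finite_Lim_measure_decseq) (use Wm dec pr in auto)
  moreover have "(\<Inter>N. W N) = C"
  proof (intro equalityI subsetI)
    fix w assume "w \<in> (\<Inter>N. W N)"
    then have "\<forall>N. \<exists>c\<in>C. \<forall>k<N. \<bar>w k - c k\<bar> < inverse (real (Suc N))" by (auto simp: W_def)
    then obtain c where c: "\<And>N. c N \<in> C" "\<And>N k. k < N \<Longrightarrow> \<bar>w k - c N k\<bar> < inverse (real (Suc N))" by metis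
    have "c \<longlonglongrightarrow> w"
      unfolding tendsto_fun_iff
    proof
      fix k
      have "(\<lambda>N. c N k - w k) \<longlonglongrightarrow> 0"
      proof (rule Lim_null_comparison)
        show "\<forall>\<^sub>F N in sequentially. norm (c N k - w k) \<le> inverse (real (Suc N))"
          using eventually_gt_at_top[of k]
        proof eventually_elim
          fix N assume "k < N"
          from c(2)[OF this] show "norm (c N k - w k) \<le> inverse (real (Suc N))"
            unfolding real_norm_def abs_minus_commute[of "c N k"] by linarith
        qed
      qed (rule LIMSEQ_inverse_real_of_nat)
      then show "(\<lambda>N. c N k) \<longlonglongrightarrow> w k" by (rule LIM_zero_cancel)
    qed
    then show "w \<in> C" using closed_sequentially[OF C] c(1) by blast
  next
    fix w assume "w \<in> C"
    then show "w \<in> (\<Inter>N. W N)" by (auto simp: W_def intro!: bexI[of _ w])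
  qed
  ultimately show ?thesis using le by (auto intro: LIMSEQ_le_const)
qed

text \<open>The hypothesis is symmetric in the two laws, so they agree on closed sets, which
  generate the Borel sets and are stable under intersections.\<close>

lemma distr_eq_if_approx_coupled:
  assumes ap: "\<And>N \<eta>. \<eta> > 0 \<Longrightarrow> \<exists>(M :: 'm measure) U V. coupled_within \<mu> \<nu> N \<eta> M U V"
  shows "\<mu> = \<nu>"
proof -
  obtain M0 :: "'m measure" and U0 V0 where M0: "prob_space M0" "U0 \<in> measurable M0 seq_borel" "V0 \<in> measurable M0 seq_borel"
      "distr M0 seq_borel U0 = \<mu>" "distr M0 seq_borel V0 = \<nu>"
    using ap[OF zero_less_one, of 0] by (elim exE conjE)
  have pr: "prob_space \<mu>" "prob_space \<nu>" "sets \<mu> = sets seq_borel" "sets \<nu> = sets seq_borel"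
    using prob_space.prob_space_distr[OF M0(1,2)] prob_space.prob_space_distr[OF M0(1,3)]
      sets_distr[of M0 seq_borel U0] sets_distr[of M0 seq_borel V0] by (simp_all only: M0(4,5))
  interpret \<mu>: prob_space \<mu> by (rule pr)
  interpret \<nu>: prob_space \<nu> by (rule pr)
  have eq: "measure \<mu> C = measure \<nu> C" if "closed C" for C
  proof (rule antisym)
    show "measure \<mu> C \<le> measure \<nu> C" by (rule closed_distr_le[OF ap that])
    show "measure \<nu> C \<le> measure \<mu> C"
    proof (rule closed_distr_le[where 'm = 'm, OF _ that])
      fix N \<eta> assume "(\<eta>::real) > 0"
      from ap[OF this, of N] obtain M :: "'m measure" and U V where M: "prob_space M" "U \<in> measurable M seq_borel" "V \<in> measurable M seq_borel"
        "distr M seq_borel U = \<mu>" "distr M seq_borel V = \<nu>" "measure M {z\<in>space M. \<forall>k<N. \<bar>U z k - V z k\<bar> \<le> \<eta>} \<ge> 1 - \<eta>"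
        by (elim exE conjE)
      show "\<exists>(M :: 'm measure) U V. coupled_within \<nu> \<mu> N \<eta> M U V"
        by (intro exI[of _ M] exI[of _ V] exI[of _ U]) (use M in \<open>simp add: abs_minus_commute\<close>)
    qed
  qed
  have bc: "sets (borel :: (nat \<Rightarrow> real) measure) = sigma_sets UNIV (Collect closed)"
    by (subst borel_eq_closed) (simp add: sets_measure_of)
  have b: "sets \<mu> = sigma_sets UNIV (Collect closed)" "sets \<nu> = sigma_sets UNIV (Collect closed)"
    by (simp_all only: pr sets_seq_borel bc)
  show ?thesis
  proof (rule measure_eqI_generator_eq[where \<Omega> = UNIV and E = "Collect closed" and A = "\<lambda>_. UNIV"])
    show "Int_stable (Collect (closed :: (nat \<Rightarrow> real) set \<Rightarrow> bool))" by (auto simp: Int_stable_def)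
    show "emeasure \<mu> X = emeasure \<nu> X" if "X \<in> Collect closed" for X
      using eq[of X] that by (simp add: \<mu>.emeasure_eq_measure \<nu>.emeasure_eq_measure)
  qed (use b in auto)
qed

section \<open>Pointwise limits and compactness of \<open>K\<close>-valued features\<close>

lemma pw_adherent_limit:
  assumes "\<And>n. F n \<in> G" "\<And>x. x \<in> A \<Longrightarrow> (\<lambda>n. F n x) \<longlonglongrightarrow> h x"
  shows "pw_adherent A G h"
  unfolding pw_adherent_def
proof (intro allI impI)
  fix B \<epsilon> assume B: "finite B" "B \<subseteq> A" "(\<epsilon>::real) > 0"
  have "\<forall>\<^sub>F n in sequentially. \<forall>b\<in>B. \<bar>F n b - h b\<bar> < \<epsilon>"
  proof (rule eventually_ball_finite[OF B(1)], rule ballI)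
    fix b assume "b \<in> B"
    then show "\<forall>\<^sub>F n in sequentially. \<bar>F n b - h b\<bar> < \<epsilon>"
      using tendstoD[OF assms(2) B(3), of b] B(2) by (auto simp: dist_real_def)
  qed
  then obtain n where "\<forall>b\<in>B. \<bar>F n b - h b\<bar> < \<epsilon>" by (auto simp: eventually_sequentially)
  then show "\<exists>f\<in>G. \<forall>b\<in>B. \<bar>f b - h b\<bar> < \<epsilon>" using assms(1) by blast
qed

definition K_valued :: "'a data_set \<Rightarrow> bool" where
  "K_valued X \<longleftrightarrow> (\<forall>f\<in>feats X. \<forall>x\<in>pts X. f x \<in> {-1/2..1/2})"

text \<open>The cube is compact by Tychonoff and sequentially compact in sequence space, so a single
  extraction makes all coordinates converge.\<close>

lemma bounded_convergent_subseq:
  fixes H :: "nat \<Rightarrow> nat \<Rightarrow> real"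
  assumes "\<And>n i. H n i \<in> {a..b}"
  obtains r where "strict_mono r" "\<And>i. convergent (\<lambda>n. H (r n) i)"
proof -
  have "compactin (product_topology (\<lambda>_. euclideanreal) UNIV) (PiE (UNIV :: nat set) (\<lambda>_. {a..b}))"
    by (subst compactin_PiE) auto
  then have "compact (PiE (UNIV :: nat set) (\<lambda>_. {a..b}))"
    by (simp add: euclidean_product_topology)
  then have "seq_compact (PiE (UNIV :: nat set) (\<lambda>_. {a..b}))"
    by (rule compact_imp_seq_compact)
  moreover have "\<forall>n. H n \<in> PiE UNIV (\<lambda>_. {a..b})" using assms by auto
  ultimately obtain l r where r: "strict_mono r" "(H \<circ> r) \<longlonglongrightarrow> l"
    unfolding seq_compact_def by metis
  have "(\<lambda>n. H (r n) i) \<longlonglongrightarrow> l i" for i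
    using r(2) unfolding tendsto_fun_iff by (simp add: o_def)
  then show ?thesis using that[OF r(1)] by (auto simp: convergent_def)
qed

text \<open>The values of all features at a dense sequence of points are coded into one bounded
  sequence. Convergence at the dense points extends to every point by the common Lipschitz
  bound.\<close>

lemma (in geom_data) feats_convergent_subseq:
  fixes F :: "nat \<Rightarrow> nat \<Rightarrow> 'a \<Rightarrow> real"
  assumes "K_valued X" "\<And>n k. F n k \<in> feats X"
  shows "\<exists>r f. strict_mono r \<and> (\<forall>k. \<forall>x\<in>pts X. (\<lambda>n. F (r n) (k::nat) x) \<longlonglongrightarrow> f k x)"
proof -
  obtain s :: "nat \<Rightarrow> 'a" where s: "\<And>n. s n \<in> pts X"
    "\<And>x r. x \<in> pts X \<Longrightarrow> r > 0 \<Longrightarrow> \<exists>n. data_dist X (s n) x < r"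
    using dense_seq by blast
  define H :: "nat \<Rightarrow> nat \<Rightarrow> real" where "H n i = (case prod_decode i of (k, m) \<Rightarrow> F n k (s m))" for n i
  have "H n i \<in> {-1/2..1/2}" for n i
    using assms s(1) by (auto simp: H_def K_valued_def split: prod.splits)
  then obtain r where r: "strict_mono r" "\<And>i. convergent (\<lambda>n. H (r n) i)"
    using bounded_convergent_subseq[of H "-1/2" "1/2"] by blast
  have cs: "convergent (\<lambda>n. F (r n) k (s m))" for k m
    using r(2)[of "prod_encode (k,m)"] by (simp add: H_def)
  have "convergent (\<lambda>n. F (r n) k x)" if x: "x \<in> pts X" for k x
  proof (rule Cauchy_convergent, rule metric_CauchyI)
    fix e :: real assume "e > 0"
    then obtain m where m: "data_dist X (s m) x < e/3" using s(2)[OF x, of "e/3"] by auto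
    have "Cauchy (\<lambda>n. F (r n) k (s m))" using cs convergent_Cauchy by blast
    then obtain N where N: "\<And>i j. i \<ge> N \<Longrightarrow> j \<ge> N \<Longrightarrow> dist (F (r i) k (s m)) (F (r j) k (s m)) < e/3"
      using \<open>e > 0\<close> metric_CauchyD[of _ "e/3"] by (metis divide_pos_pos zero_less_numeral)
    have "dist (F (r i) k x) (F (r j) k x) < e" if "i \<ge> N" "j \<ge> N" for i j
      using N[OF that] feat_lip[OF assms(2) s(1) x, of "r i" k m] feat_lip[OF assms(2) s(1) x, of "r j" k m] m
      unfolding dist_real_def by argo
    then show "\<exists>N. \<forall>i\<ge>N. \<forall>j\<ge>N. dist (F (r i) k x) (F (r j) k x) < e" by blast
  qed
  then show ?thesis
    using r(1) by (intro exI[of _ r] exI[of _ "\<lambda>k x. lim (\<lambda>n. F (r n) k x)"]) (simp add: convergent_LIMSEQ_iff)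
qed

text \<open>Convergence at the finitely many net points becomes uniform on the balls around them:
  one error at the net point and two Lipschitz errors add up to 3\<eta>.\<close>

lemma (in geom_data) near_limit:
  fixes F :: "nat \<Rightarrow> nat \<Rightarrow> 'a \<Rightarrow> real"
  assumes F: "\<And>n k. F n k \<in> feats X" and lim: "\<And>k x. x \<in> pts X \<Longrightarrow> (\<lambda>n. F n (k::nat) x) \<longlonglongrightarrow> f k x"
    and A: "finite A" "A \<subseteq> pts X" and \<eta>: "\<eta> > 0"
  shows "\<forall>\<^sub>F n in sequentially. \<forall>k<N. \<forall>x\<in>(\<Union>a\<in>A. mcball a \<eta>). \<bar>F n k x - f k x\<bar> \<le> 3 * \<eta>"
proof -
  have "\<forall>\<^sub>F n in sequentially. \<forall>k\<in>{..<N}. \<forall>a\<in>A. dist (F n k a) (f k a) < \<eta>"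
    by (intro eventually_ball_finite ballI finite_lessThan A(1) tendstoD[OF lim \<eta>]) (use A in auto)
  then show ?thesis
  proof eventually_elim
    fix n assume n: "\<forall>k\<in>{..<N}. \<forall>a\<in>A. dist (F n k a) (f k a) < \<eta>"
    show "\<forall>k<N. \<forall>x\<in>(\<Union>a\<in>A. mcball a \<eta>). \<bar>F n k x - f k x\<bar> \<le> 3 * \<eta>"
    proof (intro allI impI ballI)
      fix k x assume k: "k < N" and "x \<in> (\<Union>a\<in>A. mcball a \<eta>)"
      then obtain a where a: "a \<in> A" "x \<in> pts X" "a \<in> pts X" "data_dist X a x \<le> \<eta>" by auto
      have "pw_adherent (pts X) (feats X) (f k)" by (rule pw_adherent_limit[of "\<lambda>n. F n k"]) (use F lim in auto)
      then have "\<bar>f k a - f k x\<bar> \<le> \<eta>" using pw_adherent_lip[of "f k" a x] a by linarith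
      moreover have "\<bar>F n k a - F n k x\<bar> \<le> \<eta>" using feat_lip[OF F a(3,2), of n k] a by linarith
      moreover have "\<bar>F n k a - f k a\<bar> < \<eta>" using n k a(1) by (simp add: dist_real_def)
      ultimately show "\<bar>F n k x - f k x\<bar> \<le> 3 * \<eta>" by argo
    qed
  qed
qed

text \<open>Limits of arbitrarily chosen features could fail to be dense. The indices
  \<open>i k\<close> are therefore reserved for a dense sequence that does not move with
  \<open>n\<close>.\<close>

lemma dense_features_limit:
  fixes F :: "nat \<Rightarrow> nat \<Rightarrow> 'a \<Rightarrow> real"
  assumes F: "\<And>n k. F n k \<in> feats X" and lim: "\<And>k x. x \<in> pts X \<Longrightarrow> (\<lambda>n. F n (k::nat) x) \<longlonglongrightarrow> f k x"
    and p: "dense_features X f0" and c: "\<And>n k. F n (i k) = f0 k"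
  shows "dense_features X f"
  unfolding dense_features_def
proof (intro conjI allI ballI)
  show "pw_adherent (pts X) (feats X) (f k)" for k
    by (rule pw_adherent_limit[of "\<lambda>n. F n k"]) (use F lim in auto)
  fix h assume "h \<in> feats X"
  then have "pw_adherent (pts X) (range f0) h" using p by (simp add: dense_features_def)
  then show "pw_adherent (pts X) (range f) h"
  proof (rule pw_adherent_trans)
    fix g assume "g \<in> range f0"
    then obtain k where k: "g = f0 k" by blast
    have "pw_adherent (pts X) (range f) (f (i k))" by (rule pw_adherent_superset) simp
    then show "pw_adherent (pts X) (range f) g"
    proof (rule pw_adherent_cong)
      fix x assume "x \<in> pts X"
      from lim[OF this, of "i k"] show "f (i k) x = g x"
        by (simp add: c k LIMSEQ_const_iff)
    qed
  qed
qed

theorem box_data_zero_imp_iso: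
  fixes X :: "'a data_set" and Y :: "'b data_set"
  assumes "geom_data X" "geom_data Y" "K_valued X" "K_valued Y" and z: "box_data X Y = 0"
  shows "data_iso X Y"
proof -
  interpret X: geom_data X by fact
  interpret Y: geom_data Y by fact
  define \<epsilon> where "\<epsilon> n = inverse (real (Suc n))" for n
  have \<epsilon>: "\<epsilon> n > 0" for n by (simp add: \<epsilon>_def)
  have "\<exists>\<pi> S. \<pi> \<in> couplings X Y \<and> closedin (prod_top X Y) S \<and> measure \<pi> S \<ge> 1 - \<epsilon> n \<and>
    (\<forall>f\<in>feats X. \<exists>g\<in>feats Y. close_on S (\<epsilon> n / 2) f g) \<and>
    (\<forall>g\<in>feats Y. \<exists>f\<in>feats X. close_on S (\<epsilon> n / 2) f g)" for n
  proof -
    have "box_data X Y < ennreal (\<epsilon> n)" using \<epsilon>[of n] z by simp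
    then show ?thesis by (rule box_dataE) blast
  qed
  then obtain \<pi> S where \<pi>: "\<And>n. \<pi> n \<in> couplings X Y" and S: "\<And>n. closedin (prod_top X Y) (S n)"
    and mS: "\<And>n. measure (\<pi> n) (S n) \<ge> 1 - \<epsilon> n"
    and XY: "\<And>n. \<forall>f\<in>feats X. \<exists>g\<in>feats Y. close_on (S n) (\<epsilon> n / 2) f g"
    and YX: "\<And>n. \<forall>g\<in>feats Y. \<exists>f\<in>feats X. close_on (S n) (\<epsilon> n / 2) f g"
    by (metis (no_types, lifting))
  obtain f0 where f0: "dense_features X f0" "\<And>k. f0 k \<in> feats X" using X.dense_features_exists by blast
  obtain g0 where g0: "dense_features Y g0" "\<And>k. g0 k \<in> feats Y" using Y.dense_features_exists by blast
  have "\<forall>n k. \<exists>g. g\<in>feats Y \<and> (close_on (S n) (\<epsilon> n / 2) (f0 k) g)" using XY f0(2) by blast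
  then obtain a where a: "\<And>n k. a n k \<in> feats Y" "\<And>n k x y. (x,y) \<in> S n \<Longrightarrow> \<bar>f0 k x - a n k y\<bar> \<le> \<epsilon> n / 2"
    by metis
  have "\<forall>n k. \<exists>f. f\<in>feats X \<and> (close_on (S n) (\<epsilon> n / 2) f (g0 k))" using YX g0(2) by blast
  then obtain b where b: "\<And>n k. b n k \<in> feats X" "\<And>n k x y. (x,y) \<in> S n \<Longrightarrow> \<bar>b n k x - g0 k y\<bar> \<le> \<epsilon> n / 2"
    by metis
  \<comment> \<open>Even indices carry a fixed dense sequence of \<open>X\<close> with its partners
    in \<open>Y\<close>, odd indices a fixed dense sequence of \<open>Y\<close> with its partners in
    \<open>X\<close>. Both limits thus retain a dense subsequence, as
    \<open>dense_features_limit\<close> demands.\<close>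
  define F where "F n k = (if even k then f0 (k div 2) else b n (k div 2))" for n k
  define G where "G n k = (if even k then a n (k div 2) else g0 (k div 2))" for n k
  have F: "F n k \<in> feats X" and G: "G n k \<in> feats Y" for n k
    using f0 g0 a b by (auto simp: F_def G_def)
  have FG: "\<bar>F n k x - G n k y\<bar> \<le> \<epsilon> n / 2" if "(x,y) \<in> S n" for n k x y
    using a(2)[OF that] b(2)[OF that] by (auto simp: F_def G_def)
  obtain r f where r: "strict_mono r" "\<forall>k. \<forall>x\<in>pts X. (\<lambda>n. F (r n) k x) \<longlonglongrightarrow> f k x"
    using X.feats_convergent_subseq[of F, OF assms(3) F] by (elim exE conjE)
  obtain r' g where r': "strict_mono r'" "\<forall>k. \<forall>y\<in>pts Y. (\<lambda>n. G (r (r' n)) k y) \<longlonglongrightarrow> g k y"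
    using Y.feats_convergent_subseq[of "\<lambda>n. G (r n)", OF assms(4) G] by (elim exE conjE)
  define t where "t n = r (r' n)" for n
  have t: "strict_mono t" using strict_mono_o[OF r(1) r'(1)] by (simp add: t_def[abs_def] o_def)
  have Fl: "(\<lambda>n. F (t n) k x) \<longlonglongrightarrow> f k x" if "x \<in> pts X" for k x
    using LIMSEQ_subseq_LIMSEQ[OF r(2)[rule_format, OF that] r'(1)] by (simp add: t_def o_def)
  have Gl: "(\<lambda>n. G (t n) k y) \<longlonglongrightarrow> g k y" if "y \<in> pts Y" for k y
    using r'(2)[rule_format, OF that] by (simp add: t_def)
  have pf: "dense_features X f"
    by (rule dense_features_limit[of "\<lambda>n. F (t n)", OF F Fl f0(1), of "\<lambda>k. 2 * k"]) (auto simp: F_def)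
  have pg: "dense_features Y g"
    by (rule dense_features_limit[of "\<lambda>n. G (t n)", OF G Gl g0(1), of "\<lambda>k. 2 * k + 1"]) (auto simp: G_def)
  have "feature_law X f = feature_law Y g"
  proof (rule distr_eq_if_approx_coupled[where 'm = "'a \<times> 'b"])
    fix N and \<eta>' :: real assume "\<eta>' > 0"
    \<comment> \<open>The coordinates differ by at most 3\<eta> + \<eta>/2 + 3\<eta>, and the
      excluded mass is at most 3\<eta>.\<close>
    define \<eta> where "\<eta> = \<eta>' / 7"
    have \<eta>: "\<eta> > 0" using \<open>\<eta>' > 0\<close> by (simp add: \<eta>_def)
    obtain A where A: "finite A" "A \<subseteq> pts X" "closedin X.mtopology (\<Union>a\<in>A. X.mcball a \<eta>)"
      "X.P.prob (\<Union>a\<in>A. X.mcball a \<eta>) > 1 - \<eta>" using X.net[OF \<eta> \<eta>] .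
    obtain B where B: "finite B" "B \<subseteq> pts Y" "closedin Y.mtopology (\<Union>a\<in>B. Y.mcball a \<eta>)"
      "Y.P.prob (\<Union>a\<in>B. Y.mcball a \<eta>) > 1 - \<eta>" using Y.net[OF \<eta> \<eta>] .
    let ?A = "\<Union>a\<in>A. X.mcball a \<eta>" and ?B = "\<Union>a\<in>B. Y.mcball a \<eta>"
    have "(\<lambda>n. \<epsilon> (t n)) \<longlonglongrightarrow> 0"
      using LIMSEQ_subseq_LIMSEQ[OF LIMSEQ_inverse_real_of_nat t] by (simp add: \<epsilon>_def o_def)
    then have "\<forall>\<^sub>F n in sequentially. \<epsilon> (t n) < \<eta>" using \<eta> by (rule order_tendstoD)
    moreover have "\<forall>\<^sub>F n in sequentially. \<forall>k<N. \<forall>x\<in>?A. \<bar>F (t n) k x - f k x\<bar> \<le> 3 * \<eta>"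
      by (rule X.near_limit[of "\<lambda>n. F (t n)", OF F Fl A(1,2) \<eta>])
    moreover have "\<forall>\<^sub>F n in sequentially. \<forall>k<N. \<forall>y\<in>?B. \<bar>G (t n) k y - g k y\<bar> \<le> 3 * \<eta>"
      by (rule Y.near_limit[of "\<lambda>n. G (t n)", OF G Gl B(1,2) \<eta>])
    ultimately have "\<forall>\<^sub>F n in sequentially. \<epsilon> (t n) < \<eta> \<and> (\<forall>k<N. \<forall>x\<in>?A. \<bar>F (t n) k x - f k x\<bar> \<le> 3 * \<eta>) \<and>
       (\<forall>k<N. \<forall>y\<in>?B. \<bar>G (t n) k y - g k y\<bar> \<le> 3 * \<eta>)" by eventually_elim simp
    then have "\<exists>n. \<epsilon> (t n) < \<eta> \<and> (\<forall>k<N. \<forall>x\<in>?A. \<bar>F (t n) k x - f k x\<bar> \<le> 3 * \<eta>) \<and>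
       (\<forall>k<N. \<forall>y\<in>?B. \<bar>G (t n) k y - g k y\<bar> \<le> 3 * \<eta>)" by (rule eventually_happens'[OF sequentially_bot])
    then obtain n where n0: "\<epsilon> (t n) < \<eta> \<and> (\<forall>k<N. \<forall>x\<in>?A. \<bar>F (t n) k x - f k x\<bar> \<le> 3 * \<eta>) \<and>
       (\<forall>k<N. \<forall>y\<in>?B. \<bar>G (t n) k y - g k y\<bar> \<le> 3 * \<eta>)" ..
    note n = n0[THEN conjunct1] n0[THEN conjunct2, THEN conjunct1, rule_format] n0[THEN conjunct2, THEN conjunct2, rule_format]
    note cp = couplingD[OF assms(1,2) \<pi>[of "t n"]]
    interpret M: prob_space "\<pi> (t n)" by (rule cp)
    let ?M = "\<pi> (t n)"
    let ?U = "\<lambda>z k. f k (fst z)" and ?V = "\<lambda>z k. g k (snd z)"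
    have U: "?U \<in> measurable ?M seq_borel" "distr ?M seq_borel ?U = feature_law X f"
      using measurable_compose[OF cp(2) X.feature_law_measurable[OF pf]]
        distr_comp_marginal[OF cp(2,4) X.feature_law_measurable[OF pf]] by (auto simp: feature_law_def)
    have V: "?V \<in> measurable ?M seq_borel" "distr ?M seq_borel ?V = feature_law Y g"
      using measurable_compose[OF cp(3) Y.feature_law_measurable[OF pg]]
        distr_comp_marginal[OF cp(3,5) Y.feature_law_measurable[OF pg]] by (auto simp: feature_law_def)
    have "(\<lambda>z. f k (fst z)) \<in> borel_measurable ?M" "(\<lambda>z. g k (snd z)) \<in> borel_measurable ?M" for k
      using measurable_compose[OF cp(2) X.dense_features_measurable[OF pf]]
        measurable_compose[OF cp(3) Y.dense_features_measurable[OF pg]] by auto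
    then have E: "{z\<in>space ?M. \<forall>k<N. \<bar>?U z k - ?V z k\<bar> \<le> \<eta>'} \<in> sets ?M" by measurable
    let ?P = "fst -` ?A \<inter> space ?M" and ?Q = "snd -` ?B \<inter> space ?M"
    have mP: "?P \<in> sets ?M" and mQ: "?Q \<in> sets ?M"
      using measurable_sets[OF cp(2) X.closed_sets[OF A(3)]] measurable_sets[OF cp(3) Y.closed_sets[OF B(3)]] .
    have pP: "M.prob ?P > 1 - \<eta>"
      using A(4) measure_distr[OF cp(2) X.closed_sets[OF A(3)]] by (simp only: cp(4))
    have pQ: "M.prob ?Q > 1 - \<eta>"
      using B(4) measure_distr[OF cp(3) Y.closed_sets[OF B(3)]] by (simp only: cp(5))
    have "1 - \<eta>' \<le> M.prob (S (t n) \<inter> ?P \<inter> ?Q)"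
      using prob_Int_ge[OF cp(1) sets.Int[OF cp(7)[OF S] mP] mQ, of "t n"] prob_Int_ge[OF cp(1) cp(7)[OF S] mP, of "t n"]
        pP pQ mS[of "t n"] n(1) \<eta> unfolding \<eta>_def by argo
    also have "\<dots> \<le> M.prob {z\<in>space ?M. \<forall>k<N. \<bar>?U z k - ?V z k\<bar> \<le> \<eta>'}"
    proof (rule M.finite_measure_mono[OF _ E], rule subsetI)
      fix z assume z: "z \<in> S (t n) \<inter> ?P \<inter> ?Q"
      have "\<bar>f k (fst z) - g k (snd z)\<bar> \<le> \<eta>'" if "k < N" for k
      proof -
        have "\<bar>F (t n) k (fst z) - G (t n) k (snd z)\<bar> \<le> \<epsilon> (t n) / 2" using z by (intro FG) simp
        moreover have "\<bar>F (t n) k (fst z) - f k (fst z)\<bar> \<le> 3 * \<eta>" by (rule n(2)[OF that]) (use z in simp)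
        moreover have "\<bar>G (t n) k (snd z) - g k (snd z)\<bar> \<le> 3 * \<eta>" by (rule n(3)[OF that]) (use z in simp)
        ultimately show ?thesis using n(1) \<eta> unfolding \<eta>_def by argo
      qed
      then show "z \<in> {z\<in>space ?M. \<forall>k<N. \<bar>?U z k - ?V z k\<bar> \<le> \<eta>'}" using z by simp
    qed
    finally have "1 - \<eta>' \<le> M.prob {z\<in>space ?M. \<forall>k<N. \<bar>?U z k - ?V z k\<bar> \<le> \<eta>'}" .
    then show "\<exists>(M :: ('a \<times> 'b) measure) U V. coupled_within (feature_law X f) (feature_law Y g) N \<eta>' M U V"
      using U V cp(1) by (intro exI[of _ ?M] exI[of _ ?U] exI[of _ ?V] conjI)
  qed
  then show ?thesis by (rule feature_law_eq_imp_iso[OF assms(1,2) pf pg])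
qed


section \<open>The compact screen\<close>

definition tau_inv :: "real \<Rightarrow> real" where
  "tau_inv s = artanh (2 * s)"

lemma tau_inv_tau [simp]: "tau_inv (tau r) = r"
  by (simp add: tau_inv_def tau_def artanh_tanh_real)

lemma tau_bounds: "tau r \<in> {-1/2<..<1/2}"
  using tanh_real_bounds[of r] by (auto simp: tau_def)

lemma tau_tau_inv:
  assumes "s \<in> {-1/2<..<1/2}" shows "tau (tau_inv s) = s"
proof -
  have s: "1 + 2 * s > 0" "1 - 2 * s > 0" using assms by auto
  have "- 2 * artanh (2 * s) = - ln ((1 + 2 * s) / (1 - 2 * s))"
    by (simp add: artanh_def)
  also have "\<dots> = ln ((1 - 2 * s) / (1 + 2 * s))" using s by (simp add: ln_div)
  finally have E: "exp (- 2 * artanh (2 * s)) = (1 - 2 * s) / (1 + 2 * s)" using s by simp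
  show ?thesis unfolding tau_def tau_inv_def tanh_real_altdef E using s
    by (simp add: field_simps)
qed

lemma tau_less_iff: "tau a < tau b \<longleftrightarrow> a < b" and tau_le_iff: "tau a \<le> tau b \<longleftrightarrow> a \<le> b"
  and tau_eq_iff: "tau a = tau b \<longleftrightarrow> a = b" and tau_minus: "tau (- a) = - tau a"
  by (auto simp: tau_def)

lemma tau_lip: "\<bar>tau a - tau b\<bar> \<le> \<bar>a - b\<bar> / 2"
proof -
  have "tanh b - tanh a \<le> b - a" if "a \<le> b" for a b :: real
  proof -
    have "\<exists>y. ((\<lambda>x. tanh x - x) has_real_derivative y) (at x) \<and> y \<le> 0" for x :: real
      by (rule exI[of _ "- (tanh x ^ 2)"]) (auto intro!: derivative_eq_intros)
    then have "tanh b - b \<le> tanh a - a"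
      by (intro DERIV_nonpos_imp_nonincreasing[OF that]) blast
    then show ?thesis by linarith
  qed
  from this[of a b] this[of b a] show ?thesis
    by (cases "a \<le> b") (auto simp: tau_def abs_if field_simps)
qed

lemma tau_continuous: "isCont tau r"
  unfolding tau_def[abs_def] by (intro continuous_intros) auto

lemma tau_inv_continuous: "s \<in> {-1/2<..<1/2} \<Longrightarrow> isCont tau_inv s"
  unfolding tau_inv_def[abs_def] by (intro isCont_o2[OF _ isCont_artanh] continuous_intros) auto

lemma tau_measurable [measurable]: "tau \<in> borel_measurable borel"
  using tau_continuous by (intro borel_measurable_continuous_onI continuous_at_imp_continuous_on) auto

lemma tau_inv_measurable [measurable]: "tau_inv \<in> borel_measurable borel"
  unfolding tau_inv_def artanh_def by measurable

lemma measurable_seq_borel_map: "g \<in> borel_measurable borel \<Longrightarrow> (\<lambda>w k. g (w k)) \<in> measurable seq_borel seq_borel"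
  by (rule measurable_PiM_single')
    (auto simp: space_PiM intro: measurable_compose[OF measurable_component_singleton])

lemma pw_adherent_tau:
  assumes "pw_adherent A G h"
  shows "pw_adherent A ((\<lambda>f. tau \<circ> f) ` G) (\<lambda>x. tau (h x))"
  unfolding pw_adherent_def
proof (intro allI impI)
  fix B \<epsilon> assume B: "finite B" "B \<subseteq> A" "(\<epsilon>::real) > 0"
  obtain f where f: "f \<in> G" "\<And>b. b \<in> B \<Longrightarrow> \<bar>f b - h b\<bar> < \<epsilon>"
    using assms[unfolded pw_adherent_def, rule_format, OF B] by blast
  have "\<bar>tau (f b) - tau (h b)\<bar> < \<epsilon>" if "b \<in> B" for b
    using tau_lip[of "f b" "h b"] f(2)[OF that] by argo
  then show "\<exists>f\<in>(\<lambda>f. tau \<circ> f) ` G. \<forall>b\<in>B. \<bar>f b - tau (h b)\<bar> < \<epsilon>"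
    using f(1) by auto
qed

text \<open>The limit has to avoid \<plusminus>1/2, where \<open>tau_inv\<close> is not continuous;
  on finitely many points a common \<delta> then exists.\<close>

lemma pw_adherent_tau_inv:
  assumes "pw_adherent A ((\<lambda>f. tau \<circ> f) ` G) u" "\<And>a. a \<in> A \<Longrightarrow> u a \<in> {-1/2<..<1/2}"
  shows "pw_adherent A G (\<lambda>x. tau_inv (u x))"
  unfolding pw_adherent_def
proof (intro allI impI)
  fix B \<epsilon> assume B: "finite B" "B \<subseteq> A" "(\<epsilon>::real) > 0"
  have "\<exists>d>0. \<forall>s. \<bar>s - u b\<bar> < d \<longrightarrow> \<bar>tau_inv s - tau_inv (u b)\<bar> < \<epsilon>" if "b \<in> B" for b
    using tau_inv_continuous[OF assms(2), of b] that B(2,3)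
    unfolding continuous_at_eps_delta by (auto simp: dist_real_def)
  then obtain d where d: "\<And>b. b \<in> B \<Longrightarrow> d b > 0"
    "\<And>b s. b \<in> B \<Longrightarrow> \<bar>s - u b\<bar> < d b \<Longrightarrow> \<bar>tau_inv s - tau_inv (u b)\<bar> < \<epsilon>" by metis
  define \<delta> where "\<delta> = Min (insert 1 (d ` B))"
  have \<delta>: "\<delta> > 0" "\<And>b. b \<in> B \<Longrightarrow> \<delta> \<le> d b" using B(1) d(1) by (auto simp: \<delta>_def)
  obtain f where f: "f \<in> G" "\<And>b. b \<in> B \<Longrightarrow> \<bar>tau (f b) - u b\<bar> < \<delta>"
    using assms(1)[unfolded pw_adherent_def, rule_format, OF B(1,2) \<delta>(1)] by auto
  have "\<bar>f b - tau_inv (u b)\<bar> < \<epsilon>" if "b \<in> B" for b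
    using d(2)[OF that, of "tau (f b)"] f(2)[OF that] \<delta>(2)[OF that] by simp
  then show "\<exists>f\<in>G. \<forall>b\<in>B. \<bar>f b - tau_inv (u b)\<bar> < \<epsilon>" using f(1) by blast
qed

lemma pw_adherent_le:
  assumes "pw_adherent A G h" "x \<in> A" "y \<in> A" "\<And>g. g \<in> G \<Longrightarrow> \<bar>g x - g y\<bar> \<le> c"
  shows "\<bar>h x - h y\<bar> \<le> c"
proof (rule field_le_epsilon)
  fix e :: real assume "e > 0"
  then obtain f where f: "f \<in> G" "\<And>b. b \<in> {x,y} \<Longrightarrow> \<bar>f b - h b\<bar> < e/2"
    using assms(1)[unfolded pw_adherent_def, rule_format, of "{x,y}" "e/2"] assms(2,3) by auto
  show "\<bar>h x - h y\<bar> \<le> c + e"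
    using assms(4)[OF f(1)] f(2)[of x] f(2)[of y] by (simp add: abs_if split: if_splits)
qed

text \<open>All functions on \<open>M\<close> are 1-Lipschitz for \<open>d\<close>, so each test
  point can be moved to a nearby image point \<open>e a\<close>. This carries adherence from a dense
  image to the whole space, here from a data set to its completion.\<close>

lemma pw_adherent_dense:
  assumes "pw_adherent A G' h'" and e: "\<And>a. a \<in> A \<Longrightarrow> e a \<in> M"
    and dense: "\<And>z r. z \<in> M \<Longrightarrow> r > 0 \<Longrightarrow> \<exists>a\<in>A. d (e a) z < r"
    and G: "\<And>g'. g' \<in> G' \<Longrightarrow> \<exists>g\<in>G. (\<forall>a\<in>A. g (e a) = g' a) \<and> (\<forall>x\<in>M. \<forall>y\<in>M. \<bar>g x - g y\<bar> \<le> d x y)"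
    and h: "\<And>a. a \<in> A \<Longrightarrow> h (e a) = h' a" "\<And>x y. x \<in> M \<Longrightarrow> y \<in> M \<Longrightarrow> \<bar>h x - h y\<bar> \<le> d x y"
  shows "pw_adherent M G h"
  unfolding pw_adherent_def
proof (intro allI impI)
  fix B \<epsilon> assume B: "finite B" "B \<subseteq> M" "(\<epsilon>::real) > 0"
  have "\<forall>b\<in>B. \<exists>a\<in>A. d (e a) b < \<epsilon>/3" by (intro ballI dense) (use B in auto)
  then obtain c where c: "\<And>b. b \<in> B \<Longrightarrow> c b \<in> A" "\<And>b. b \<in> B \<Longrightarrow> d (e (c b)) b < \<epsilon>/3" by metis
  have "c ` B \<subseteq> A" "\<epsilon>/3 > 0" using c B(3) by auto
  then obtain g' where g'0: "g' \<in> G'" "\<forall>x\<in>c ` B. \<bar>g' x - h' x\<bar> < \<epsilon>/3"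
    using assms(1)[unfolded pw_adherent_def, rule_format, OF finite_imageI[OF B(1)], of c "\<epsilon>/3"] by blast
  then have g': "g' \<in> G'" "\<And>b. b \<in> B \<Longrightarrow> \<bar>g' (c b) - h' (c b)\<bar> < \<epsilon>/3" by blast+
  obtain g where g: "g\<in>G" "\<And>a. a \<in> A \<Longrightarrow> g (e a) = g' a" "\<And>x y. x\<in>M \<Longrightarrow> y\<in>M \<Longrightarrow> \<bar>g x - g y\<bar> \<le> d x y"
    using G[OF g'(1)] by blast
  have "\<bar>g b - h b\<bar> < \<epsilon>" if b: "b \<in> B" for b
  proof -
    have bM: "b \<in> M" using b B by auto
    show ?thesis
      using g(3)[OF e[OF c(1)[OF b]] bM] h(2)[OF e[OF c(1)[OF b]] bM] c(2)[OF b] g'(2)[OF b]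
        g(2)[OF c(1)[OF b]] h(1)[OF c(1)[OF b]] by argo
  qed
  then show "\<exists>f\<in>G. \<forall>b\<in>B. \<bar>f b - h b\<bar> < \<epsilon>" using g(1) by blast
qed

section \<open>The completion for the distance of the truncated features\<close>

context geom_data
begin

abbreviation "cp \<equiv> completion_pts (pts X) (tau_dist X)"
abbreviation "cd \<equiv> completion_dist (pts X) (tau_dist X)"
abbreviation "cm \<equiv> screen_map X"

lemma tau_bdd: "bdd_above ((\<lambda>f. \<bar>f x - f y\<bar>) ` (\<lambda>f. tau \<circ> f) ` feats X)"
  unfolding image_image
proof (rule bdd_aboveI2)
  fix f show "\<bar>(tau \<circ> f) x - (tau \<circ> f) y\<bar> \<le> 1" using tau_bounds[of "f x"] tau_bounds[of "f y"] by auto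
qed

lemma tau_dist_upper:
  assumes "f \<in> feats X" "x \<in> pts X" "y \<in> pts X"
  shows "\<bar>tau (f x) - tau (f y)\<bar> \<le> tau_dist X x y"
  using feature_dist_upper[OF tau_bdd, where f = "tau \<circ> f" and M = "pts X"] assms by (simp add: tau_dist_def)

lemma tau_dist_least:
  assumes "x \<in> pts X" "y \<in> pts X" "\<And>f. f \<in> feats X \<Longrightarrow> \<bar>tau (f x) - tau (f y)\<bar> \<le> c"
  shows "tau_dist X x y \<le> c"
  unfolding tau_dist_def using feats_ne assms by (intro feature_dist_least) auto

lemma tau_dist_le:
  assumes "x \<in> pts X" "y \<in> pts X" shows "tau_dist X x y \<le> data_dist X x y"
proof (rule tau_dist_least[OF assms])
  fix f assume "f \<in> feats X"
  then show "\<bar>tau (f x) - tau (f y)\<bar> \<le> data_dist X x y"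
    using tau_lip[of "f x" "f y"] feat_lip[of f x y] assms by argo
qed

lemma tau_Metric: "Metric_space (pts X) (tau_dist X)"
  unfolding tau_dist_def
proof (rule Metric_space_feature_dist[OF _ tau_bdd])
  show "(\<lambda>f. tau \<circ> f) ` feats X \<noteq> {}" using feats_ne by simp
  fix x y assume xy: "x \<in> pts X" "y \<in> pts X" and eq: "\<And>g. g \<in> (\<lambda>f. tau \<circ> f) ` feats X \<Longrightarrow> g x = g y"
  have "\<bar>f x - f y\<bar> \<le> 0" if "f \<in> feats X" for f
    using eq[of "tau \<circ> f"] that by (simp add: tau_eq_iff)
  then have "data_dist X x y \<le> 0" by (rule feature_dist_least[OF feats_ne xy])
  then show "x = y" using nonneg[of x y] zero[OF xy] by simp
qed

sublocale T: Metric_space "pts X" "tau_dist X" by (rule tau_Metric)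
sublocale C: Metric_space cp cd by (rule completion_Metric_space[OF tau_Metric])

lemma C_complete: "C.mcomplete" and cm_closure: "C.mtopology closure_of (cm ` pts X) = cp"
  using completion[OF tau_Metric] by (auto simp: is_metric_completion_def)

lemma cm_in: "x \<in> pts X \<Longrightarrow> cm x \<in> cp"
  by (rule completion_map_in[OF tau_Metric])

lemma cm_dist: "x \<in> pts X \<Longrightarrow> y \<in> pts X \<Longrightarrow> cd (cm x) (cm y) = tau_dist X x y"
  by (rule completion_isometry[OF tau_Metric])

lemma cm_dense:
  assumes "z \<in> cp" "r > 0" shows "\<exists>x\<in>pts X. cd (cm x) z < r"
proof -
  have "z \<in> C.mtopology closure_of (cm ` pts X)" using assms cm_closure by simp
  then show ?thesis using assms(2) C.commute by (force simp: C.metric_closure_of)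
qed

lemma cm_continuous: "continuous_map mtopology C.mtopology cm"
  unfolding metric_continuous_map[OF C.Metric_space_axioms]
proof (intro conjI ballI allI impI)
  show "cm ` pts X \<subseteq> cp" using cm_in by auto
  fix a \<epsilon> assume "a \<in> pts X" "(\<epsilon>::real) > 0"
  then show "\<exists>\<delta>>0. \<forall>x. x \<in> pts X \<and> data_dist X a x < \<delta> \<longrightarrow> cd (cm a) (cm x) < \<epsilon>"
    by (intro exI[of _ \<epsilon>]) (auto simp: cm_dist intro: le_less_trans[OF tau_dist_le])
qed

lemma cm_measurable: "cm \<in> measurable (meas X) (borel_of C.mtopology)"
  using measurable_continuous_borel_of[OF cm_continuous] by (simp add: measurable_cong_sets[OF sets_meas refl])

lemma lip_extension:
  assumes u: "\<And>x y. x \<in> pts X \<Longrightarrow> y \<in> pts X \<Longrightarrow> \<bar>u x - u y\<bar> \<le> tau_dist X x y"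
  shows "\<exists>h\<in>extensional cp. (\<forall>g\<in>cp. \<forall>g'\<in>cp. \<bar>h g - h g'\<bar> \<le> cd g g') \<and> (\<forall>x\<in>pts X. h (cm x) = u x)"
proof -
  \<comment> \<open>McShane's extension: a point \<open>g\<close> of the completion is its own distance function.\<close>
  define h where "h = (\<lambda>g\<in>cp. INF x\<in>pts X. u x + g x)"
  have hv: "h g = (INF x\<in>pts X. u x + g x)" if "g \<in> cp" for g using that by (simp add: h_def)
  have bd: "bdd_below ((\<lambda>x. u x + g x) ` pts X)" if g: "g \<in> cp" for g
  proof -
    obtain z where z: "z \<in> pts X" "\<And>y. y \<in> pts X \<Longrightarrow> \<bar>g y - tau_dist X z y\<bar> \<le> 1"
      using completion_ptsE[OF tau_Metric g zero_less_one] by blast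
    show ?thesis
    proof (rule bdd_belowI2)
      fix x assume "x \<in> pts X"
      then show "u z - 1 \<le> u x + g x" using u[OF z(1), of x] z(2)[of x] by argo
    qed
  qed
  have le: "h g \<le> h g' + cd g g'" if g: "g \<in> cp" "g' \<in> cp" for g g'
  proof -
    have "h g - cd g g' \<le> h g'"
      unfolding hv[OF g(2)]
    proof (rule cINF_greatest[OF pts_ne])
      fix x assume x: "x \<in> pts X"
      have "h g \<le> u x + g x" unfolding hv[OF g(1)] by (rule cINF_lower[OF bd[OF g(1)] x])
      then show "h g - cd g g' \<le> u x + g' x"
        using completion_dist_upper[OF tau_Metric g x] by argo
    qed
    then show ?thesis by linarith
  qed
  show ?thesis
  proof (intro bexI[of _ h] conjI ballI)
    show "h \<in> extensional cp" by (simp add: h_def)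
    show "\<bar>h g - h g'\<bar> \<le> cd g g'" if "g \<in> cp" "g' \<in> cp" for g g'
      using le[OF that] le[OF that(2,1)] C.commute[of g g'] by linarith
    fix x assume x: "x \<in> pts X"
    have "h (cm x) \<le> u x + cm x x" unfolding hv[OF cm_in[OF x]] by (rule cINF_lower[OF bd[OF cm_in[OF x]] x])
    also have "cm x x = 0" using x T.zero[OF x x] by (simp add: completion_map_def)
    finally have "h (cm x) \<le> u x" by simp
    moreover have "u x \<le> h (cm x)"
      unfolding hv[OF cm_in[OF x]]
    proof (rule cINF_greatest[OF pts_ne])
      fix y assume y: "y \<in> pts X"
      then show "u x \<le> u y + cm x y" using u[OF x y] by (simp add: completion_map_def)
    qed
    ultimately show "h (cm x) = u x" by simp
  qed
qed

text \<open>Resolves the definite description: \<open>lip_extension\<close> supplies an extension,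
  and two continuous extensions agree because the image of \<open>cm\<close> is dense.\<close>

lemma screen_extension_lip:
  assumes f: "\<And>x y. x \<in> pts X \<Longrightarrow> y \<in> pts X \<Longrightarrow> \<bar>tau (f x) - tau (f y)\<bar> \<le> tau_dist X x y"
  shows "screen_extension X f \<in> extensional cp"
    "\<And>g g'. g \<in> cp \<Longrightarrow> g' \<in> cp \<Longrightarrow> \<bar>screen_extension X f g - screen_extension X f g'\<bar> \<le> cd g g'"
    "\<And>x. x \<in> pts X \<Longrightarrow> screen_extension X f (cm x) = tau (f x)"
proof -
  obtain h where h0: "h \<in> extensional cp" "\<forall>g\<in>cp. \<forall>g'\<in>cp. \<bar>h g - h g'\<bar> \<le> cd g g'"
    "\<forall>x\<in>pts X. h (cm x) = tau (f x)"
    using lip_extension[of "\<lambda>x. tau (f x)", OF f] by blast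
  note h = h0(1) h0(2)[rule_format] h0(3)[rule_format]
  have hc: "continuous_map C.mtopology euclideanreal h" by (rule C.lip_continuous[OF h(2)])
  have "screen_extension X f = h"
    unfolding screen_extension_def
  proof (rule the_equality)
    show "h \<in> extensional (topspace C.mtopology) \<and> continuous_map C.mtopology euclideanreal h \<and> (\<forall>x\<in>pts X. h (cm x) = tau (f x))"
      using h hc by simp
    fix h' assume h': "h' \<in> extensional (topspace C.mtopology) \<and> continuous_map C.mtopology euclideanreal h' \<and> (\<forall>x\<in>pts X. h' (cm x) = tau (f x))"
    show "h' = h"
    proof (rule extensionalityI)
      show "h' \<in> extensional cp" using h' by simp
      fix z assume "z \<in> cp"
      then have "z \<in> C.mtopology closure_of (cm ` pts X)" using cm_closure by simp
      then show "h' z = h z"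
        by (rule forall_in_closure_of_eq[of _ _ _ euclideanreal]) (use h' hc h(3) in auto)
    qed (rule h)
  qed
  with h show "screen_extension X f \<in> extensional cp"
    "\<And>g g'. g \<in> cp \<Longrightarrow> g' \<in> cp \<Longrightarrow> \<bar>screen_extension X f g - screen_extension X f g'\<bar> \<le> cd g g'"
    "\<And>x. x \<in> pts X \<Longrightarrow> screen_extension X f (cm x) = tau (f x)" by simp_all
qed

lemma pw_adherent_tau_lip:
  assumes "pw_adherent (pts X) (feats X) f" "x \<in> pts X" "y \<in> pts X"
  shows "\<bar>tau (f x) - tau (f y)\<bar> \<le> tau_dist X x y"
  by (rule pw_adherent_le[OF pw_adherent_tau[OF assms(1)] assms(2,3)]) (auto intro!: tau_dist_upper[OF _ assms(2,3)])

text \<open>Stated for pointwise limits of features, because the terms of a dense feature sequence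
  may be such limits and have to be extended as well.\<close>

lemma pw_adherent_extension:
  assumes "pw_adherent (pts X) (feats X) f"
  shows "screen_extension X f \<in> extensional cp"
    "\<And>g g'. g \<in> cp \<Longrightarrow> g' \<in> cp \<Longrightarrow> \<bar>screen_extension X f g - screen_extension X f g'\<bar> \<le> cd g g'"
    "\<And>x. x \<in> pts X \<Longrightarrow> screen_extension X f (cm x) = tau (f x)"
proof -
  have L: "\<bar>tau (f x) - tau (f y)\<bar> \<le> tau_dist X x y" if "x \<in> pts X" "y \<in> pts X" for x y
    by (rule pw_adherent_tau_lip[OF assms that])
  show "screen_extension X f \<in> extensional cp"
    "\<And>g g'. g \<in> cp \<Longrightarrow> g' \<in> cp \<Longrightarrow> \<bar>screen_extension X f g - screen_extension X f g'\<bar> \<le> cd g g'"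
    "\<And>x. x \<in> pts X \<Longrightarrow> screen_extension X f (cm x) = tau (f x)"
    using screen_extension_lip[of f, OF L] by blast+
qed

lemmas feat_extension = pw_adherent_extension[OF pw_adherent_superset]

abbreviation "scm \<equiv> distr (meas X) (borel_of C.mtopology) cm"

text \<open>\<open>cm\<close> is continuous with dense image, so the preimage of a nonempty open set
  is nonempty and open, and \<open>X\<close> has full support.\<close>

lemma scm_full: "openin C.mtopology U \<Longrightarrow> U \<noteq> {} \<Longrightarrow> emeasure scm U > 0"
proof -
  assume U: "openin C.mtopology U" "U \<noteq> {}"
  then obtain z where z: "z \<in> U" by blast
  then obtain r where r: "r > 0" "C.mball z r \<subseteq> U" using U(1) unfolding C.openin_mtopology by blast
  have "z \<in> cp" using z U(1) openin_subset by fastforce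
  then obtain x where x: "x \<in> pts X" "cd (cm x) z < r" using cm_dense r by blast
  then have "cm x \<in> U" using r(2) cm_in[OF x(1)] \<open>z \<in> cp\<close> C.commute by auto
  let ?V = "{x \<in> topspace mtopology. cm x \<in> U}"
  have V: "openin mtopology ?V" by (rule openin_continuous_map_preimage[OF cm_continuous U(1)])
  have "emeasure scm U = emeasure (meas X) (cm -` U \<inter> space (meas X))"
    by (rule emeasure_distr[OF cm_measurable borel_of_open[OF U(1)]])
  also have "cm -` U \<inter> space (meas X) = ?V" by auto
  also have "emeasure (meas X) ?V > 0" using full[OF V] x(1) \<open>cm x \<in> U\<close> by auto
  finally show ?thesis .
qed

text \<open>By \<open>scm_full\<close> the support taken in the definition of \<open>screen\<close>
  is the whole completion, which makes \<open>cp\<close> the carrier.\<close>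

lemma screen_eq: "screen X = \<lparr>pts = cp, feats = screen_extension X ` feats X, meas = scm\<rparr>"
proof -
  have S: "measure_support C.mtopology scm = cp"
    using scm_full by (auto simp: measure_support_def)
  have "restrict (screen_extension X f) cp = screen_extension X f" if "f \<in> feats X" for f
    using feat_extension(1)[OF that] by (simp add: extensional_restrict)
  then have "(\<lambda>f. restrict (screen_extension X f) cp) ` feats X = screen_extension X ` feats X"
    by (intro image_cong) auto
  moreover have "restrict_space scm cp = scm"
  proof (rule measure_eqI)
    show s: "sets (restrict_space scm cp) = sets scm"
    proof -
      have "cp \<inter> A = A" if "A \<in> sets scm" for A using sets.sets_into_space[OF that] by auto
      then have "(\<inter>) cp ` sets scm = (\<lambda>A. A) ` sets scm" by (intro image_cong refl)
      then show ?thesis by (simp add: sets_restrict_space)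
    qed
    show "emeasure (restrict_space scm cp) A = emeasure scm A" if "A \<in> sets (restrict_space scm cp)" for A
    proof (rule emeasure_restrict_space)
      show "cp \<inter> space scm \<in> sets scm" using sets.top[of scm] by simp
      show "A \<subseteq> cp" using that s sets.sets_into_space[of A scm] by simp
    qed
  qed
  ultimately show ?thesis by (simp add: screen_def S Let_def)
qed

lemma screen_simps [simp]: "pts (screen X) = cp" "feats (screen X) = screen_extension X ` feats X" "meas (screen X) = scm"
  by (simp_all add: screen_eq)

text \<open>The completion distance is again a supremum over features: the extended features are
  1-Lipschitz for it, which gives one inequality, and density of the image of \<open>cm\<close>
  gives the other.\<close>

lemma screen_dist: "data_dist (screen X) = cd"
proof (intro ext)
  fix g g'
  show "data_dist (screen X) g g' = cd g g'"
  proof (cases "g \<in> cp \<and> g' \<in> cp")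
    case False
    then show ?thesis by (auto simp: feature_dist_def completion_dist_def)
  next
    case True
    then have g: "g \<in> cp" "g' \<in> cp" by auto
    have bd: "bdd_above ((\<lambda>f. \<bar>screen_extension X f g - screen_extension X f g'\<bar>) ` feats X)"
      by (rule bdd_aboveI2) (rule feat_extension(2)[OF _ g])
    define c where "c = (SUP f\<in>feats X. \<bar>screen_extension X f g - screen_extension X f g'\<bar>)"
    have c: "\<bar>screen_extension X f g - screen_extension X f g'\<bar> \<le> c" if "f \<in> feats X" for f
      unfolding c_def by (rule cSUP_upper[OF that bd])
    have "c \<le> cd g g'" unfolding c_def by (rule cSUP_least[OF feats_ne]) (rule feat_extension(2)[OF _ g])
    moreover have "cd g g' \<le> c"
    proof (rule field_le_epsilon)
      fix e :: real assume "e > 0"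
      then obtain x y where x: "x \<in> pts X" "cd (cm x) g < e/4" and y: "y \<in> pts X" "cd (cm y) g' < e/4"
        using cm_dense[OF g(1), of "e/4"] cm_dense[OF g(2), of "e/4"] by auto
      \<comment> \<open>Replacing \<open>g\<close> and \<open>g'\<close> by nearby image points
        changes each extended feature by less than e/4 at either end.\<close>
      have "tau_dist X x y \<le> c + e/2"
      proof (rule tau_dist_least[OF x(1) y(1)])
        fix f assume f: "f \<in> feats X"
        show "\<bar>tau (f x) - tau (f y)\<bar> \<le> c + e / 2"
          using c[OF f] feat_extension(2)[OF f cm_in[OF x(1)] g(1)] feat_extension(2)[OF f cm_in[OF y(1)] g(2)]
            feat_extension(3)[OF f x(1)] feat_extension(3)[OF f y(1)] x(2) y(2) by argo
      qed
      then show "cd g g' \<le> c + e"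
        using C.triangle[OF g(1) cm_in[OF x(1)] g(2)] C.triangle[OF cm_in[OF x(1)] cm_in[OF y(1)] g(2)]
          cm_dist[OF x(1) y(1)] x(2) y(2) C.commute[of "cm x" g] by argo
    qed
    ultimately show ?thesis using g by (simp add: feature_dist_def image_image c_def)
  qed
qed

lemma screen_geom_data: "geom_data (screen X)"
proof (rule geom_data.intro)
  show "geometric_data_set (screen X)"
    unfolding geometric_data_set_def screen_dist
    unfolding screen_simps
  proof (intro conjI allI impI ballI)
    show "screen_extension X ` feats X \<noteq> {}" using feats_ne by simp
    show "screen_extension X ` feats X \<subseteq> extensional cp" using feat_extension(1) by auto
    show "bdd_above ((\<lambda>f. \<bar>f x - f y\<bar>) ` screen_extension X ` feats X)" if "x \<in> cp" "y \<in> cp" for x y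
      unfolding image_image by (rule bdd_aboveI2) (rule feat_extension(2)[OF _ that])
    show "Metric_space cp cd" by (rule C.Metric_space_axioms)
    show "C.mcomplete" by (rule C_complete)
    obtain s :: "nat \<Rightarrow> 'a" where s: "\<And>n. s n \<in> pts X"
      "\<And>x r. x \<in> pts X \<Longrightarrow> r > 0 \<Longrightarrow> \<exists>n. data_dist X (s n) x < r"
      using dense_seq by blast
    show "separable_space C.mtopology"
      unfolding separable_space_def
    proof (intro exI[of _ "range (\<lambda>n. cm (s n))"] conjI)
      show "C.mtopology closure_of range (\<lambda>n. cm (s n)) = topspace C.mtopology"
      proof (intro equalityI subsetI)
        fix z assume "z \<in> topspace C.mtopology"
        then have z: "z \<in> cp" by simp
        have "\<exists>n. cd z (cm (s n)) < r" if "r > 0" for r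
        proof -
          have r2: "r/2 > 0" using that by simp
          obtain x where x: "x \<in> pts X" "cd (cm x) z < r/2" using cm_dense[OF z r2] by blast
          obtain n where n: "data_dist X (s n) x < r/2" using s(2)[OF x(1) r2] by blast
          have "cd (cm (s n)) z < r"
            using C.triangle[OF cm_in[OF s(1)] cm_in[OF x(1)] z, of n] tau_dist_le[OF s(1) x(1), of n]
             cm_dist[OF s(1) x(1), of n] x(2) n by linarith
          then show ?thesis using C.commute by metis
        qed
        then show "z \<in> C.mtopology closure_of range (\<lambda>n. cm (s n))"
          using z cm_in[OF s(1)] by (auto simp: C.metric_closure_of)
      qed (auto simp: C.metric_closure_of)
    qed (use cm_in s(1) in auto)
    show "sets scm = sets (borel_of C.mtopology)" by simp
    show "prob_space scm" by (rule P.prob_space_distr[OF cm_measurable])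
    show "emeasure scm U > 0" if "openin C.mtopology U \<and> U \<noteq> {}" for U using scm_full that by simp
  qed
qed

lemma screen_K: "K_valued (screen X)"
  unfolding K_valued_def
proof (intro ballI)
  fix h z assume h: "h \<in> feats (screen X)" and z: "z \<in> pts (screen X)"
  then obtain f where f: "f \<in> feats X" "h = screen_extension X f" by auto
  have "\<bar>h z\<bar> \<le> 1/2"
  proof (rule field_le_epsilon)
    fix e :: real assume "e > 0"
    then obtain x where x: "x \<in> pts X" "cd (cm x) z < e" using cm_dense[of z e] z by auto
    then show "\<bar>h z\<bar> \<le> 1/2 + e"
      using feat_extension(2)[OF f(1) cm_in[OF x(1)], of z] feat_extension(3)[OF f(1) x(1)] z tau_bounds[of "f x"]
      by (auto simp: f(2) abs_if split: if_splits)
  qed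
  then show "h z \<in> {- 1 / 2..1 / 2}" by (auto simp: abs_le_iff)
qed

lemma screen_map_measurable: "cm \<in> measurable (meas X) (meas (screen X))"
  using cm_measurable by simp

lemma screen_map_distr: "distr (meas X) (meas (screen X)) cm = meas (screen X)"
  unfolding screen_simps by (rule distr_cong) auto

lemma dense_features_screen:
  assumes "dense_features X f" shows "dense_features (screen X) (\<lambda>k. screen_extension X (f k))"
proof -
  have f: "pw_adherent (pts X) (feats X) (f k)" for k using assms by (simp add: dense_features_def)
  have "pw_adherent cp (screen_extension X ` feats X) (screen_extension X (f k))" for k
  proof (rule pw_adherent_dense[where e = cm and d = cd, OF pw_adherent_tau[OF f[of k]] cm_in cm_dense])
    fix g assume "g \<in> (\<lambda>f. tau \<circ> f) ` feats X"
    then obtain u where u: "u \<in> feats X" "g = tau \<circ> u" by blast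
    show "\<exists>g'\<in>screen_extension X ` feats X. (\<forall>a\<in>pts X. g' (cm a) = g a) \<and> (\<forall>x\<in>cp. \<forall>y\<in>cp. \<bar>g' x - g' y\<bar> \<le> cd x y)"
      using u feat_extension(2,3)[OF u(1)] by (intro bexI[of _ "screen_extension X u"]) auto
  qed (use pw_adherent_extension(2,3)[OF f] in auto)
  moreover have "pw_adherent cp (range (\<lambda>k. screen_extension X (f k))) (screen_extension X h)" if h: "h \<in> feats X" for h
  proof (rule pw_adherent_dense[where e = cm and d = cd, OF pw_adherent_tau[of _ "range f" h] cm_in cm_dense])
    show "pw_adherent (pts X) (range f) h" using assms h by (simp add: dense_features_def)
    fix g assume "g \<in> (\<lambda>f. tau \<circ> f) ` range f"
    then obtain k where u: "g = tau \<circ> f k" by blast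
    show "\<exists>g'\<in>range (\<lambda>k. screen_extension X (f k)). (\<forall>a\<in>pts X. g' (cm a) = g a) \<and> (\<forall>x\<in>cp. \<forall>y\<in>cp. \<bar>g' x - g' y\<bar> \<le> cd x y)"
      using u pw_adherent_extension(2,3)[OF f[of k]] by (intro bexI[of _ "screen_extension X (f k)"]) auto
  qed (use feat_extension(2,3)[OF h] in auto)
  ultimately show ?thesis by (auto simp: dense_features_def)
qed

lemma feature_law_screen:
  assumes "dense_features (screen X) h"
  shows "feature_law (screen X) h = distr (meas X) seq_borel (\<lambda>x k. h k (cm x))"
proof -
  have "feature_law (screen X) h = distr (distr (meas X) (meas (screen X)) cm) seq_borel (\<lambda>x k. h k x)"
    unfolding feature_law_def screen_map_distr ..
  also have "\<dots> = distr (meas X) seq_borel ((\<lambda>x k. h k x) \<circ> cm)"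
    by (rule distr_distr[OF geom_data.feature_law_measurable[OF screen_geom_data assms] screen_map_measurable])
  finally show ?thesis by (simp add: o_def)
qed

text \<open>On laws the screen acts by applying \<open>tau\<close> to every coordinate. Hence the
  isomorphism class of the screen depends only on that of \<open>X\<close>.\<close>

lemma feature_law_screen_extension:
  assumes "dense_features X f"
  shows "feature_law (screen X) (\<lambda>k. screen_extension X (f k)) = distr (feature_law X f) seq_borel (\<lambda>w k. tau (w k))"
proof -
  have f: "pw_adherent (pts X) (feats X) (f k)" for k using assms by (simp add: dense_features_def)
  have m: "(\<lambda>w k. tau (w k)) \<in> measurable seq_borel seq_borel" by (rule measurable_seq_borel_map) simp
  have "feature_law (screen X) (\<lambda>k. screen_extension X (f k)) = distr (meas X) seq_borel (\<lambda>x k. tau (f k x))"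
    unfolding feature_law_screen[OF dense_features_screen[OF assms]]
    by (intro distr_cong refl) (use pw_adherent_extension(3)[OF f] in auto)
  also have "\<dots> = distr (feature_law X f) seq_borel (\<lambda>w k. tau (w k))"
    unfolding feature_law_def by (subst distr_distr[OF m feature_law_measurable[OF assms]]) (simp add: o_def)
  finally show ?thesis .
qed

end

section \<open>Invariance and injectivity of the screen\<close>

theorem screen_iso:
  assumes "geom_data X" "geom_data Y" "data_iso X Y"
  shows "data_iso (screen X) (screen Y)"
proof -
  interpret X: geom_data X by fact
  interpret Y: geom_data Y by fact
  obtain g where g: "dense_features Y g" using Y.dense_features_exists by blast
  obtain f where f: "dense_features X f" "feature_law X f = feature_law Y g" using iso_imp_feature_law_eq[OF assms g] .
  show ?thesis
    by (rule feature_law_eq_imp_iso[OF X.screen_geom_data Y.screen_geom_data X.dense_features_screen[OF f(1)] Y.dense_features_screen[OF g]])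
      (simp add: X.feature_law_screen_extension[OF f(1)] Y.feature_law_screen_extension[OF g] f(2))
qed

text \<open>A dense sequence of the screen of \<open>Y\<close> whose law is that of the extended
  features of \<open>X\<close> is pulled back to \<open>Y\<close> along the screen map. Applying
  \<open>tau_inv\<close> should give a dense sequence of \<open>Y\<close> with the law of
  \<open>f\<close>; the obstacle is that the pulled-back limits might reach \<plusminus>1/2.\<close>

theorem screen_iso_imp_iso:
  assumes "geom_data X" "geom_data Y" "data_iso (screen X) (screen Y)"
  shows "data_iso X Y"
proof -
  interpret X: geom_data X by fact
  interpret Y: geom_data Y by fact
  interpret SY: geom_data "screen Y" by (rule Y.screen_geom_data)
  obtain f where f: "dense_features X f" using X.dense_features_exists by blast
  let ?h = "\<lambda>k. screen_extension X (f k)"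
  obtain g' where g': "dense_features (screen Y) g'" "feature_law (screen Y) g' = feature_law (screen X) ?h"
    using iso_imp_feature_law_eq[OF Y.screen_geom_data X.screen_geom_data data_iso_sym[OF X.screen_geom_data Y.screen_geom_data assms(3)] X.dense_features_screen[OF f]] .
  define u where "u k y = g' k (Y.cm y)" for k y
  have um: "(\<lambda>y k. u k y) \<in> measurable (meas Y) seq_borel"
    using measurable_compose[OF Y.screen_map_measurable SY.feature_law_measurable[OF g'(1)]] by (simp add: u_def)
  have mt: "(\<lambda>w k. tau (w k)) \<in> measurable seq_borel seq_borel" and mi: "(\<lambda>w k. tau_inv (w k)) \<in> measurable seq_borel seq_borel"
    by (rule measurable_seq_borel_map; simp)+
  have lu: "distr (meas Y) seq_borel (\<lambda>y k. u k y) = distr (feature_law X f) seq_borel (\<lambda>w k. tau (w k))"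
    using g'(2) Y.feature_law_screen[OF g'(1)] X.feature_law_screen_extension[OF f] by (simp add: u_def)
  have uc: "pw_adherent (pts Y) ((\<lambda>f. tau \<circ> f) ` feats Y) (u k)" for k
    unfolding u_def
  proof (rule pw_adherent_transfer[of "pts (screen Y)" "feats (screen Y)" "g' k" Y.cm])
    show "pw_adherent (pts (screen Y)) (feats (screen Y)) (g' k)" using g'(1) by (simp add: dense_features_def)
    fix g assume "g \<in> feats (screen Y)"
    then obtain v where "v \<in> feats Y" "g = screen_extension Y v" by auto
    then show "\<exists>g'\<in>(\<lambda>f. tau \<circ> f) ` feats Y. \<forall>a\<in>pts Y. g' a = g (Y.cm a)"
      using Y.feat_extension(3) by (intro bexI[of _ "tau \<circ> v"]) auto
  qed (use Y.cm_in in auto)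
  \<comment> \<open>The law of \<open>u\<close> is the image of a law under \<open>tau\<close>,
    hence concentrated on sequences with all entries in the open interval, and some point of
    \<open>Y\<close> must realize one.\<close>
  obtain y1 where y1: "y1 \<in> pts Y" "\<And>k. u k y1 \<in> {-1/2<..<1/2}"
  proof -
    let ?B = "{w \<in> space seq_borel. \<forall>k. w k \<in> {-1/2<..<1/2::real}}"
    have B: "?B \<in> sets seq_borel" by measurable
    have "emeasure (meas Y) ((\<lambda>y k. u k y) -` ?B \<inter> space (meas Y)) = emeasure (distr (meas Y) seq_borel (\<lambda>y k. u k y)) ?B"
      by (rule emeasure_distr[OF um B, symmetric])
    also have "\<dots> = emeasure (feature_law X f) ((\<lambda>w k. tau (w k)) -` ?B \<inter> space (feature_law X f))"
      unfolding lu by (rule emeasure_distr[OF _ B]) (simp add: feature_law_def mt)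
    also have "(\<lambda>w k. tau (w k)) -` ?B \<inter> space (feature_law X f) = space (feature_law X f)"
      using tau_bounds by (auto simp: space_PiM)
    also have "emeasure (feature_law X f) (space (feature_law X f)) = 1"
      unfolding feature_law_def by (rule prob_space.emeasure_space_1[OF X.P.prob_space_distr[OF X.feature_law_measurable[OF f]]])
    finally have "(\<lambda>y k. u k y) -` ?B \<inter> space (meas Y) \<noteq> {}" by auto
    then show ?thesis using that by auto
  qed
  \<comment> \<open>A limit of functions \<open>tau \<circ> f\<close> with \<open>f\<close> \<open>1\<close>-Lipschitz that reaches \<open>\<plusminus>1/2\<close> anywhere is constant,
    which the distribution of \<open>u k\<close> excludes.\<close>
  have ub: "u k y \<in> {-1/2<..<1/2}" if y: "y \<in> pts Y" for k y
  proof -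
    define M where "M = \<bar>tau_inv (u k y1)\<bar> + 1"
    have M: "\<bar>u k y1\<bar> < tau M"
    proof -
      have "u k y1 = tau (tau_inv (u k y1))" using tau_tau_inv[OF y1(2)] by simp
      moreover have "tau (tau_inv (u k y1)) < tau M" "tau (- M) < tau (tau_inv (u k y1))"
        unfolding tau_less_iff M_def by auto
      ultimately show ?thesis using tau_minus[of M] by linarith
    qed
    let ?D = "data_dist Y y1 y"
    have "\<bar>u k y\<bar> \<le> tau (M + ?D)"
    proof (rule field_le_epsilon)
      fix e :: real assume e: "e > 0"
      \<comment> \<open>The second bound keeps \<bar>tau (v y1)\<bar> below \<open>tau M\<close>.
        This bounds \<open>v y1\<close>, and then \<open>v y\<close> by the Lipschitz estimate,
        independently of the approximating feature.\<close>
      let ?e = "min e (tau M - \<bar>u k y1\<bar>)"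
      obtain v where v: "v \<in> feats Y" "\<bar>tau (v y1) - u k y1\<bar> < ?e" "\<bar>tau (v y) - u k y\<bar> < ?e"
        using uc[of k, unfolded pw_adherent_def, rule_format, of "{y1,y}" ?e] y y1(1) e M by auto
      have "\<bar>tau (v y1)\<bar> < tau M" using v(2) by linarith
      then have "tau (v y1) < tau M" "tau (- M) < tau (v y1)" using tau_minus[of M] by linarith+
      then have "\<bar>v y1\<bar> < M" unfolding tau_less_iff by linarith
      then have "\<bar>v y\<bar> < M + ?D" using Y.feat_lip[OF v(1) y1(1) y] by linarith
      then have "tau (v y) \<le> tau (M + ?D)" "tau (- (M + ?D)) \<le> tau (v y)" unfolding tau_le_iff by linarith+
      then show "\<bar>u k y\<bar> \<le> tau (M + ?D) + e" using v(3) tau_minus[of "M + ?D"] by linarith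
    qed
    then show ?thesis using tau_bounds[of "M + ?D"] by (auto simp: abs_le_iff)
  qed
  define g where "g = (\<lambda>k y. tau_inv (u k y))"
  have g: "dense_features Y g"
    unfolding dense_features_def
  proof (intro conjI allI ballI)
    show "pw_adherent (pts Y) (feats Y) (g k)" for k
      unfolding g_def by (rule pw_adherent_tau_inv[OF uc ub])
    fix v assume v: "v \<in> feats Y"
    have "screen_extension Y v \<in> feats (screen Y)" using v by simp
    then have "pw_adherent (pts (screen Y)) (range g') (screen_extension Y v)" using g'(1) by (simp only: dense_features_def)
    then have "pw_adherent (pts Y) ((\<lambda>f. tau \<circ> f) ` range g) (\<lambda>y. screen_extension Y v (Y.cm y))"
    proof (rule pw_adherent_transfer)
      fix w assume "w \<in> range g'"
      then obtain k where k: "w = g' k" by blast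
      show "\<exists>w'\<in>(\<lambda>f. tau \<circ> f) ` range g. \<forall>a\<in>pts Y. w' a = w (Y.cm a)"
        by (intro bexI[of _ "tau \<circ> g k"]) (auto simp: g_def k tau_tau_inv[OF ub] u_def[symmetric])
    qed (use Y.cm_in in auto)
    then have "pw_adherent (pts Y) ((\<lambda>f. tau \<circ> f) ` range g) (\<lambda>y. tau (v y))"
      by (rule pw_adherent_cong) (rule Y.feat_extension(3)[OF v])
    from pw_adherent_tau_inv[OF this] show "pw_adherent (pts Y) (range g) v"
      using tau_bounds by simp
  qed
  have "feature_law Y g = distr (distr (meas Y) seq_borel (\<lambda>y k. u k y)) seq_borel (\<lambda>w k. tau_inv (w k))"
    unfolding feature_law_def by (subst distr_distr[OF mi um]) (simp add: o_def g_def)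
  also have "\<dots> = distr (feature_law X f) seq_borel (\<lambda>w. w)"
    unfolding lu by (subst distr_distr[OF mi]) (simp_all add: feature_law_def mt o_def)
  also have "\<dots> = feature_law X f" by (rule distr_id2) (simp add: feature_law_def)
  finally show ?thesis by (intro feature_law_eq_imp_iso[OF assms(1,2) f g]) simp
qed


section \<open>Density of the screens\<close>

lemma Lipschitz_openin:
  assumes "Metric_space M d" "Metric_space M d'" and L: "L > 0" "\<And>x y. x \<in> M \<Longrightarrow> y \<in> M \<Longrightarrow> d' x y \<le> L * d x y"
    and U: "openin (Metric_space.mtopology M d') U"
  shows "openin (Metric_space.mtopology M d) U"
proof -
  interpret A: Metric_space M d by fact
  interpret B: Metric_space M d' by fact
  show ?thesis
    unfolding A.openin_mtopology
  proof (intro conjI allI impI)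
    show "U \<subseteq> M" using U by (simp add: B.openin_mtopology)
    fix x assume x: "x \<in> U"
    then obtain r where r: "r > 0" "B.mball x r \<subseteq> U" using U unfolding B.openin_mtopology by blast
    have "A.mball x (r / L) \<subseteq> B.mball x r"
    proof
      fix y assume y: "y \<in> A.mball x (r / L)"
      then have "L * d x y < r" using L(1) by (simp add: field_simps)
      then show "y \<in> B.mball x r" using y L(2)[of x y] by auto
    qed
    then show "\<exists>r>0. A.mball x r \<subseteq> U" using r L(1) by (intro exI[of _ "r / L"]) auto
  qed
qed

lemma Lipschitz_MCauchy:
  assumes "Metric_space M d" "Metric_space M d'" and L: "L > 0" "\<And>x y. x \<in> M \<Longrightarrow> y \<in> M \<Longrightarrow> d' x y \<le> L * d x y"
    and c: "Metric_space.MCauchy M d \<sigma>"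
  shows "Metric_space.MCauchy M d' \<sigma>"
proof -
  interpret A: Metric_space M d by fact
  interpret B: Metric_space M d' by fact
  have r: "range \<sigma> \<subseteq> M" using c by (simp add: A.MCauchy_def)
  show ?thesis
    unfolding B.MCauchy_def
  proof (intro conjI allI impI r)
    fix e :: real assume "e > 0"
    then have "e / L > 0" using L(1) by simp
    then obtain N where N: "\<forall>n n'. N \<le> n \<longrightarrow> N \<le> n' \<longrightarrow> d (\<sigma> n) (\<sigma> n') < e / L"
      using c unfolding A.MCauchy_def by blast
    have "d' (\<sigma> n) (\<sigma> n') < e" if "N \<le> n" "N \<le> n'" for n n'
    proof -
      have "L * d (\<sigma> n) (\<sigma> n') < e" using N[rule_format, OF that] L(1) by (simp add: field_simps)
      then show ?thesis using L(2)[of "\<sigma> n" "\<sigma> n'"] r by force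
    qed
    then show "\<exists>N. \<forall>n n'. N \<le> n \<longrightarrow> N \<le> n' \<longrightarrow> d' (\<sigma> n) (\<sigma> n') < e" by blast
  qed
qed

text \<open>The derivative of \<open>tau_inv\<close> at z is 2 / (1 - (2z)^2). On [-c, c] it is
  largest at the ends, and it is unbounded near \<plusminus>1/2, so the constant depends on
  \<open>c\<close>.\<close>

lemma tau_inv_lip:
  assumes c: "0 \<le> c" "c < 1/2" and st: "\<bar>s\<bar> \<le> c" "\<bar>t\<bar> \<le> c"
  shows "\<bar>tau_inv s - tau_inv t\<bar> \<le> 2 / (1 - (2 * c)\<^sup>2) * \<bar>s - t\<bar>"
proof -
  have c2: "(2 * c)\<^sup>2 < 1" by (rule abs_square_less_1[THEN iffD2]) (use c in auto)
  have "norm (tau_inv s - tau_inv t) \<le> 2 / (1 - (2 * c)\<^sup>2) * norm (s - t)"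
  proof (rule field_differentiable_bound[of "{-c..c}"])
    fix z assume z: "z \<in> {-c..c}"
    then have z1: "\<bar>2 * z\<bar> \<le> 2 * c" by auto
    have z2: "(2 * z)\<^sup>2 \<le> (2 * c)\<^sup>2" using z1 c(1) by (intro abs_le_square_iff[THEN iffD1]) simp
    show "(tau_inv has_field_derivative 2 / (1 - (2 * z)\<^sup>2)) (at z within {-c..c})"
    proof -
      have "(artanh has_field_derivative 1 / (1 - (2 * z)\<^sup>2)) (at (2 * z))"
        by (rule artanh_real_has_field_derivative) (use z1 c in linarith)
      moreover have "((\<lambda>z. 2 * z) has_field_derivative 2) (at z)" by (auto intro!: derivative_eq_intros)
      ultimately have "((\<lambda>z. artanh (2 * z)) has_field_derivative 1 / (1 - (2 * z)\<^sup>2) * 2) (at z)"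
        by (rule DERIV_chain2)
      then show ?thesis by (simp add: tau_inv_def[abs_def] has_field_derivative_at_within)
    qed
    show "norm (2 / (1 - (2 * z)\<^sup>2)) \<le> 2 / (1 - (2 * c)\<^sup>2)"
      using z2 c2 by (simp add: frac_le)
  qed (use st in \<open>auto simp: abs_le_iff\<close>)
  then show ?thesis by simp
qed

lemma K_valued_abs:
  assumes "K_valued X" "f \<in> feats X" "x \<in> pts X" shows "\<bar>f x\<bar> \<le> 1/2"
proof -
  have "f x \<in> {-1/2..1/2}" using assms unfolding K_valued_def by blast
  then show ?thesis by (auto simp: abs_if)
qed

text \<open>After contraction by 1 - \<delta> the feature values lie in [-c, c] with c = (1 -
  \<delta>)/2, where \<open>tau_inv\<close> is Lipschitz; conversely \<open>tau\<close> is Lipschitz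
  everywhere. The new distance is therefore bi-Lipschitz equivalent to the old one, and
  completeness, topology and Borel sets are unchanged. The features of the screen of
  \<open>Y\<close> are the contracted ones, at most \<delta>/2 away from the originals.\<close>

theorem screens_dense:
  fixes X :: "'a data_set"
  assumes "geom_data X" "K_valued X" and \<delta>: "0 < \<delta>" "\<delta> < 1"
  obtains Y :: "'a data_set" where "geom_data Y" "box_data (screen Y) X \<le> ennreal \<delta>"
proof -
  interpret X: geom_data X by fact
  define \<Theta> where "\<Theta> f = restrict (\<lambda>x. tau_inv ((1 - \<delta>) * f x)) (pts X)" for f
  define F where "F = \<Theta> ` feats X"
  define Y where "Y = \<lparr>pts = pts X, feats = F, meas = meas X\<rparr>"
  have Y [simp]: "pts Y = pts X" "feats Y = F" "meas Y = meas X" by (simp_all add: Y_def)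
  define c where "c = (1 - \<delta>) / 2"
  have c: "0 \<le> c" "c < 1/2" using \<delta> by (auto simp: c_def)
  define L where "L = 2 / (1 - (2 * c)\<^sup>2)"
  have "(2 * c)\<^sup>2 < 1" by (rule abs_square_less_1[THEN iffD2]) (use c in auto)
  then have L: "L > 0" by (simp add: L_def)
  have fb: "\<bar>(1 - \<delta>) * f x\<bar> \<le> c" if "f \<in> feats X" "x \<in> pts X" for f x
  proof -
    have "\<bar>f x\<bar> \<le> 1/2" by (rule K_valued_abs[OF assms(2) that])
    then have "(1 - \<delta>) * \<bar>f x\<bar> \<le> (1 - \<delta>) * (1/2)" using \<delta> by (intro mult_left_mono) auto
    then show ?thesis using \<delta> by (simp add: c_def abs_mult)
  qed
  have fK: "(1 - \<delta>) * f x \<in> {-1/2<..<1/2}" if "f \<in> feats X" "x \<in> pts X" for f x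
    using fb[OF that] c by (auto simp: abs_le_iff)
  have \<Theta>: "\<Theta> f x = tau_inv ((1 - \<delta>) * f x)" if "x \<in> pts X" for f x
    using that by (simp add: \<Theta>_def)
  have tau\<Theta>: "tau (\<Theta> f x) = (1 - \<delta>) * f x" if "f \<in> feats X" "x \<in> pts X" for f x
    using \<Theta>[OF that(2)] tau_tau_inv[OF fK[OF that]] by simp
  have up: "\<bar>\<Theta> f x - \<Theta> f y\<bar> \<le> L * data_dist X x y" if "f \<in> feats X" "x \<in> pts X" "y \<in> pts X" for f x y
  proof -
    have "\<bar>\<Theta> f x - \<Theta> f y\<bar> \<le> L * \<bar>(1 - \<delta>) * f x - (1 - \<delta>) * f y\<bar>"
      unfolding \<Theta>[OF that(2)] \<Theta>[OF that(3)] L_def by (rule tau_inv_lip[OF c]) (use that fb in auto)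
    also have "\<bar>(1 - \<delta>) * f x - (1 - \<delta>) * f y\<bar> = (1 - \<delta>) * \<bar>f x - f y\<bar>"
      using \<delta> by (simp add: right_diff_distrib[symmetric] abs_mult)
    also have "\<dots> \<le> 1 * data_dist X x y"
      using X.feat_lip[OF that] \<delta> by (intro mult_mono) auto
    finally show ?thesis using L by simp
  qed
  have low: "\<bar>f x - f y\<bar> \<le> inverse (1 - \<delta>) * \<bar>\<Theta> f x - \<Theta> f y\<bar>" if "f \<in> feats X" "x \<in> pts X" "y \<in> pts X" for f x y
  proof -
    have "(1 - \<delta>) * \<bar>f x - f y\<bar> = \<bar>(1 - \<delta>) * f x - (1 - \<delta>) * f y\<bar>"
      using \<delta> by (simp add: right_diff_distrib[symmetric] abs_mult)
    also have "\<dots> \<le> \<bar>\<Theta> f x - \<Theta> f y\<bar>"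
      using tau_lip[of "\<Theta> f x" "\<Theta> f y"] unfolding tau\<Theta>[OF that(1,2)] tau\<Theta>[OF that(1,3)] by argo
    finally show ?thesis using \<delta> by (simp add: field_simps)
  qed
  have bdd: "bdd_above ((\<lambda>f. \<bar>f x - f y\<bar>) ` F)" if "x \<in> pts X" "y \<in> pts X" for x y
    unfolding F_def image_image by (rule bdd_aboveI2) (rule up[OF _ that])
  have Fne: "F \<noteq> {}" using X.feats_ne by (simp add: F_def)
  have le1: "data_dist X x y \<le> inverse (1 - \<delta>) * data_dist Y x y" if "x \<in> pts X" "y \<in> pts X" for x y
  proof (rule feature_dist_least[OF X.feats_ne that])
    fix f assume f: "f \<in> feats X"
    have "\<bar>\<Theta> f x - \<Theta> f y\<bar> \<le> data_dist Y x y"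
      using feature_dist_upper[OF bdd[OF that], of "\<Theta> f" "pts X"] that f by (simp add: F_def)
    then have "inverse (1 - \<delta>) * \<bar>\<Theta> f x - \<Theta> f y\<bar> \<le> inverse (1 - \<delta>) * data_dist Y x y"
      using \<delta> by (intro mult_left_mono) auto
    then show "\<bar>f x - f y\<bar> \<le> inverse (1 - \<delta>) * data_dist Y x y" using low[OF f that] by linarith
  qed
  have le2: "data_dist Y x y \<le> L * data_dist X x y" if "x \<in> pts X" "y \<in> pts X" for x y
    unfolding Y by (rule feature_dist_least[OF Fne that]) (use up that in \<open>auto simp: F_def\<close>)
  have MY: "Metric_space (pts X) (data_dist Y)"
    unfolding Y
  proof (rule Metric_space_feature_dist[OF Fne bdd])
    fix x y assume xy: "x \<in> pts X" "y \<in> pts X" and eq: "\<And>f. f \<in> F \<Longrightarrow> f x = f y"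
    have "\<bar>f x - f y\<bar> \<le> 0" if "f \<in> feats X" for f
    proof -
      have "\<Theta> f x = \<Theta> f y" using that by (intro eq) (simp add: F_def)
      then show ?thesis using low[OF that xy] by simp
    qed
    then have "data_dist X x y \<le> 0" by (rule feature_dist_least[OF X.feats_ne xy])
    then show "x = y" using X.nonneg[of x y] X.zero[OF xy] by simp
  qed
  interpret MY: Metric_space "pts X" "data_dist Y" by (rule MY)
  have i0: "inverse (1 - \<delta>) > 0" using \<delta> by simp
  have top: "MY.mtopology = X.mtopology"
    unfolding topology_eq
    using Lipschitz_openin[OF X.Metric_space_axioms MY L le2] Lipschitz_openin[OF MY X.Metric_space_axioms i0 le1] by blast
  have "geometric_data_set Y"
    unfolding geometric_data_set_def
  proof (intro conjI)
    show "feats Y \<noteq> {}" using Fne by simp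
    show "feats Y \<subseteq> extensional (pts Y)" by (auto simp: F_def \<Theta>_def)
    show "\<forall>x\<in>pts Y. \<forall>y\<in>pts Y. bdd_above ((\<lambda>f. \<bar>f x - f y\<bar>) ` feats Y)" using bdd by simp
    show "Metric_space (pts Y) (data_dist Y)" using MY by simp
    have "MY.mcomplete"
      unfolding MY.mcomplete_def top
    proof (intro allI impI)
      fix \<sigma> assume \<sigma>: "MY.MCauchy \<sigma>"
      have "X.MCauchy \<sigma>"
        by (rule Lipschitz_MCauchy[OF MY X.Metric_space_axioms i0 _ \<sigma>]) (rule le1)
      then show "\<exists>x. limitin X.mtopology \<sigma> x sequentially" using X.complete unfolding X.mcomplete_def by blast
    qed
    then show "Metric_space.mcomplete (pts Y) (data_dist Y)" by simp
    have t: "data_top Y = X.mtopology" using top by simp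
    show "separable_space (data_top Y)" unfolding t by (rule X.separable)
    show "sets (meas Y) = sets (borel_of (data_top Y))" unfolding t using X.sets_meas by simp
    show "prob_space (meas Y)" by (simp add: X.P.prob_space_axioms)
    show "\<forall>U. openin (data_top Y) U \<and> U \<noteq> {} \<longrightarrow> emeasure (meas Y) U > 0" unfolding t using X.full by simp
  qed
  then have gY: "geom_data Y" by (rule geom_data.intro)
  interpret Y: geom_data Y by (rule gY)
  obtain f where f: "dense_features X f" "\<And>k. f k \<in> feats X" using X.dense_features_exists by blast
  define f' where "f' k = \<Theta> (f k)" for k
  have f'F: "f' k \<in> feats Y" for k using f(2) by (simp add: f'_def F_def)
  have f': "dense_features Y f'"
    unfolding dense_features_def
  proof (intro conjI allI ballI)
    show "pw_adherent (pts Y) (feats Y) (f' k)" for k by (rule pw_adherent_superset[OF f'F])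
    fix h assume "h \<in> feats Y"
    then obtain u where u: "u \<in> feats X" "h = \<Theta> u" by (auto simp: F_def)
    \<comment> \<open>Density is checked for the functions \<open>tau \<circ> f' k\<close>, where it
      follows from that of \<open>f\<close> by scaling, and is then carried through the continuous
      \<open>tau_inv\<close>.\<close>
    have "pw_adherent (pts X) ((\<lambda>f. tau \<circ> f) ` range f') (\<lambda>x. (1 - \<delta>) * u x)"
      unfolding pw_adherent_def
    proof (intro allI impI)
      fix B \<epsilon> assume B: "finite B" "B \<subseteq> pts X" "(\<epsilon>::real) > 0"
      have "pw_adherent (pts X) (range f) u" using f(1) u(1) by (simp add: dense_features_def)
      from this[unfolded pw_adherent_def, rule_format, OF B] obtain k where k: "\<And>b. b \<in> B \<Longrightarrow> \<bar>f k b - u b\<bar> < \<epsilon>" by blast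
      have "\<bar>(tau \<circ> f' k) b - (1 - \<delta>) * u b\<bar> < \<epsilon>" if b: "b \<in> B" for b
      proof -
        have "b \<in> pts X" using b B by auto
        have "(tau \<circ> f' k) b - (1 - \<delta>) * u b = (1 - \<delta>) * (f k b - u b)"
          using tau\<Theta>[OF f(2) \<open>b \<in> pts X\<close>, of k] by (simp add: f'_def right_diff_distrib)
        then have "\<bar>(tau \<circ> f' k) b - (1 - \<delta>) * u b\<bar> = (1 - \<delta>) * \<bar>f k b - u b\<bar>"
          using \<delta> by (simp add: abs_mult)
        also have "\<dots> \<le> 1 * \<bar>f k b - u b\<bar>" using \<delta> by (intro mult_right_mono) auto
        finally show ?thesis using k[OF b] by simp
      qed
      then show "\<exists>g\<in>(\<lambda>f. tau \<circ> f) ` range f'. \<forall>b\<in>B. \<bar>g b - (1 - \<delta>) * u b\<bar> < \<epsilon>"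
        by (intro bexI[of _ "tau \<circ> f' k"]) auto
    qed
    from pw_adherent_tau_inv[OF this fK[OF u(1)]]
    show "pw_adherent (pts Y) (range f') h"
      unfolding Y by (rule pw_adherent_cong) (simp_all add: u(2) \<Theta>)
  qed
  have ev: "\<bar>screen_extension Y (f' k) (Y.cm x) - f k x\<bar> \<le> \<delta> / 2" if x: "x \<in> pts X" for k x
  proof -
    have "screen_extension Y (f' k) (Y.cm x) = (1 - \<delta>) * f k x"
      using Y.feat_extension(3)[OF f'F, of x k] x tau\<Theta>[OF f(2) x] by (simp add: f'_def)
    then have "\<bar>screen_extension Y (f' k) (Y.cm x) - f k x\<bar> = \<delta> * \<bar>f k x\<bar>"
      using \<delta> by (simp add: left_diff_distrib abs_mult)
    also have "\<bar>f k x\<bar> \<le> 1/2" by (rule K_valued_abs[OF assms(2) f(2) x])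
    finally show ?thesis using \<delta> by simp
  qed
  have "box_data (screen Y) X \<le> ennreal \<delta>"
  \<comment> \<open>\<open>X\<close> itself is the sample space: one component is the screen map,
    the other the identity, and \<open>ev\<close> holds at every point.\<close>
  proof (rule box_data_upper[OF Y.screen_geom_data assms(1) X.P.prob_space_axioms _ _ _ _ Y.dense_features_screen[OF f'] f(1), where e = "\<delta>/2"])
    show "Y.cm \<in> measurable (meas X) (meas (screen Y))" using Y.screen_map_measurable by simp
    show "distr (meas X) (meas (screen Y)) Y.cm = meas (screen Y)" using Y.screen_map_distr by simp
    show "(\<lambda>x. x) \<in> measurable (meas X) (meas X)" by simp
    show "distr (meas X) (meas X) (\<lambda>x. x) = meas X" by (simp add: distr_id2)
    have "{\<omega> \<in> space (meas X). \<forall>k. \<bar>screen_extension Y (f' k) (Y.cm \<omega>) - f k \<omega>\<bar> \<le> \<delta> / 2} = space (meas X)"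
      using ev by auto
    then show "1 - \<delta> \<le> X.P.prob {\<omega> \<in> space (meas X). \<forall>k. \<bar>screen_extension Y (f' k) (Y.cm \<omega>) - f k \<omega>\<bar> \<le> \<delta> / 2}"
      using \<delta> by (simp only: X.P.prob_space)
  qed simp
  with gY show ?thesis using that by blast
qed


section \<open>Realizing random sequences and Markov chains\<close>

text \<open>
  The points of \<open>X\<close> form the support of the distribution of \<open>\<xi>\<close> with respect to the supremum distance. That
  distance is not separable on all bounded sequences, hence the countable set \<open>C\<close>.
\<close>

lemma realization:
  fixes \<xi> :: "'w \<Rightarrow> nat \<Rightarrow> real"
  assumes Q: "prob_space Q" and m: "\<xi> \<in> measurable Q seq_borel"
    and K: "\<And>\<omega> k. \<omega> \<in> space Q \<Longrightarrow> \<xi> \<omega> k \<in> {-1/2..1/2}"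
    and C: "countable C" "\<And>\<omega> r. \<omega> \<in> space Q \<Longrightarrow> r > 0 \<Longrightarrow> \<exists>q\<in>C. \<forall>k. \<bar>\<xi> \<omega> k - q k\<bar> \<le> r"
  obtains X :: "(nat \<Rightarrow> real) data_set" and \<alpha> where "geom_data X" "K_valued X" "dense_features X (\<lambda>k x. x k)"
    "\<alpha> \<in> measurable Q (meas X)" "distr Q (meas X) \<alpha> = meas X" "AE \<omega> in Q. \<alpha> \<omega> = \<xi> \<omega>"
proof -
  interpret Q: prob_space Q by fact
  define N where "N x r = {\<omega>\<in>space Q. \<forall>k. \<bar>\<xi> \<omega> k - x k\<bar> \<le> r}" for x r
  have m1: "(\<lambda>\<omega>. \<xi> \<omega> k) \<in> borel_measurable Q" for k
    using measurable_compose[OF m measurable_component_singleton[of k]] by simp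
  have Nm: "N x r \<in> sets Q" for x r unfolding N_def using m1 by measurable
  have Nmono: "N x r \<subseteq> N y s" if "\<And>k. \<bar>x k - y k\<bar> \<le> s - r" for x y r s
  proof
    fix \<omega> assume w: "\<omega> \<in> N x r"
    have "\<bar>\<xi> \<omega> k - y k\<bar> \<le> s" for k
    proof -
      have "\<bar>\<xi> \<omega> k - x k\<bar> \<le> r" using w by (simp add: N_def)
      then show ?thesis using that[of k] by argo
    qed
    then show "\<omega> \<in> N y s" using w by (simp add: N_def)
  qed
  \<comment> \<open>The bound on the entries keeps all distances finite and the features
    \<open>K\<close>-valued.\<close>
  define S where "S = {x. (\<forall>k. x k \<in> {-1/2..1/2}) \<and> (\<forall>r>0. Q.prob (N x r) > 0)}"
  define F where "F = range (\<lambda>k. restrict (\<lambda>x. x k) S)"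
  define d where "d = feature_dist S F"
  have bdd: "bdd_above ((\<lambda>f. \<bar>f x - f y\<bar>) ` F)" if "x \<in> S" "y \<in> S" for x y
  proof -
    have "\<bar>x k - y k\<bar> \<le> 1" for k
    proof -
      have "x k \<in> {-1/2..1/2}" "y k \<in> {-1/2..1/2}" using that by (auto simp: S_def)
      then show ?thesis by auto
    qed
    then show ?thesis unfolding F_def image_image using that by (intro bdd_aboveI2[of _ _ 1]) simp
  qed
  have Fne: "F \<noteq> {}" by (simp add: F_def)
  have d_up: "\<bar>x k - y k\<bar> \<le> d x y" if "x \<in> S" "y \<in> S" for x y k
  proof -
    have "restrict (\<lambda>x. x k) S \<in> F" by (simp add: F_def)
    from feature_dist_upper[OF bdd[OF that] this that] that show ?thesis by (simp add: d_def)
  qed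
  have d_le: "d x y \<le> c" if "x \<in> S" "y \<in> S" "\<And>k. \<bar>x k - y k\<bar> \<le> c" for x y c
    unfolding d_def by (rule feature_dist_least[OF Fne that(1,2)]) (use that in \<open>auto simp: F_def\<close>)
  interpret M: Metric_space S d
    unfolding d_def
  proof (rule Metric_space_feature_dist[OF Fne bdd])
    fix x y assume xy: "x \<in> S" "y \<in> S" and eq: "\<And>f. f \<in> F \<Longrightarrow> f x = f y"
    have "x k = y k" for k
      using eq[of "restrict (\<lambda>x. x k) S"] xy by (simp add: F_def)
    then show "x = y" by blast
  qed
  have complete: "M.mcomplete"
    unfolding M.mcomplete_def
  proof (intro allI impI)
    fix \<sigma> assume "M.MCauchy \<sigma>"
    then have \<sigma>: "\<And>n. \<sigma> n \<in> S" and cau: "\<And>e. e > 0 \<Longrightarrow> \<exists>L. \<forall>n n'. L \<le> n \<longrightarrow> L \<le> n' \<longrightarrow> d (\<sigma> n) (\<sigma> n') < e"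
      by (auto simp: M.MCauchy_def)
    have "convergent (\<lambda>n. \<sigma> n k)" for k
    proof (rule Cauchy_convergent, rule metric_CauchyI)
      fix e :: real assume "e > 0"
      from cau[OF this] obtain L where L: "\<forall>n n'. L \<le> n \<longrightarrow> L \<le> n' \<longrightarrow> d (\<sigma> n) (\<sigma> n') < e" ..
      have "dist (\<sigma> n k) (\<sigma> n' k) < e" if "n \<ge> L" "n' \<ge> L" for n n'
        using d_up[OF \<sigma> \<sigma>, of n k n'] L[rule_format, OF that] by (simp add: dist_real_def)
      then show "\<exists>L. \<forall>n\<ge>L. \<forall>n'\<ge>L. dist (\<sigma> n k) (\<sigma> n' k) < e" by blast
    qed
    then have "\<exists>l. (\<lambda>n. \<sigma> n k) \<longlonglongrightarrow> l" for k by (simp add: convergent_def)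
    then obtain x where x: "\<And>k. (\<lambda>n. \<sigma> n k) \<longlonglongrightarrow> x k" by metis
    have unif: "\<exists>L. \<forall>n\<ge>L. \<forall>k. \<bar>\<sigma> n k - x k\<bar> \<le> e" if "e > 0" for e
    proof -
      from cau[OF that] obtain L where L: "\<forall>n n'. L \<le> n \<longrightarrow> L \<le> n' \<longrightarrow> d (\<sigma> n) (\<sigma> n') < e" ..
      have "\<bar>\<sigma> n k - x k\<bar> \<le> e" if "n \<ge> L" for n k
      proof (rule LIMSEQ_le_const2)
        show "(\<lambda>n'. \<bar>\<sigma> n k - \<sigma> n' k\<bar>) \<longlonglongrightarrow> \<bar>\<sigma> n k - x k\<bar>" by (intro tendsto_intros x)
        show "\<exists>N. \<forall>n'\<ge>N. \<bar>\<sigma> n k - \<sigma> n' k\<bar> \<le> e"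
        proof (intro exI[of _ L] allI impI)
          fix n' assume "L \<le> n'"
          then show "\<bar>\<sigma> n k - \<sigma> n' k\<bar> \<le> e"
            using d_up[OF \<sigma> \<sigma>, of n k n'] L[rule_format, OF that, of n'] by linarith
        qed
      qed
      then show ?thesis by blast
    qed
    have xS: "x \<in> S"
      unfolding S_def
    proof (intro CollectI conjI allI impI)
      fix k
      have "\<sigma> n k \<in> {-1/2..1/2}" for n using \<sigma>[of n] by (auto simp: S_def)
      then show "x k \<in> {-1/2..1/2}" using closed_sequentially[OF closed_atLeastAtMost _ x[of k]] by blast
    next
      fix r :: real assume "r > 0"
      then obtain L where L: "\<forall>n\<ge>L. \<forall>k. \<bar>\<sigma> n k - x k\<bar> \<le> r/2" using unif[of "r/2"] by auto
      have "0 < Q.prob (N (\<sigma> L) (r/2))" using \<sigma>[of L] \<open>r > 0\<close> by (auto simp: S_def)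
      also have "\<dots> \<le> Q.prob (N x r)"
        by (rule Q.finite_measure_mono[OF Nmono Nm]) (use L in simp)
      finally show "0 < Q.prob (N x r)" .
    qed
    have "limitin M.mtopology \<sigma> x sequentially"
      unfolding M.limit_metric_sequentially
    proof (intro conjI allI impI xS)
      fix e :: real assume "e > 0"
      then obtain L where L: "\<forall>n\<ge>L. \<forall>k. \<bar>\<sigma> n k - x k\<bar> \<le> e/2" using unif[of "e/2"] by auto
      have "\<sigma> n \<in> S \<and> d (\<sigma> n) x < e" if "n \<ge> L" for n
        using d_le[OF \<sigma> xS, of n "e/2"] L that \<sigma>[of n] \<open>e > 0\<close> by force
      then show "\<exists>L. \<forall>n\<ge>L. \<sigma> n \<in> S \<and> d (\<sigma> n) x < e" by blast
    qed
    then show "\<exists>x. limitin M.mtopology \<sigma> x sequentially" by blast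
  qed
  define \<rho> where "\<rho> n = inverse (real (Suc n))" for n
  have \<rho>: "\<rho> n > 0" "\<And>r. r > 0 \<Longrightarrow> \<exists>n. \<rho> n < r" for n
    using reals_Archimedean by (auto simp: \<rho>_def)
  \<comment> \<open>The neighbourhoods of points of \<open>C\<close> that carry no mass. There are
    countably many, so their union \<open>Bad\<close> is null, and it contains every sample point
    whose value misses the support.\<close>
  define I where "I = {(q, n). q \<in> C \<and> Q.prob (N q (\<rho> n)) = 0}"
  define Bad where "Bad = (\<Union>(q,n)\<in>I. N q (\<rho> n))"
  have "countable (C \<times> (UNIV :: nat set))" using C(1) by simp
  then have cI: "countable I" by (rule countable_subset[rotated]) (auto simp: I_def)
  have Badm: "Bad \<in> sets Q" unfolding Bad_def by (rule sets.countable_UN'') (auto intro: Nm cI)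
  have "Bad \<in> null_sets Q"
    unfolding Bad_def by (rule null_sets_UN'[OF cI]) (auto simp: I_def Nm Q.emeasure_eq_measure intro!: null_setsI)
  then have Bad0: "Q.prob Bad = 0" by (simp add: Q.emeasure_eq_measure null_sets_def)
  have good: "\<xi> \<omega> \<in> S" if w: "\<omega> \<in> space Q" "\<omega> \<notin> Bad" for \<omega>
  proof (rule ccontr)
    assume "\<xi> \<omega> \<notin> S"
    then obtain r where r: "r > 0" "Q.prob (N (\<xi> \<omega>) r) \<le> 0"
      using K[OF w(1)] unfolding S_def by (auto simp: not_less)
    obtain n where n: "\<rho> n < r/2" using \<rho>(2)[of "r/2"] r by auto
    obtain q where q: "q \<in> C" "\<And>k. \<bar>\<xi> \<omega> k - q k\<bar> \<le> \<rho> n" using C(2)[OF w(1) \<rho>(1)] by blast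
    \<comment> \<open>With \<rho> n < r/2, the \<rho> n-neighbourhood of \<open>q\<close>, which
      contains the value, lies inside the r-neighbourhood of that value.\<close>
    have "Q.prob (N q (\<rho> n)) \<le> Q.prob (N (\<xi> \<omega>) r)"
    proof (rule Q.finite_measure_mono[OF Nmono Nm])
      fix k show "\<bar>q k - \<xi> \<omega> k\<bar> \<le> r - \<rho> n" using q(2)[of k] n by linarith
    qed
    then have "Q.prob (N q (\<rho> n)) = 0" using r(2) by (intro antisym) auto
    then have "(q, n) \<in> I" using q by (simp add: I_def)
    moreover have "\<omega> \<in> N q (\<rho> n)" using q w by (simp add: N_def)
    ultimately show False using w(2) unfolding Bad_def by blast
  qed
  have "Q.prob (space Q - Bad) = 1" using Q.prob_compl[OF Badm] Bad0 by simp
  then have "space Q - Bad \<noteq> {}" by (metis measure_empty zero_neq_one)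
  then obtain x0 where x0: "x0 \<in> S" using good by blast
  have hit: "\<exists>q\<in>C. \<forall>k. \<bar>x k - q k\<bar> \<le> \<rho> n" if "x \<in> S" for x n
  proof -
    have r2: "\<rho> n / 2 > 0" using \<rho>(1)[of n] by simp
    then have "Q.prob (N x (\<rho> n / 2)) > 0" using that by (simp add: S_def)
    then have "N x (\<rho> n / 2) \<noteq> {}" by auto
    then obtain \<omega> where w: "\<omega> \<in> space Q" "\<And>k. \<bar>\<xi> \<omega> k - x k\<bar> \<le> \<rho> n / 2" by (auto simp: N_def)
    obtain q where q: "q \<in> C" "\<And>k. \<bar>\<xi> \<omega> k - q k\<bar> \<le> \<rho> n / 2" using C(2)[OF w(1) r2] by blast
    have "\<bar>x k - q k\<bar> \<le> \<rho> n" for k using w(2)[of k] q(2)[of k] by linarith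
    with q(1) show ?thesis by blast
  qed
  then have Cne: "C \<noteq> {}" using x0 by blast
  define q where "q = from_nat_into C"
  have rq: "range q = C" unfolding q_def by (rule range_from_nat_into[OF Cne C(1)])
  \<comment> \<open>Points of \<open>C\<close> may lie outside \<open>S\<close>. For each of their
    neighbourhoods a point of \<open>S\<close> inside it is chosen, with \<open>x0\<close> as
    default where the neighbourhood misses \<open>S\<close>.\<close>
  define s where "s i = (case prod_decode i of (a, n) \<Rightarrow> 
    if \<exists>x\<in>S. \<forall>k. \<bar>x k - q a k\<bar> \<le> \<rho> n then SOME x. x \<in> S \<and> (\<forall>k. \<bar>x k - q a k\<bar> \<le> \<rho> n) else x0)" for i
  have sS: "s i \<in> S" for i
  proof (cases "prod_decode i")
    case (Pair a n)
    show ?thesis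
    proof (cases "\<exists>x\<in>S. \<forall>k. \<bar>x k - q a k\<bar> \<le> \<rho> n")
      case True
      then have "\<exists>x. x \<in> S \<and> (\<forall>k. \<bar>x k - q a k\<bar> \<le> \<rho> n)" by blast
      from someI_ex[OF this] show ?thesis using True by (simp add: s_def Pair)
    next
      case False
      then have "s i = x0" by (simp only: s_def Pair prod.case if_False)
      with x0 show ?thesis by simp
    qed
  qed
  have dense: "\<exists>i. d (s i) x < r" if x: "x \<in> S" and r: "r > 0" for x r
  proof -
    obtain n where n: "\<rho> n < r/3" using \<rho>(2)[of "r/3"] r by auto
    obtain a where a: "\<And>k. \<bar>x k - q a k\<bar> \<le> \<rho> n" using hit[OF x, of n] rq by blast
    then have ex: "\<exists>x. x \<in> S \<and> (\<forall>k. \<bar>x k - q a k\<bar> \<le> \<rho> n)" using x by blast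
    let ?i = "prod_encode (a, n)"
    have "s ?i = (SOME x. x \<in> S \<and> (\<forall>k. \<bar>x k - q a k\<bar> \<le> \<rho> n))" using ex by (auto simp: s_def)
    then have si: "\<And>k. \<bar>s ?i k - q a k\<bar> \<le> \<rho> n" using someI_ex[OF ex] by simp
    have "d (s ?i) x \<le> 2 * \<rho> n"
    proof (rule d_le[OF sS x])
      fix k show "\<bar>s ?i k - x k\<bar> \<le> 2 * \<rho> n" using si[of k] a[of k] by argo
    qed
    then show ?thesis using n r by (intro exI[of _ ?i]) linarith
  qed
  \<comment> \<open>On the null event the value is redirected to \<open>x0\<close>, so that every
    value lies in \<open>S\<close>.\<close>
  define \<alpha> where "\<alpha> \<omega> = (if \<omega> \<in> Bad then x0 else \<xi> \<omega>)" for \<omega>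
  have \<alpha>S: "\<alpha> \<in> space Q \<rightarrow> S" using x0 good by (auto simp: \<alpha>_def)
  have \<alpha>m1: "(\<lambda>\<omega>. \<alpha> \<omega> k) \<in> borel_measurable Q" for k
  proof -
    have "(\<lambda>\<omega>. \<alpha> \<omega> k) = (\<lambda>\<omega>. if \<omega> \<in> Bad then x0 k else \<xi> \<omega> k)" by (auto simp: \<alpha>_def)
    then show ?thesis using Badm m1[of k] by simp
  qed
  have \<alpha>: "\<alpha> \<in> measurable Q (borel_of M.mtopology)"
  proof (rule M.measurable_borel_of_mtopology[OF sS dense \<alpha>S])
    fix x r assume x: "x \<in> S"
    have "{\<omega>\<in>space Q. d x (\<alpha> \<omega>) \<le> r} = {\<omega>\<in>space Q. \<forall>k. \<bar>x k - \<alpha> \<omega> k\<bar> \<le> r}"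
      using \<alpha>S by (intro Collect_cong conj_cong refl)
        (auto intro!: d_le[OF x] intro: order_trans[OF d_up[OF x]])
    also have "\<dots> \<in> sets Q" using \<alpha>m1 by measurable
    finally show "{\<omega>\<in>space Q. d x (\<alpha> \<omega>) \<le> r} \<in> sets Q" .
  qed
  define X where "X = \<lparr>pts = S, feats = F, meas = distr Q (borel_of M.mtopology) \<alpha>\<rparr>"
  have X [simp]: "pts X = S" "feats X = F" "meas X = distr Q (borel_of M.mtopology) \<alpha>" by (simp_all add: X_def)
  have dX: "data_dist X = d" by (simp add: d_def)
  have "geometric_data_set X"
    unfolding geometric_data_set_def dX
    unfolding X
  proof (intro conjI allI impI ballI)
    show "F \<noteq> {}" by (rule Fne)
    show "F \<subseteq> extensional S" by (auto simp: F_def)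
    show "bdd_above ((\<lambda>f. \<bar>f x - f y\<bar>) ` F)" if "x \<in> S" "y \<in> S" for x y by (rule bdd[OF that])
    show "Metric_space S d" by (rule M.Metric_space_axioms)
    show "M.mcomplete" by (rule complete)
    show "separable_space M.mtopology"
      unfolding separable_space_def
    proof (intro exI[of _ "range s"] conjI)
      show "M.mtopology closure_of range s = topspace M.mtopology"
      proof (intro equalityI subsetI)
        fix z assume "z \<in> topspace M.mtopology"
        then have z: "z \<in> S" by simp
        have "\<exists>n. d z (s n) < r" if "r > 0" for r
          using dense[OF z that] M.commute by metis
        then show "z \<in> M.mtopology closure_of range s"
          using z sS by (auto simp: M.metric_closure_of)
      qed (auto simp: M.metric_closure_of)
    qed (use sS in auto)
    show "sets (distr Q (borel_of M.mtopology) \<alpha>) = sets (borel_of M.mtopology)" by simp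
    show "prob_space (distr Q (borel_of M.mtopology) \<alpha>)" by (rule Q.prob_space_distr[OF \<alpha>])
    fix U assume U: "openin M.mtopology U \<and> U \<noteq> {}"
    then obtain x where "x \<in> U" by blast
    then obtain r where r: "r > 0" "M.mball x r \<subseteq> U" using U unfolding M.openin_mtopology by blast
    have x: "x \<in> S" using U \<open>x \<in> U\<close> openin_subset by fastforce
    have "0 < Q.prob (N x (r/2))" using x r by (simp add: S_def)
    also have "\<dots> = Q.prob (N x (r/2) - Bad)"
      using Q.finite_measure_Diff'[OF Nm Badm] Q.finite_measure_mono[OF Int_lower2 Badm, of "N x (r/2)"] Bad0
        measure_nonneg[of Q "N x (r/2) \<inter> Bad"] by simp
    also have "\<dots> \<le> Q.prob (\<alpha> -` U \<inter> space Q)"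
    proof (rule Q.finite_measure_mono)
      show "N x (r/2) - Bad \<subseteq> \<alpha> -` U \<inter> space Q"
      proof
        fix \<omega> assume w: "\<omega> \<in> N x (r/2) - Bad"
        then have ww: "\<omega> \<in> space Q" "\<alpha> \<omega> = \<xi> \<omega>" by (auto simp: N_def \<alpha>_def)
        then have aS: "\<alpha> \<omega> \<in> S" using \<alpha>S by blast
        have "d x (\<alpha> \<omega>) \<le> r/2"
          by (rule d_le[OF x aS]) (use w ww in \<open>auto simp: N_def abs_minus_commute\<close>)
        then have "\<alpha> \<omega> \<in> M.mball x r" using x aS r(1) by simp
        then show "\<omega> \<in> \<alpha> -` U \<inter> space Q" using r(2) ww by blast
      qed
      show "\<alpha> -` U \<inter> space Q \<in> sets Q" by (rule measurable_sets[OF \<alpha> borel_of_open]) (use U in simp)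
    qed
    finally show "emeasure (distr Q (borel_of M.mtopology) \<alpha>) U > 0"
      using emeasure_distr[OF \<alpha> borel_of_open, of U] U by (simp add: Q.emeasure_eq_measure)
  qed
  then have gX: "geom_data X" by (rule geom_data.intro)
  moreover have "K_valued X" by (auto simp: K_valued_def F_def S_def)
  moreover have "dense_features X (\<lambda>k x. x k)"
    unfolding dense_features_def
  proof (intro conjI allI ballI)
    show "pw_adherent (pts X) (feats X) (\<lambda>x. x k)" for k
      by (rule pw_adherent_cong[OF pw_adherent_superset[of "restrict (\<lambda>x. x k) S"]]) (auto simp: F_def)
    fix h assume "h \<in> feats X"
    then obtain k where k: "h = restrict (\<lambda>x. x k) S" by (auto simp: F_def)
    show "pw_adherent (pts X) (range (\<lambda>k x. x k)) h"
      by (rule pw_adherent_cong[OF pw_adherent_superset[of "\<lambda>x. x k"]]) (auto simp: k)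
  qed
  moreover have "\<alpha> \<in> measurable Q (meas X)" using \<alpha> by simp
  moreover have "distr Q (meas X) \<alpha> = meas X" unfolding X by (rule distr_cong) auto
  moreover have "AE \<omega> in Q. \<alpha> \<omega> = \<xi> \<omega>"
    by (rule AE_I'[OF \<open>Bad \<in> null_sets Q\<close>]) (auto simp: \<alpha>_def)
  ultimately show ?thesis using that by blast
qed

text \<open>On a countable state space the transition kernels are elementary conditional
  probabilities, and the Ionescu-Tulcea theorem builds the process from them. The consistency of
  neighbouring marginals makes each prescribed pair law appear at its place.\<close>

lemma markov_chain:
  fixes \<rho> :: "nat \<Rightarrow> (nat \<times> nat) measure"
  assumes pr: "\<And>n. prob_space (\<rho> n)" and sets: "\<And>n. sets (\<rho> n) = UNIV"
    and cons: "\<And>n. distr (\<rho> n) (count_space UNIV) snd = distr (\<rho> (Suc n)) (count_space UNIV) fst"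
  obtains Q :: "(nat \<Rightarrow> nat) measure" where "prob_space Q" "\<And>n. (\<lambda>\<omega>. \<omega> n) \<in> measurable Q (count_space UNIV)"
    "\<And>n. distr Q (count_space UNIV) (\<lambda>\<omega>. (\<omega> n, \<omega> (Suc n))) = \<rho> n"
proof -
  have sp: "space (\<rho> n) = UNIV" for n using sets_eq_imp_space_eq[of "\<rho> n" "count_space UNIV"] sets by simp
  have ms: "f \<in> measurable (\<rho> n) N \<longleftrightarrow> range f \<subseteq> space N" for f :: "nat \<times> nat \<Rightarrow> 'z" and N n
    by (auto simp: measurable_def sets sp)
  let ?c = "count_space (UNIV :: nat set)"
  define w where "w n a = emeasure (\<rho> n) {z. fst z = a}" for n a
  \<comment> \<open>States of weight \<open>0\<close> are given an arbitrary probability, which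
    keeps every \<open>K n a\<close> a probability measure.\<close>
  define K where "K n a = (if w n a = 0 then return ?c 0 else distr (uniform_measure (\<rho> n) {z. fst z = a}) ?c snd)" for n a
  have wfin: "w n a \<noteq> \<infinity>" for n a
    using prob_space.emeasure_le_1[OF pr, of n "{z. fst z = a}"] by (auto simp: w_def top_unique)
  have msu: "f \<in> measurable (uniform_measure (\<rho> n) A) N \<longleftrightarrow> range f \<subseteq> space N" for f :: "nat \<times> nat \<Rightarrow> 'z" and N n A
    by (auto simp: measurable_def sets sp)
  have Kp: "prob_space (K n a)" for n a
    using wfin[of n a] unfolding K_def
    by (auto intro!: prob_space_return prob_space.prob_space_distr prob_space_uniform_measure simp: w_def msu)
  have Ks: "sets (K n a) = UNIV" for n a by (simp add: K_def)
  have Kw: "w n a * emeasure (K n a) {b} = emeasure (\<rho> n) {(a,b)}" for n a b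
  proof (cases "w n a = 0")
    case True
    have "emeasure (\<rho> n) {(a,b)} \<le> w n a" unfolding w_def by (rule emeasure_mono) (auto simp: sets)
    then show ?thesis using True by simp
  next
    case False
    have "emeasure (K n a) {b} = emeasure (uniform_measure (\<rho> n) {z. fst z = a}) (snd -` {b})"
      using False by (simp add: K_def emeasure_distr msu sp)
    also have "\<dots> = emeasure (\<rho> n) ({z. fst z = a} \<inter> snd -` {b}) / w n a"
      by (simp add: emeasure_uniform_measure sets w_def)
    also have "{z. fst z = a} \<inter> snd -` {b} = {(a,b)}" by auto
    finally have "w n a * emeasure (K n a) {b} = emeasure (\<rho> n) {(a,b)} * w n a / w n a"
      by (simp add: ennreal_times_divide mult.commute)
    also have "\<dots> = emeasure (\<rho> n) {(a,b)}"
      using False wfin[of n a] by (simp add: ennreal_mult_divide_eq)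
    finally show ?thesis .
  qed
  define P0 where "P0 = distr (\<rho> 0) ?c fst"
  \<comment> \<open>\<open>P (Suc n)\<close> reads only coordinate \<open>n\<close>, which makes the
    process a Markov chain; \<open>P 0\<close> is the initial law.\<close>
  define P where "P i \<omega> = (if i = 0 then P0 else K (i - 1) (\<omega> (i - 1)))" for i and \<omega> :: "nat \<Rightarrow> nat"
  have PK: "P (Suc n) \<omega> = K n (\<omega> n)" for n \<omega> by (simp add: P_def)
  have P0: "prob_space P0" "sets P0 = UNIV" unfolding P0_def by (auto intro!: prob_space.prob_space_distr pr simp: ms)
  interpret IT: Ionescu_Tulcea P "\<lambda>_. ?c"
  proof (rule Ionescu_Tulcea.intro)
    have sa: "M \<in> space (subprob_algebra ?c)" if "prob_space M" "sets M = UNIV" for M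
      using that prob_space_imp_subprob_space by (auto simp: space_subprob_algebra)
    show "P i \<in> measurable (PiM {0..<i} (\<lambda>_. ?c)) (subprob_algebra ?c)" for i
    proof (cases i)
      case 0
      then show ?thesis using sa[OF P0] by (simp add: P_def[abs_def])
    next
      case (Suc j)
      have "(\<lambda>\<omega>. \<omega> j) \<in> measurable (PiM {0..<i} (\<lambda>_. ?c)) ?c" using Suc by (intro measurable_component_singleton) auto
      moreover have "K j \<in> measurable ?c (subprob_algebra ?c)" using sa[OF Kp Ks] by simp
      ultimately have "(\<lambda>\<omega>. K j (\<omega> j)) \<in> measurable (PiM {0..<i} (\<lambda>_. ?c)) (subprob_algebra ?c)"
        by (rule measurable_compose)
      then show ?thesis by (simp add: P_def[abs_def] Suc)
    qed
    show "prob_space (P i x)" if "x \<in> space (PiM {0..<i} (\<lambda>_. ?c))" for i x using P0 Kp by (simp add: P_def)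
  qed
  let ?u = "\<lambda>x::nat. undefined :: nat"
  let ?\<mu> = "\<lambda>n. IT.C 0 n ?u"
  let ?M = "\<lambda>n. PiM {0..<n} (\<lambda>_::nat. ?c)"
  have u: "?u \<in> space (PiM {0..<0} (\<lambda>_. ?c))" by (simp add: space_PiM)
  have s\<mu>: "sets (?\<mu> n) = sets (?M n)" for n using IT.sets_C[OF u] by simp
  have sp\<mu>: "space (?\<mu> n) = space (?M n)" for n using IT.space_C[OF u] by simp
  have comp: "(\<lambda>\<omega>. \<omega> j) \<in> measurable (?M n) ?c" if "j < n" for j n
    using that by (intro measurable_component_singleton) auto
  have set1: "{\<omega>\<in>space (?M n). \<omega> j = a} \<in> sets (?M n)" if "j < n" for j n a
    using measurable_sets[OF comp[OF that], of "{a}"] by (simp add: vimage_def Int_def conj_commute)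
  have set2: "{\<omega>\<in>space (?M (Suc (Suc n))). \<omega> n = a \<and> \<omega> (Suc n) = b} \<in> sets (?M (Suc (Suc n)))" for n a b
  proof -
    have "{\<omega>\<in>space (?M (Suc (Suc n))). \<omega> n = a \<and> \<omega> (Suc n) = b} =
      {\<omega>\<in>space (?M (Suc (Suc n))). \<omega> n = a} \<inter> {\<omega>\<in>space (?M (Suc (Suc n))). \<omega> (Suc n) = b}" by auto
    then show ?thesis using set1[of n "Suc (Suc n)" a] set1[of "Suc n" "Suc (Suc n)" b] by auto
  qed
  have step: "emeasure (?\<mu> (Suc (Suc n))) {\<omega>\<in>space (?M (Suc (Suc n))). \<omega> n = a \<and> \<omega> (Suc n) = b} =
     emeasure (?\<mu> (Suc n)) {\<omega>\<in>space (?M (Suc n)). \<omega> n = a} * emeasure (K n a) {b}" for n a b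
  proof -
    let ?A = "{\<omega>\<in>space (?M (Suc (Suc n))). \<omega> n = a \<and> \<omega> (Suc n) = b}"
    have "emeasure (?\<mu> (Suc (Suc n))) ?A = (\<integral>\<^sup>+ \<omega>. emeasure (IT.eP (Suc n) \<omega>) ?A \<partial>?\<mu> (Suc n))"
    proof -
      have "?\<mu> (Suc (Suc n)) = ?\<mu> (Suc n) \<bind> IT.eP (Suc n)" by simp
      moreover have "emeasure (?\<mu> (Suc n) \<bind> IT.eP (Suc n)) ?A = (\<integral>\<^sup>+ \<omega>. emeasure (IT.eP (Suc n) \<omega>) ?A \<partial>?\<mu> (Suc n))"
      proof (rule emeasure_bind[OF _ _ set2])
        show "space (?\<mu> (Suc n)) \<noteq> {}" using prob_space.not_empty[OF IT.prob_space_C[OF u, of "Suc n"]] .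
        show "IT.eP (Suc n) \<in> measurable (?\<mu> (Suc n)) (subprob_algebra (?M (Suc (Suc n))))"
          unfolding measurable_cong_sets[OF s\<mu>[of "Suc n"] refl] by (rule IT.measurable_eP)
      qed
      ultimately show ?thesis by (simp only:)
    qed
    also have "\<dots> = (\<integral>\<^sup>+ \<omega>. emeasure (K n a) {b} * indicator {\<omega>\<in>space (?M (Suc n)). \<omega> n = a} \<omega> \<partial>?\<mu> (Suc n))"
    proof (rule nn_integral_cong)
      fix \<omega> assume "\<omega> \<in> space (?\<mu> (Suc n))"
      then have w: "\<omega> \<in> space (?M (Suc n))" by (simp only: sp\<mu>)
      have "emeasure (IT.eP (Suc n) \<omega>) ?A = emeasure (P (Suc n) \<omega>) ((fun_upd \<omega> (Suc n)) -` ?A \<inter> space ?c)"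
        by (rule IT.emeasure_eP[OF w set2])
      also have "(fun_upd \<omega> (Suc n)) -` ?A \<inter> space ?c = (if \<omega> n = a then {b} else {})"
      proof -
        have "fun_upd \<omega> (Suc n) x \<in> space (?M (Suc (Suc n)))" for x
          using w by (auto simp: space_PiM PiE_iff extensional_def)
        then show ?thesis by auto
      qed
      finally show "emeasure (IT.eP (Suc n) \<omega>) ?A = emeasure (K n a) {b} * indicator {\<omega>\<in>space (?M (Suc n)). \<omega> n = a} \<omega>"
        using w by (cases "\<omega> n = a") (simp_all add: PK)
    qed
    also have "\<dots> = emeasure (K n a) {b} * emeasure (?\<mu> (Suc n)) {\<omega>\<in>space (?M (Suc n)). \<omega> n = a}"
      by (rule nn_integral_cmult_indicator) (simp only: s\<mu> set1 lessI)
    finally show ?thesis by (simp only: mult.commute)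
  qed
  have ext: "?\<mu> (Suc n) = distr (?\<mu> (Suc (Suc n))) (?M (Suc n)) (\<lambda>x. restrict x {0..<Suc n})" for n
    using IT.distr_C[OF _ u, of "Suc n" "Suc (Suc n)"] by simp
  \<comment> \<open>The nth coordinate has the first marginal of \<open>\<rho> n\<close>. In the
    induction step, summation over the previous state gives the second marginal of
    \<open>\<rho> n\<close>, and \<open>cons\<close> identifies it with the first marginal of
    \<open>\<rho> (Suc n)\<close>.\<close>
  have marg: "emeasure (?\<mu> (Suc n)) {\<omega>\<in>space (?M (Suc n)). \<omega> n = a} = w n a" for n a
  proof (induction n arbitrary: a)
    case 0
    have "?\<mu> (Suc 0) = IT.eP 0 ?u"
      using bind_return[OF IT.measurable_eP[of 0] u] by simp
    then have "emeasure (?\<mu> (Suc 0)) {\<omega>\<in>space (?M (Suc 0)). \<omega> 0 = a} = emeasure (P 0 ?u) ((fun_upd ?u 0) -` {\<omega>\<in>space (?M (Suc 0)). \<omega> 0 = a} \<inter> space ?c)"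
      using IT.emeasure_eP[OF u set1[of 0 "Suc 0" a]] by simp
    also have "(fun_upd ?u 0) -` {\<omega>\<in>space (?M (Suc 0)). \<omega> 0 = a} \<inter> space ?c = {a}"
      by (auto simp: space_PiM PiE_iff extensional_def)
    also have "emeasure (P 0 ?u) {a} = w 0 a"
      by (simp add: P_def P0_def emeasure_distr ms w_def sp vimage_def)
    finally show ?case .
  next
    case (Suc n)
    let ?B = "\<lambda>b. {\<omega>\<in>space (?M (Suc (Suc n))). \<omega> n = b \<and> \<omega> (Suc n) = a}"
    have "{\<omega>\<in>space (?M (Suc (Suc n))). \<omega> (Suc n) = a} = (\<Union>b. ?B b)" by auto
    then have "emeasure (?\<mu> (Suc (Suc n))) {\<omega>\<in>space (?M (Suc (Suc n))). \<omega> (Suc n) = a} = (\<Sum>b. emeasure (?\<mu> (Suc (Suc n))) (?B b))"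
      by (simp only:) (rule suminf_emeasure[symmetric]; auto simp: disjoint_family_on_def s\<mu> set2 simp del: IT.C.simps)
    also have "\<dots> = (\<Sum>b. emeasure (\<rho> n) {(b,a)})"
      unfolding step Suc.IH Kw ..
    also have "\<dots> = emeasure (\<rho> n) (\<Union>b. {(b,a)})"
      by (rule suminf_emeasure) (auto simp: disjoint_family_on_def sets)
    also have "(\<Union>b. {(b,a)}) = snd -` {a} \<inter> space (\<rho> n)" by (auto simp: sp)
    also have "emeasure (\<rho> n) \<dots> = emeasure (distr (\<rho> n) ?c snd) {a}"
      by (rule emeasure_distr[symmetric]) (auto simp: ms)
    also have "\<dots> = w (Suc n) a"
      unfolding cons by (simp add: emeasure_distr ms w_def sp vimage_def)
    finally show ?case .
  qed
  define Q where "Q = IT.PF.lim"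
  have sQ: "sets Q = sets (PiM UNIV (\<lambda>_. ?c))" by (simp add: Q_def)
  have spQ: "space Q = UNIV" using sets_eq_imp_space_eq[OF sQ] by (simp add: space_PiM)
  have cQ: "(\<lambda>\<omega>. \<omega> n) \<in> measurable Q ?c" for n
    unfolding measurable_cong_sets[OF sQ refl] by (rule measurable_component_singleton) simp
  have "prob_space Q"
  proof
    have "prod_emb UNIV (\<lambda>_::nat. ?c) {} (space (PiM {} (\<lambda>_::nat. ?c))) = UNIV"
      by (auto simp: prod_emb_def space_PiM restrict_def)
    then have "emeasure Q (space Q) = emeasure Q (prod_emb UNIV (\<lambda>_::nat. ?c) {} (space (PiM {} (\<lambda>_::nat. ?c))))"
      by (simp only: spQ)
    also have "\<dots> = emeasure (IT.CI {}) (space (PiM {} (\<lambda>_. ?c)))"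
      unfolding Q_def by (rule IT.lim) auto
    also have "\<dots> = 1"
      using prob_space.emeasure_space_1[OF IT.PF.prob_space_P[of "{}"]] by (simp add: IT.PF.space_P)
    finally show "emeasure Q (space Q) = 1" .
  qed
  moreover have "distr Q (count_space UNIV) (\<lambda>\<omega>. (\<omega> n, \<omega> (Suc n))) = \<rho> n" for n
  proof (rule measure_eqI_countable[of _ UNIV])
    have m2: "(\<lambda>\<omega>. (\<omega> n, \<omega> (Suc n))) \<in> measurable Q (count_space UNIV)"
      using measurable_Pair[OF cQ[of n] cQ[of "Suc n"]] by (simp add: pair_measure_countable)
    fix z :: "nat \<times> nat" assume "z \<in> UNIV"
    obtain a b where z: "z = (a, b)" by (cases z)
    let ?A = "{\<omega>\<in>space (?M (Suc (Suc n))). \<omega> n = a \<and> \<omega> (Suc n) = b}"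
    have "emeasure (distr Q (count_space UNIV) (\<lambda>\<omega>. (\<omega> n, \<omega> (Suc n)))) {z} = emeasure Q {\<omega>. \<omega> n = a \<and> \<omega> (Suc n) = b}"
      by (subst emeasure_distr[OF m2]) (auto simp: z spQ intro!: arg_cong[where f = "emeasure Q"])
    also have "{\<omega>. \<omega> n = a \<and> \<omega> (Suc n) = b} = prod_emb UNIV (\<lambda>_. ?c) {0..<Suc (Suc n)} ?A"
      by (auto simp: prod_emb_def space_PiM)
    also have "emeasure Q \<dots> = emeasure (IT.CI {0..<Suc (Suc n)}) ?A"
      unfolding Q_def by (rule IT.lim[OF _ set2]) simp
    also have "\<dots> = emeasure (?\<mu> (Suc (Suc n))) (prod_emb {0..<Suc (Suc n)} (\<lambda>_. ?c) {0..<Suc (Suc n)} ?A)"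
      by (rule IT.emeasure_CI[OF subset_refl set2])
    also have "prod_emb {0..<Suc (Suc n)} (\<lambda>_. ?c) {0..<Suc (Suc n)} ?A = ?A"
      by (rule prod_emb_id) (auto simp: space_PiM)
    also have "emeasure (?\<mu> (Suc (Suc n))) ?A = emeasure (\<rho> n) {z}"
      unfolding step marg Kw z ..
    finally show "emeasure (distr Q (count_space UNIV) (\<lambda>\<omega>. (\<omega> n, \<omega> (Suc n)))) {z} = emeasure (\<rho> n) {z}" .
  qed (auto simp: sets)
  ultimately show ?thesis using that cQ by blast
qed


section \<open>Limits of Cauchy sequences\<close>

text \<open>Partners are chosen forwards from \<open>m\<close> by the recursion \<open>u\<close> and
  backwards by \<open>v\<close>. Chains through prescribed elements of every level are needed, and a
  chain built forwards from level 0 could miss most features of later levels.\<close>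

lemma two_sided_chain:
  assumes up: "\<And>n f. f \<in> F n \<Longrightarrow> \<exists>g\<in>F (Suc n). R n f g"
    and down: "\<And>n g. g \<in> F (Suc n) \<Longrightarrow> \<exists>f\<in>F n. R n f g" and f: "f \<in> F m"
  shows "\<exists>c. c m = f \<and> (\<forall>n::nat. c n \<in> F n \<and> R n (c n) (c (Suc n)))"
proof -
  have "\<forall>n f. \<exists>g. f \<in> F n \<longrightarrow> g \<in> F (Suc n) \<and> R n f g" using up by blast
  then obtain U where U: "\<And>n f. f \<in> F n \<Longrightarrow> U n f \<in> F (Suc n) \<and> R n f (U n f)" by metis
  have "\<forall>n g. \<exists>f. g \<in> F (Suc n) \<longrightarrow> f \<in> F n \<and> R n f g" using down by blast
  then obtain D where D: "\<And>n g. g \<in> F (Suc n) \<Longrightarrow> D n g \<in> F n \<and> R n (D n g) g" by metis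
  define u where "u = rec_nat f (\<lambda>i. U (m + i))"
  define v where "v = rec_nat f (\<lambda>i. D (m - Suc i))"
  have u: "u 0 = f" "\<And>i. u (Suc i) = U (m + i) (u i)" by (auto simp: u_def)
  have v: "v 0 = f" "\<And>i. v (Suc i) = D (m - Suc i) (v i)" by (auto simp: v_def)
  have uF: "u i \<in> F (m + i)" for i by (induction i) (use f U in \<open>auto simp: u\<close>)
  have vF: "i \<le> m \<Longrightarrow> v i \<in> F (m - i)" for i
  proof (induction i)
    case (Suc i)
    then have "v i \<in> F (Suc (m - Suc i))" by (simp add: Suc_diff_Suc)
    then show ?case using D by (simp add: v)
  qed (simp add: v f)
  define c where "c n = (if m \<le> n then u (n - m) else v (m - n))" for n
  have "c n \<in> F n \<and> R n (c n) (c (Suc n))" for n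
  proof (cases "m \<le> n")
    case True
    then show ?thesis using uF[of "n - m"] U[OF uF[of "n - m"]] u(2)[of "n - m"]
      by (simp add: c_def Suc_diff_le)
  next
    case False
    then have n: "m - n = Suc (m - Suc n)" "m - Suc (m - Suc n) = n" by auto
    have cS: "c (Suc n) = v (m - Suc n)" using False by (auto simp: c_def u v not_le le_Suc_eq)
    have "v (m - Suc n) \<in> F (Suc n)" using vF[of "m - Suc n"] False by simp
    moreover have "c n = D n (v (m - Suc n))" using False v(2)[of "m - Suc n"] n by (simp add: c_def)
    ultimately show ?thesis using D unfolding cS by simp
  qed
  moreover have "c m = f" by (simp add: c_def u)
  ultimately show ?thesis by blast
qed

text \<open>The limit is assembled from the values of the feature chains at representatives of
  random cells. With box distances and cell radii of order 2^-n all errors and exceptional masses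
  sum geometrically.\<close>

theorem cauchy_limit:
  fixes X :: "nat \<Rightarrow> 'a data_set"
  assumes g: "\<And>n. geom_data (X n)" and K: "\<And>n. K_valued (X n)"
    and box: "\<And>n. box_data (X n) (X (Suc n)) < ennreal ((1/2)^n)"
  obtains Y :: "(nat \<Rightarrow> real) data_set" where "geom_data Y" "K_valued Y" "\<And>n. box_data (X n) Y \<le> ennreal (10 * (1/2)^n)"
proof -
  define \<epsilon> :: "nat \<Rightarrow> real" where "\<epsilon> n = (1/2)^n" for n
  have \<epsilon>: "\<epsilon> n > 0" "\<epsilon> (Suc n) = \<epsilon> n / 2" for n by (auto simp: \<epsilon>_def)
  have "\<exists>\<pi> S. \<pi> \<in> couplings (X n) (X (Suc n)) \<and> closedin (prod_top (X n) (X (Suc n))) S \<and> measure \<pi> S \<ge> 1 - \<epsilon> n \<and>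
    (\<forall>f\<in>feats (X n). \<exists>g\<in>feats (X (Suc n)). close_on S (\<epsilon> n / 2) f g) \<and>
    (\<forall>g\<in>feats (X (Suc n)). \<exists>f\<in>feats (X n). close_on S (\<epsilon> n / 2) f g)" for n
  proof -
    have "box_data (X n) (X (Suc n)) < ennreal (\<epsilon> n)" using box[of n] by (simp add: \<epsilon>_def)
    then show ?thesis by (rule box_dataE) blast
  qed
  then obtain \<pi> S where \<pi>: "\<And>n. \<pi> n \<in> couplings (X n) (X (Suc n))"
    and S: "\<And>n. closedin (prod_top (X n) (X (Suc n))) (S n)"
    and mS: "\<And>n. measure (\<pi> n) (S n) \<ge> 1 - \<epsilon> n"
    and up: "\<And>n. \<forall>f\<in>feats (X n). \<exists>g\<in>feats (X (Suc n)). close_on (S n) (\<epsilon> n / 2) f g"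
    and down: "\<And>n. \<forall>g\<in>feats (X (Suc n)). \<exists>f\<in>feats (X n). close_on (S n) (\<epsilon> n / 2) f g"
    by (metis (no_types, lifting))
  have "\<exists>f. dense_features (X m) f \<and> (\<forall>k. f k \<in> feats (X m))" for m
    using geom_data.dense_features_exists[OF g[of m]] by metis
  then obtain f0 where f0: "\<And>m. dense_features (X m) (f0 m)" "\<And>m k. f0 m k \<in> feats (X m)" by metis
  have "\<exists>c. c m = f0 m k \<and> (\<forall>n. c n \<in> feats (X n) \<and> (close_on (S n) (\<epsilon> n / 2) (c n) (c (Suc n))))" for m k
    by (rule two_sided_chain[where R = "\<lambda>n f g. close_on (S n) (\<epsilon> n / 2) f g"])
      (use up down f0(2) in auto)
  then obtain ch where ch: "\<And>m k. ch m k m = f0 m k" "\<And>m k n. ch m k n \<in> feats (X n)"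
    "\<And>m k n x y. (x,y) \<in> S n \<Longrightarrow> \<bar>ch m k n x - ch m k (Suc n) y\<bar> \<le> \<epsilon> n / 2" by metis
  \<comment> \<open>One index codes the pair (m, k), naming the chain through the kth dense feature
    of level m. At level n the chains with m = n already form a dense sequence.\<close>
  define cc where "cc n i = (case prod_decode i of (m, k) \<Rightarrow> ch m k n)" for n i
  have ccF: "cc n i \<in> feats (X n)" for n i using ch(2) by (simp add: cc_def split: prod.splits)
  have ccS: "\<bar>cc n i x - cc (Suc n) i y\<bar> \<le> \<epsilon> n / 2" if "(x,y) \<in> S n" for n i x y
    using ch(3)[OF that] by (simp add: cc_def split: prod.splits)
  have pcc: "dense_features (X n) (cc n)" for n
  proof (rule dense_features_superseq[OF f0(1) _ ccF])
    have "f0 n k = cc n (prod_encode (n, k))" for k by (simp add: cc_def ch(1))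
    then show "range (f0 n) \<subseteq> range (cc n)" by auto
  qed
  have "\<exists>(p :: 'a \<Rightarrow> nat) s. p \<in> measurable (meas (X n)) (count_space UNIV) \<and> (\<forall>i. s i \<in> pts (X n)) \<and>
    (\<forall>x\<in>pts (X n). data_dist (X n) (s (p x)) x \<le> \<epsilon> n)" for n
    using geom_data.cells[OF g \<epsilon>(1), of n n] by metis
  then obtain p :: "nat \<Rightarrow> 'a \<Rightarrow> nat" and s where p: "\<And>n. p n \<in> measurable (meas (X n)) (count_space UNIV)"
    "\<And>n i. s n i \<in> pts (X n)" "\<And>n x. x \<in> pts (X n) \<Longrightarrow> data_dist (X n) (s n (p n x)) x \<le> \<epsilon> n" by metis
  note cp = couplingD[OF g g \<pi>]
  \<comment> \<open>The joint law of the cells at consecutive levels. Its second marginal and the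
    first marginal of its successor are both the law of the cells of
    \<open>X (Suc n)\<close>.\<close>
  define \<rho> where "\<rho> n = distr (\<pi> n) (count_space UNIV) (\<lambda>z. (p n (fst z), p (Suc n) (snd z)))" for n
  have pm: "(\<lambda>z. (p n (fst z), p (Suc n) (snd z))) \<in> measurable (\<pi> n) (count_space UNIV)" for n
    using measurable_Pair[OF measurable_compose[OF cp(2) p(1)] measurable_compose[OF cp(3) p(1)]]
    by (simp add: pair_measure_countable)
  have \<rho>p: "prob_space (\<rho> n)" for n unfolding \<rho>_def by (rule prob_space.prob_space_distr[OF cp(1) pm])
  have \<rho>s: "sets (\<rho> n) = UNIV" for n by (simp add: \<rho>_def)
  have \<rho>1: "distr (\<rho> n) (count_space UNIV) fst = distr (meas (X n)) (count_space UNIV) (p n)" for n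
    unfolding \<rho>_def by (subst distr_distr[OF _ pm]) (simp_all add: o_def distr_comp_marginal[OF cp(2,4) p(1)])
  have \<rho>2: "distr (\<rho> n) (count_space UNIV) snd = distr (meas (X (Suc n))) (count_space UNIV) (p (Suc n))" for n
    unfolding \<rho>_def by (subst distr_distr[OF _ pm]) (simp_all add: o_def distr_comp_marginal[OF cp(3,5) p(1)])
  obtain Q :: "(nat \<Rightarrow> nat) measure" where Q: "prob_space Q" "\<And>n. (\<lambda>\<omega>. \<omega> n) \<in> measurable Q (count_space UNIV)"
    "\<And>n. distr Q (count_space UNIV) (\<lambda>\<omega>. (\<omega> n, \<omega> (Suc n))) = \<rho> n"
    by (rule markov_chain[of \<rho>, OF \<rho>p \<rho>s]) (simp add: \<rho>1 \<rho>2, blast)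
  interpret Q: prob_space Q by fact
  define v where "v n i k = cc n k (s n i)" for n i k
  \<comment> \<open>The bound adds the cell radius \<epsilon> n, the matching error \<epsilon> n / 2
    and the next cell radius \<epsilon> (n+1) = \<epsilon> n / 2.\<close>
  define E where "E n = {(i,j). \<forall>k. \<bar>v n i k - v (Suc n) j k\<bar> \<le> 2 * \<epsilon> n}" for n
  have Qm2: "(\<lambda>\<omega>. (\<omega> n, \<omega> (Suc n))) \<in> measurable Q (count_space UNIV)" for n
    using measurable_Pair[OF Q(2)[of n] Q(2)[of "Suc n"]] by (simp add: pair_measure_countable)
  \<comment> \<open>The bad events are summable; off their tails the cell representatives converge uniformly in \<open>k\<close>.\<close>
  define B where "B n = {\<omega>\<in>space Q. (\<omega> n, \<omega> (Suc n)) \<notin> E n}" for n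
  have Bm: "B n \<in> sets Q" for n
    using measurable_sets[OF Qm2[of n], of "- E n"] by (simp add: B_def vimage_def Int_def conj_commute)
  have B: "Q.prob (B n) \<le> \<epsilon> n" for n
  proof -
    interpret \<pi>: prob_space "\<pi> n" by (rule cp)
    have "Q.prob ((\<lambda>\<omega>. (\<omega> n, \<omega> (Suc n))) -` E n \<inter> space Q) = measure (\<rho> n) (E n)"
      unfolding Q(3)[symmetric] by (rule measure_distr[OF Qm2, symmetric]) simp
    also have "\<dots> = \<pi>.prob ((\<lambda>z. (p n (fst z), p (Suc n) (snd z))) -` E n \<inter> space (\<pi> n))"
      unfolding \<rho>_def by (rule measure_distr[OF pm]) simp
    also have "\<dots> \<ge> \<pi>.prob (S n)"
    proof (rule \<pi>.finite_measure_mono)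
      show "(\<lambda>z. (p n (fst z), p (Suc n) (snd z))) -` E n \<inter> space (\<pi> n) \<in> sets (\<pi> n)"
        by (rule measurable_sets[OF pm]) simp
      show "S n \<subseteq> (\<lambda>z. (p n (fst z), p (Suc n) (snd z))) -` E n \<inter> space (\<pi> n)"
      proof
        fix z assume z: "z \<in> S n"
        then have zs: "z \<in> space (\<pi> n)" using sets.sets_into_space[OF cp(7)[OF S]] by blast
        obtain x y where xy: "z = (x, y)" by (cases z)
        have x: "x \<in> pts (X n)" and y: "y \<in> pts (X (Suc n))" using zs by (auto simp: cp(6) xy)
        have "\<bar>v n (p n x) k - v (Suc n) (p (Suc n) y) k\<bar> \<le> 2 * \<epsilon> n" for k
          using geom_data.dense_features_lip[OF g pcc p(2) x, of k "p n x"] geom_data.dense_features_lip[OF g pcc p(2) y, of k "p (Suc n) y"]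
            p(3)[OF x] p(3)[OF y] ccS[of x y n k] z \<epsilon>[of n] unfolding v_def xy by argo
        then show "z \<in> (\<lambda>z. (p n (fst z), p (Suc n) (snd z))) -` E n \<inter> space (\<pi> n)"
          using zs by (simp add: E_def xy)
      qed
    qed
    finally have "1 - \<epsilon> n \<le> Q.prob ((\<lambda>\<omega>. (\<omega> n, \<omega> (Suc n))) -` E n \<inter> space Q)" using mS[of n] by linarith
    moreover have "B n = space Q - ((\<lambda>\<omega>. (\<omega> n, \<omega> (Suc n))) -` E n \<inter> space Q)" by (auto simp: B_def)
    moreover have "(\<lambda>\<omega>. (\<omega> n, \<omega> (Suc n))) -` E n \<inter> space Q \<in> sets Q" by (rule measurable_sets[OF Qm2]) simp
    ultimately show ?thesis using Q.prob_compl by simp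
  qed
  \<comment> \<open>No bad transition from level n on; the geometric tail of the bad probabilities
    is at most 2 * \<epsilon> n.\<close>
  define G where "G n = space Q - (\<Union>i. B (n + i))" for n
  have Gm: "G n \<in> sets Q" for n unfolding G_def using Bm by auto
  have G: "Q.prob (G n) \<ge> 1 - 2 * \<epsilon> n" for n
  proof -
    have sm: "summable (\<lambda>i. \<epsilon> n * (1/2)^i)" by (intro summable_mult summable_geometric) simp
    have e: "\<epsilon> (n + i) = \<epsilon> n * (1/2)^i" for i by (simp add: \<epsilon>_def power_add)
    have le: "Q.prob (B (n + i)) \<le> \<epsilon> n * (1/2)^i" for i using B[of "n + i"] by (simp only: e)
    have sB: "summable (\<lambda>i. Q.prob (B (n + i)))"
      by (rule summable_comparison_test'[OF sm]) (use le in simp)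
    have "Q.prob (\<Union>i. B (n + i)) \<le> (\<Sum>i. Q.prob (B (n + i)))"
      by (rule Q.finite_measure_subadditive_countably[OF _ sB]) (use Bm in auto)
    also have "\<dots> \<le> (\<Sum>i. \<epsilon> n * (1/2)^i)" by (rule suminf_le[OF le sB sm])
    also have "\<dots> = 2 * \<epsilon> n" by (subst suminf_mult) (auto simp: suminf_geometric)
    finally have "Q.prob (\<Union>i. B (n + i)) \<le> 2 * \<epsilon> n" .
    moreover have "(\<Union>i. B (n + i)) \<in> sets Q" using Bm by auto
    ultimately show ?thesis unfolding G_def using Q.prob_compl by simp
  qed
  have vK: "v n i k \<in> {-1/2..1/2}" for n i k
    using K[of n] ccF p(2) by (auto simp: K_valued_def v_def)
  \<comment> \<open>The increments 2 * \<epsilon> i telescope, because 2 * \<epsilon> i = 4 *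
    \<epsilon> i - 4 * \<epsilon> (i+1).\<close>
  have tail: "\<bar>v m (\<omega> m) k - v (m + j) (\<omega> (m + j)) k\<bar> \<le> 4 * \<epsilon> m - 4 * \<epsilon> (m + j)"
    if "\<omega> \<in> G n" "n \<le> m" for \<omega> n m j k
  proof (induction j)
    case (Suc j)
    have "\<omega> \<notin> B (n + (m + j - n))" using that unfolding G_def by blast
    then have "\<omega> \<notin> B (m + j)" using that by simp
    then have "\<bar>v (m+j) (\<omega> (m+j)) k - v (Suc (m+j)) (\<omega> (Suc (m+j))) k\<bar> \<le> 2 * \<epsilon> (m+j)"
      using that by (auto simp: B_def E_def G_def)
    then show ?case using Suc \<epsilon>(2)[of "m+j"] unfolding add_Suc_right by argo
  qed simp
  have tail': "\<bar>v m (\<omega> m) k - v m' (\<omega> m') k\<bar> \<le> 4 * \<epsilon> m" if "\<omega> \<in> G n" "n \<le> m" "m \<le> m'" for \<omega> n m m' k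
    using tail[OF that(1,2), of k "m' - m"] that \<epsilon>(1)[of "m'"] by simp
  have \<epsilon>0: "\<epsilon> \<longlonglongrightarrow> 0" unfolding \<epsilon>_def[abs_def] by (rule LIMSEQ_realpow_zero) auto
  have small: "\<exists>m\<ge>n. 4 * \<epsilon> m < r" if "r > 0" for r n
  proof -
    have "r / 4 > 0" using that by simp
    from order_tendstoD(2)[OF \<epsilon>0 this] obtain N where N: "\<And>m. m \<ge> N \<Longrightarrow> \<epsilon> m < r/4"
      unfolding eventually_sequentially by blast
    show ?thesis using N[of "max n N"] by (intro exI[of _ "max n N"]) auto
  qed
  have conv: "convergent (\<lambda>m. v m (\<omega> m) k)" if w: "\<omega> \<in> G n" for \<omega> n k
  proof (rule Cauchy_convergent, rule metric_CauchyI)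
    fix r :: real assume "r > 0"
    then obtain m where m: "m \<ge> n" "4 * \<epsilon> m < r / 2" using small[of "r/2" n] by auto
    have "dist (v i (\<omega> i) k) (v j (\<omega> j) k) < r" if "i \<ge> m" "j \<ge> m" for i j
      using tail'[OF w m(1) that(1), of k] tail'[OF w m(1) that(2), of k] m(2) unfolding dist_real_def by argo
    then show "\<exists>M. \<forall>i\<ge>M. \<forall>j\<ge>M. dist (v i (\<omega> i) k) (v j (\<omega> j) k) < r" by blast
  qed
  \<comment> \<open>The default is one of the representative sequences, so that the approximation by
    \<open>C\<close> below holds at every sample point and not just almost surely.\<close>
  define \<xi> where "\<xi> \<omega> k = (if \<omega> \<in> (\<Union>n. G n) then lim (\<lambda>m. v m (\<omega> m) k) else v 0 0 k)" for \<omega> k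
  have \<xi>l: "(\<lambda>m. v m (\<omega> m) k) \<longlonglongrightarrow> \<xi> \<omega> k" if "\<omega> \<in> G n" for \<omega> n k
    using conv[OF that, of k] that unfolding \<xi>_def convergent_LIMSEQ_iff by auto
  have \<xi>v: "\<bar>v m (\<omega> m) k - \<xi> \<omega> k\<bar> \<le> 4 * \<epsilon> m" if "\<omega> \<in> G n" "n \<le> m" for \<omega> n m k
  proof (rule LIMSEQ_le_const2)
    show "(\<lambda>m'. \<bar>v m (\<omega> m) k - v m' (\<omega> m') k\<bar>) \<longlonglongrightarrow> \<bar>v m (\<omega> m) k - \<xi> \<omega> k\<bar>"
      by (intro tendsto_intros \<xi>l[OF that(1)])
    show "\<exists>N. \<forall>m'\<ge>N. \<bar>v m (\<omega> m) k - v m' (\<omega> m') k\<bar> \<le> 4 * \<epsilon> m" using tail'[OF that] by blast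
  qed
  have \<xi>K: "\<xi> \<omega> k \<in> {-1/2..1/2}" for \<omega> k
  proof (cases "\<omega> \<in> (\<Union>n. G n)")
    case True
    then obtain n where "\<omega> \<in> G n" by blast
    show ?thesis by (rule closed_sequentially[OF closed_atLeastAtMost _ \<xi>l[OF \<open>\<omega> \<in> G n\<close>]]) (rule vK)
  qed (use vK[of 0 0 k] in \<open>simp add: \<xi>_def\<close>)
  have vm: "(\<lambda>\<omega>. v m (\<omega> m) k) \<in> borel_measurable Q" for m k
    by (rule measurable_compose[OF Q(2)]) simp
  have \<xi>m: "\<xi> \<in> measurable Q seq_borel"
  proof (rule measurable_PiM_single')
    fix k
    have "(\<lambda>\<omega>. lim (\<lambda>m. if \<omega> \<in> (\<Union>n. G n) then v m (\<omega> m) k else v 0 0 k)) \<in> borel_measurable Q"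
      using vm Gm by (intro borel_measurable_lim_metric measurable_If_set) auto
    also have "(\<lambda>\<omega>. lim (\<lambda>m. if \<omega> \<in> (\<Union>n. G n) then v m (\<omega> m) k else v 0 0 k)) = (\<lambda>\<omega>. \<xi> \<omega> k)"
      by (auto simp: \<xi>_def)
    finally show "(\<lambda>\<omega>. \<xi> \<omega> k) \<in> borel_measurable Q" .
  qed (simp add: space_PiM)
  \<comment> \<open>The representatives are countably many and approximate the values of \<xi>
    uniformly in the feature index, which supplies the separability demanded by
    \<open>realization\<close>.\<close>
  define C where "C = range (\<lambda>(n, i). v n i)"
  have Cc: "countable C" unfolding C_def by simp
  have Cd: "\<exists>q\<in>C. \<forall>k. \<bar>\<xi> \<omega> k - q k\<bar> \<le> r" if "r > 0" for \<omega> r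
  proof (cases "\<omega> \<in> (\<Union>n. G n)")
    case True
    then obtain n where n: "\<omega> \<in> G n" by blast
    obtain m where m: "m \<ge> n" "4 * \<epsilon> m < r" using small[OF \<open>r > 0\<close>] by blast
    have "\<bar>\<xi> \<omega> k - v m (\<omega> m) k\<bar> \<le> r" for k using \<xi>v[OF n m(1), of k] m(2) by argo
    moreover have "v m (\<omega> m) \<in> C" unfolding C_def by (rule range_eqI[of _ _ "(m, \<omega> m)"]) simp
    ultimately show ?thesis by blast
  next
    case False
    then have "\<xi> \<omega> = v 0 0" by (auto simp: \<xi>_def)
    moreover have "v 0 0 \<in> C" unfolding C_def by (rule range_eqI[of _ _ "(0, 0)"]) simp
    ultimately show ?thesis using that by (intro bexI[of _ "v 0 0"]) auto
  qed
  obtain Y :: "(nat \<Rightarrow> real) data_set" and \<alpha> where Y: "geom_data Y" "K_valued Y" "dense_features Y (\<lambda>k x. x k)"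
    "\<alpha> \<in> measurable Q (meas Y)" "distr Q (meas Y) \<alpha> = meas Y" "AE \<omega> in Q. \<alpha> \<omega> = \<xi> \<omega>"
    by (rule realization[OF Q(1) \<xi>m \<xi>K Cc Cd])
  have "box_data (X n) Y \<le> ennreal (10 * (1/2)^n)" for n
  proof -
    interpret Xn: geom_data "X n" by (rule g)
    interpret Y: geom_data Y by (rule Y)
    have eq: "distr (meas (X n)) (count_space UNIV) (p n) = distr Q (count_space UNIV) (\<lambda>\<omega>. \<omega> n)"
    proof -
      have "distr (distr Q (count_space UNIV) (\<lambda>\<omega>. (\<omega> n, \<omega> (Suc n)))) (count_space UNIV) fst = distr Q (count_space UNIV) (\<lambda>\<omega>. \<omega> n)"
        by (subst distr_distr[OF _ Qm2]) (simp_all add: o_def)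
      then show ?thesis unfolding Q(3) \<rho>1 .
    qed
    \<comment> \<open>Gluing along the cells of level n couples a point of \<open>X n\<close> with a
      chain whose nth state is the cell of that point.\<close>
    obtain N where N: "prob_space N" "sets N = sets (meas (X n) \<Otimes>\<^sub>M Q)" "distr N (meas (X n)) fst = meas (X n)"
      "distr N Q snd = Q" "AE z in N. p n (fst z) = (snd z) n"
      by (rule glue[OF Xn.P.prob_space_axioms Q(1) p(1) Q(2) eq])
    interpret N: prob_space N by fact
    have fm: "fst \<in> measurable N (meas (X n))" and sm: "snd \<in> measurable N Q"
      by (simp_all add: measurable_cong_sets[OF N(2) refl])
    have \<beta>: "(\<lambda>z. \<alpha> (snd z)) \<in> measurable N (meas Y)" "distr N (meas Y) (\<lambda>z. \<alpha> (snd z)) = meas Y"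
      using measurable_compose[OF sm Y(4)] distr_comp_marginal[OF sm N(4) Y(4)] Y(5) by auto
    have "AE \<omega> in distr N Q snd. \<alpha> \<omega> = \<xi> \<omega>" unfolding N(4) by (rule Y(6))
    then have ae: "AE z in N. \<alpha> (snd z) = \<xi> (snd z)" by (rule AE_distrD[OF sm])
    \<comment> \<open>The cell radius contributes \<epsilon> n and the tail of the chain 4 *
      \<epsilon> n; doubling the sum yields the constant 10.\<close>
    let ?E = "{z\<in>space N. \<forall>k. \<bar>cc n k (fst z) - \<alpha> (snd z) k\<bar> \<le> 5 * \<epsilon> n}"
    have "(\<lambda>z. cc n k (fst z)) \<in> borel_measurable N" "(\<lambda>z. \<alpha> (snd z) k) \<in> borel_measurable N" for k
      using measurable_compose[OF fm Xn.dense_features_measurable[OF pcc]]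
        measurable_compose[OF \<beta>(1) Y.dense_features_measurable[OF Y(3)]] by auto
    then have Em: "?E \<in> sets N" by measurable
    have "1 - 2 * \<epsilon> n \<le> Q.prob (G n)" by (rule G)
    also have "\<dots> = N.prob (snd -` G n \<inter> space N)"
      using measure_distr[OF sm Gm[of n]] by (simp only: N(4))
    also have "\<dots> \<le> N.prob ?E"
    proof (rule N.finite_measure_mono_AE[OF _ Em])
      show "AE z in N. z \<in> snd -` G n \<inter> space N \<longrightarrow> z \<in> ?E"
        using N(5) ae
      proof eventually_elim
        fix z :: "'a \<times> (nat \<Rightarrow> nat)" assume z: "p n (fst z) = (snd z) n" "\<alpha> (snd z) = \<xi> (snd z)"
        show "z \<in> snd -` G n \<inter> space N \<longrightarrow> z \<in> ?E"
        proof
          assume w: "z \<in> snd -` G n \<inter> space N"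
          then have x: "fst z \<in> pts (X n)" using measurable_space[OF fm, of z] by simp
          have "\<bar>cc n k (fst z) - \<alpha> (snd z) k\<bar> \<le> 5 * \<epsilon> n" for k
            using Xn.dense_features_lip[OF pcc p(2) x, of k "p n (fst z)"] p(3)[OF x] \<xi>v[of "snd z" n n k] w
            unfolding z v_def by simp
          then show "z \<in> ?E" using w by simp
        qed
      qed
    qed
    finally have "1 - 10 * \<epsilon> n \<le> N.prob ?E" using \<epsilon>(1)[of n] by linarith
    then have "box_data (X n) Y \<le> ennreal (10 * \<epsilon> n)"
      by (intro box_data_upper[OF g Y(1) N(1) fm N(3) \<beta> pcc Y(3), where e = "5 * \<epsilon> n"]) auto
    then show ?thesis by (simp add: \<epsilon>_def)
  qed
  with Y(1,2) show ?thesis using that by blast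
qed


section \<open>The metric space of isomorphism classes\<close>

lemma mem_iso_class: "Z \<in> iso_class X \<longleftrightarrow> geom_data Z \<and> data_iso X Z"
  by (simp add: iso_class_def geom_data_def)

lemma iso_class_cong:
  assumes "geom_data X" "geom_data Y" "data_iso X Y" shows "iso_class X = iso_class Y"
  using data_iso_trans[OF assms(1,2)] data_iso_trans[OF assms(2,1)] data_iso_sym[OF assms] assms(3)
  by (auto simp: mem_iso_class)

lemma iso_class_member:
  assumes "geom_data X" obtains Z where "Z \<in> iso_class X" "geom_data Z" "data_iso X Z"
  using iso_class_nonempty[of X] assms by (auto simp: geom_data_def mem_iso_class)

lemma iso_class_eqD:
  assumes "geom_data X" "geom_data Y" "iso_class X = iso_class Y" shows "data_iso X Y"
proof -
  obtain Z where Z: "Z \<in> iso_class X" "geom_data Z" "data_iso X Z" using iso_class_member[OF assms(1)] .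
  then have "data_iso Y Z" using assms(3) by (simp add: mem_iso_class)
  then show ?thesis using data_iso_trans[OF assms(1) Z(2) assms(2) Z(3)] data_iso_sym[OF assms(2) Z(2)] by blast
qed

text \<open>An isomorphism matches features only up to pointwise limits, and these stay in
  \<open>K\<close> because \<open>K\<close> is closed.\<close>

lemma K_valued_iso:
  assumes "geom_data X" "geom_data Y" "data_iso X Y" "K_valued X" shows "K_valued Y"
  unfolding K_valued_def
proof (intro ballI)
  interpret X: geom_data X by fact
  interpret Y: geom_data Y by fact
  fix h y assume h: "h \<in> feats Y" and y: "y \<in> pts Y"
  obtain \<psi> where \<psi>: "\<psi> \<in> measurable (meas Y) (meas X)" "(\<lambda>g. compose (pts Y) g \<psi>) ` feats_closure X = feats_closure Y"
    using data_iso_sym[OF assms(1-3)] unfolding data_iso_def by (elim bexE conjE)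
  have "h \<in> feats_closure Y"
    using pw_adherent_superset[OF h] subsetD[OF Y.feats_ext h] by (simp add: feats_closure_eq[OF assms(2)])
  then obtain g where g: "g \<in> feats_closure X" "h = compose (pts Y) g \<psi>" unfolding \<psi>(2)[symmetric] by blast
  have gc: "pw_adherent (pts X) (feats X) g" using g(1) by (simp add: feats_closure_eq[OF assms(1)])
  have x: "\<psi> y \<in> pts X" using measurable_space[OF \<psi>(1), of y] y by simp
  have "g (\<psi> y) \<in> {-1/2..1/2}"
    by (rule pw_adherent_closed_range[OF gc _ x closed_atLeastAtMost])
      (rule assms(4)[unfolded K_valued_def, rule_format, OF _ x])
  then show "h y \<in> {-1/2..1/2}" using y by (simp add: g(2) compose_def)
qed

lemma data_classesE:
  assumes "a \<in> data_classes" obtains X :: "(nat \<Rightarrow> real) data_set" where "geom_data X" "a = iso_class X"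
  using assms by (auto simp: data_classes_def geom_data_def)

lemma data_classes_KE:
  assumes "a \<in> data_classes_K" obtains X :: "(nat \<Rightarrow> real) data_set" where "geom_data X" "K_valued X" "a = iso_class X"
proof -
  obtain X :: "(nat \<Rightarrow> real) data_set" where X: "a = iso_class X" "geometric_data_set X"
    "\<forall>f\<in>feats X. \<forall>x\<in>pts X. f x \<in> {-1/2..1/2}"
    using assms unfolding data_classes_K_def by blast
  have "geom_data X" by (rule geom_data.intro[OF X(2)])
  moreover have "K_valued X" unfolding K_valued_def by (rule X(3))
  ultimately show ?thesis using that X(1) by blast
qed

lemma iso_class_in_data_classes:
  assumes "geom_data X" shows "iso_class X \<in> data_classes"
proof -
  obtain Z where Z: "Z \<in> iso_class X" "geom_data Z" "data_iso X Z" using iso_class_member[OF assms] .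
  have "iso_class X = iso_class Z" by (rule iso_class_cong[OF assms Z(2,3)])
  then show ?thesis using Z(2) by (auto simp: data_classes_def geom_data_def)
qed

lemma iso_class_in_data_classes_K:
  assumes "geom_data X" "K_valued X" shows "iso_class X \<in> data_classes_K"
proof -
  obtain Z where Z: "Z \<in> iso_class X" "geom_data Z" "data_iso X Z" using iso_class_member[OF assms(1)] .
  have "iso_class X = iso_class Z" by (rule iso_class_cong[OF assms(1) Z(2,3)])
  moreover have "\<forall>f\<in>feats Z. \<forall>x\<in>pts Z. f x \<in> {-1/2..1/2}"
    using K_valued_iso[OF assms(1) Z(2,3) assms(2)] unfolding K_valued_def .
  ultimately show ?thesis using Z(2) unfolding data_classes_K_def geom_data_def by blast
qed

lemma box_dist_iso_class:
  assumes "geom_data X" "geom_data Y"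
  shows "box_dist (iso_class X) (iso_class Y) = enn2real (box_data X Y)"
proof -
  obtain Z where Z: "Z \<in> iso_class X" using iso_class_member[OF assms(1)] by blast
  obtain W where W: "W \<in> iso_class Y" using iso_class_member[OF assms(2)] by blast
  have "box_data X' Y' = box_data X Y" if "X' \<in> iso_class X" "Y' \<in> iso_class Y" for X' Y'
    by (rule box_data_iso_cong[symmetric]) (use that assms in \<open>auto simp: mem_iso_class\<close>)
  then have "(\<Union>X'\<in>iso_class X. \<Union>Y'\<in>iso_class Y. {box_data X' Y'}) = {box_data X Y}"
    using Z W by auto
  then show ?thesis
    using iso_class_in_data_classes[OF assms(1)] iso_class_in_data_classes[OF assms(2)] by (simp add: box_dist_def)
qed

lemma box_dist_nonneg: "box_dist a b \<ge> 0"
  by (simp add: box_dist_def)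

lemma box_dist_commute: "box_dist a b = box_dist b a"
proof (cases "a \<in> data_classes \<and> b \<in> data_classes")
  case True
  obtain X :: "(nat \<Rightarrow> real) data_set" where X: "geom_data X" "a = iso_class X" by (rule data_classesE[OF conjunct1[OF True]])
  obtain Y :: "(nat \<Rightarrow> real) data_set" where Y: "geom_data Y" "b = iso_class Y" by (rule data_classesE[OF conjunct2[OF True]])
  show ?thesis unfolding X(2) Y(2) box_dist_iso_class[OF X(1) Y(1)] box_dist_iso_class[OF Y(1) X(1)]
    by (simp only: box_data_commute[OF X(1) Y(1)])
qed (auto simp: box_dist_def)

lemma box_data_finite: "geom_data X \<Longrightarrow> geom_data Y \<Longrightarrow> box_data X Y < top"
  using box_data_le_1[of X Y] by (metis ennreal_one_less_top order_le_less_trans)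

lemma box_dist_triangle:
  assumes "a \<in> data_classes" "b \<in> data_classes" "c \<in> data_classes"
  shows "box_dist a c \<le> box_dist a b + box_dist b c"
proof -
  obtain X :: "(nat \<Rightarrow> real) data_set" where X: "geom_data X" "a = iso_class X" by (rule data_classesE[OF assms(1)])
  obtain Y :: "(nat \<Rightarrow> real) data_set" where Y: "geom_data Y" "b = iso_class Y" by (rule data_classesE[OF assms(2)])
  obtain Z :: "(nat \<Rightarrow> real) data_set" where Z: "geom_data Z" "c = iso_class Z" by (rule data_classesE[OF assms(3)])
  have "enn2real (box_data X Z) \<le> enn2real (box_data X Y + box_data Y Z)"
    by (intro enn2real_mono box_data_triangle X Y Z)
      (simp add: box_data_finite[OF X(1) Y(1)] box_data_finite[OF Y(1) Z(1)])
  also have "\<dots> = enn2real (box_data X Y) + enn2real (box_data Y Z)"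
    by (intro enn2real_plus box_data_finite X Y Z)
  finally show ?thesis
    unfolding X(2) Y(2) Z(2) box_dist_iso_class[OF X(1) Y(1)] box_dist_iso_class[OF X(1) Z(1)] box_dist_iso_class[OF Y(1) Z(1)] .
qed

text \<open>Separation rests on the compactness of \<open>K\<close>. It serves both metrics, since
  \<open>box_tau_dist\<close> is evaluated on screens, which are \<open>K\<close>-valued by
  \<open>screen_K\<close>.\<close>

lemma box_dist_zero_iff:
  assumes "geom_data X" "geom_data Y" "K_valued X" "K_valued Y"
  shows "box_dist (iso_class X) (iso_class Y) = 0 \<longleftrightarrow> data_iso X Y"
proof
  assume "box_dist (iso_class X) (iso_class Y) = 0"
  then have "box_data X Y = 0"
    using box_data_finite[OF assms(1,2)] by (auto simp: box_dist_iso_class[OF assms(1,2)] enn2real_eq_0_iff)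
  then show "data_iso X Y" by (rule box_data_zero_imp_iso[OF assms])
next
  assume "data_iso X Y"
  then show "box_dist (iso_class X) (iso_class Y) = 0"
    using box_data_iso[OF assms(1,2)] by (simp add: box_dist_iso_class[OF assms(1,2)])
qed

lemma data_classes_K_subset: "data_classes_K \<subseteq> data_classes"
  using iso_class_in_data_classes by (auto elim!: data_classes_KE)

lemma Metric_space_box_dist: "Metric_space data_classes_K box_dist"
proof
  fix a b assume "a \<in> data_classes_K" "b \<in> data_classes_K"
  then obtain X Y :: "(nat \<Rightarrow> real) data_set" where XY: "geom_data X" "K_valued X" "a = iso_class X" "geom_data Y" "K_valued Y" "b = iso_class Y"
    by (metis data_classes_KE)
  show "box_dist a b = 0 \<longleftrightarrow> a = b"
    unfolding XY(3,6) box_dist_zero_iff[OF XY(1,4,2,5)]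
    using iso_class_cong[OF XY(1,4)] iso_class_eqD[OF XY(1,4)] by blast
next
  fix a b c assume "a \<in> data_classes_K" "b \<in> data_classes_K" "c \<in> data_classes_K"
  then show "box_dist a c \<le> box_dist a b + box_dist b c"
    using data_classes_K_subset by (intro box_dist_triangle) blast+
qed (rule box_dist_nonneg box_dist_commute)+

lemma screen_class_iso_class:
  fixes X :: "(nat \<Rightarrow> real) data_set"
  assumes "geom_data X" shows "screen_class (iso_class X) = iso_class (screen X)"
proof -
  have "iso_class (screen X') = iso_class (screen X)" if "X' \<in> iso_class X" for X'
    using that screen_iso[OF assms] geom_data.screen_geom_data[OF assms] geom_data.screen_geom_data[of X']
    by (intro iso_class_cong[symmetric]) (auto simp: mem_iso_class)
  moreover have "X \<in> iso_class X" using assms data_iso_refl[OF assms] by (simp add: mem_iso_class)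
  ultimately show ?thesis unfolding screen_class_def by blast
qed

lemma screen_class_in: "a \<in> data_classes \<Longrightarrow> screen_class a \<in> data_classes_K"
  by (elim data_classesE) (simp add: screen_class_iso_class iso_class_in_data_classes_K geom_data.screen_geom_data geom_data.screen_K)

lemma Metric_space_box_tau_dist: "Metric_space data_classes box_tau_dist"
  unfolding box_tau_dist_def
proof
  fix a b assume ab: "a \<in> data_classes" "b \<in> data_classes"
  obtain X :: "(nat \<Rightarrow> real) data_set" where X: "geom_data X" "a = iso_class X" by (rule data_classesE[OF ab(1)])
  obtain Y :: "(nat \<Rightarrow> real) data_set" where Y: "geom_data Y" "b = iso_class Y" by (rule data_classesE[OF ab(2)])
  show "box_dist (screen_class a) (screen_class b) = 0 \<longleftrightarrow> a = b"
    unfolding X(2) Y(2) screen_class_iso_class[OF X(1)] screen_class_iso_class[OF Y(1)]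
      box_dist_zero_iff[OF geom_data.screen_geom_data[OF X(1)] geom_data.screen_geom_data[OF Y(1)] geom_data.screen_K[OF X(1)] geom_data.screen_K[OF Y(1)]]
    using screen_iso[OF X(1) Y(1)] screen_iso_imp_iso[OF X(1) Y(1)] iso_class_cong[OF X(1) Y(1)] iso_class_eqD[OF X(1) Y(1)]
    by blast
  fix c assume c: "c \<in> data_classes"
  show "box_dist (screen_class a) (screen_class c) \<le> box_dist (screen_class a) (screen_class b) + box_dist (screen_class b) (screen_class c)"
    by (intro box_dist_triangle) (use ab c screen_class_in data_classes_K_subset in blast)+
qed (rule box_dist_nonneg box_dist_commute)+

lemma screens_closure_of:
  "Metric_space.mtopology data_classes_K box_dist closure_of (screen_class ` data_classes) = data_classes_K"
proof -
  interpret B: Metric_space data_classes_K box_dist by (rule Metric_space_box_dist)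
  have "\<exists>b\<in>screen_class ` data_classes. b \<in> data_classes_K \<and> box_dist a b < r" if a: "a \<in> data_classes_K" and r: "r > 0" for a r
  proof -
    obtain X :: "(nat \<Rightarrow> real) data_set" where X: "geom_data X" "K_valued X" "a = iso_class X"
      by (rule data_classes_KE[OF a])
    \<comment> \<open>\<open>screens_dense\<close> requires \<delta> < 1, and halving r turns its
      bound into a strict one.\<close>
    define \<delta> where "\<delta> = min (r / 2) (1 / 2)"
    have \<delta>: "0 < \<delta>" "\<delta> < 1" "\<delta> < r" using r by (auto simp: \<delta>_def)
    obtain Y :: "(nat \<Rightarrow> real) data_set" where Y: "geom_data Y" "box_data (screen Y) X \<le> ennreal \<delta>"
      by (rule screens_dense[OF X(1,2) \<delta>(1,2)])
    have "box_dist a (iso_class (screen Y)) = enn2real (box_data (screen Y) X)"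
      unfolding X(3) box_dist_commute[of "iso_class X"] by (rule box_dist_iso_class[OF geom_data.screen_geom_data[OF Y(1)] X(1)])
    also have "\<dots> \<le> \<delta>" using enn2real_mono[OF Y(2)] \<delta> by simp
    finally have "box_dist a (screen_class (iso_class Y)) < r" using \<delta> by (simp add: screen_class_iso_class[OF Y(1)])
    then show ?thesis using iso_class_in_data_classes[OF Y(1)] screen_class_in by blast
  qed
  then show ?thesis by (auto simp: B.metric_closure_of)
qed

text \<open>A Cauchy sequence converges as soon as a subsequence does, so it is enough to thin it
  out until consecutive distances satisfy the geometric bound of
  \<open>cauchy_limit\<close>.\<close>

lemma mcomplete_box_dist: "Metric_space.mcomplete data_classes_K box_dist"
proof -
  interpret B: Metric_space data_classes_K box_dist by (rule Metric_space_box_dist)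
  show ?thesis
    unfolding B.mcomplete_def
  proof (intro allI impI)
    fix \<sigma> assume cau: "B.MCauchy \<sigma>"
    then have \<sigma>: "\<sigma> n \<in> data_classes_K" for n by (auto simp: B.MCauchy_def)
    have "\<exists>N. \<forall>m m'. N \<le> m \<longrightarrow> N \<le> m' \<longrightarrow> box_dist (\<sigma> m) (\<sigma> m') < (1/2)^n" for n
      using cau[unfolded B.MCauchy_def] by simp
    then obtain N where N: "\<And>n m m'. N n \<le> m \<Longrightarrow> N n \<le> m' \<Longrightarrow> box_dist (\<sigma> m) (\<sigma> m') < (1/2)^n" by metis
    \<comment> \<open>The maximum secures both \<open>N n \<le> r n\<close> and strict
      monotonicity.\<close>
    define r where "r = rec_nat (N 0) (\<lambda>n k. max (N (Suc n)) (Suc k))"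
    have r: "r (Suc n) = max (N (Suc n)) (Suc (r n))" "N n \<le> r n" for n
      by (simp add: r_def) (cases n; simp add: r_def)
    have sm: "strict_mono r" unfolding strict_mono_Suc_iff using r by (simp add: less_max_iff_disj)
    have step: "box_dist (\<sigma> (r n)) (\<sigma> (r (Suc n))) < (1/2)^n" for n
    proof (rule N)
      show "N n \<le> r (Suc n)" using r(2)[of n] strict_monoD[OF sm lessI[of n]] by linarith
    qed (rule r(2))
    have "\<exists>X. geom_data X \<and> K_valued X \<and> \<sigma> (r n) = iso_class (X :: (nat \<Rightarrow> real) data_set)" for n
      by (rule data_classes_KE[OF \<sigma>]) blast
    then obtain X :: "nat \<Rightarrow> (nat \<Rightarrow> real) data_set" where X: "\<And>n. geom_data (X n)" "\<And>n. K_valued (X n)" "\<And>n. \<sigma> (r n) = iso_class (X n)"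
      by metis
    have box: "box_data (X n) (X (Suc n)) < ennreal ((1/2)^n)" for n
    proof -
      have "ennreal (enn2real (box_data (X n) (X (Suc n)))) < ennreal ((1/2)^n)"
        using step[of n] unfolding X(3) box_dist_iso_class[OF X(1) X(1)] by (simp add: ennreal_less_iff)
      then show ?thesis using box_data_finite[OF X(1) X(1)] by simp
    qed
    obtain Y :: "(nat \<Rightarrow> real) data_set" where Y: "geom_data Y" "K_valued Y" "\<And>n. box_data (X n) Y \<le> ennreal (10 * (1/2)^n)"
      using cauchy_limit[of X, OF X(1,2) box] by blast
    have bd: "box_dist (\<sigma> (r n)) (iso_class Y) \<le> 10 * (1/2)^n" for n
      unfolding X(3) box_dist_iso_class[OF X(1) Y(1)] using enn2real_mono[OF Y(3)[of n]] by simp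
    have "limitin B.mtopology (\<sigma> \<circ> r) (iso_class Y) sequentially"
      unfolding B.limit_metric_sequentially
    proof (intro conjI allI impI)
      show "iso_class Y \<in> data_classes_K" by (rule iso_class_in_data_classes_K[OF Y(1,2)])
      fix e :: real assume "e > 0"
      have "(\<lambda>n. 10 * (1/2)^n :: real) \<longlonglongrightarrow> 10 * 0" by (intro tendsto_intros LIMSEQ_realpow_zero) auto
      then have "\<forall>\<^sub>F n in sequentially. 10 * (1/2)^n < e" using \<open>e > 0\<close> by (intro order_tendstoD(2)[of _ "10 * 0"]) auto
      then obtain L where L: "\<And>n. n \<ge> L \<Longrightarrow> 10 * (1/2)^n < e" unfolding eventually_sequentially by blast
      have "(\<sigma> \<circ> r) n \<in> data_classes_K \<and> box_dist ((\<sigma> \<circ> r) n) (iso_class Y) < e" if "n \<ge> L" for n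
        using L[OF that] bd[of n] \<sigma> by simp
      then show "\<exists>L. \<forall>n\<ge>L. (\<sigma> \<circ> r) n \<in> data_classes_K \<and> box_dist ((\<sigma> \<circ> r) n) (iso_class Y) < e" by blast
    qed
    then show "\<exists>x. limitin B.mtopology \<sigma> x sequentially"
      using B.MCauchy_convergent_subsequence[OF cau sm] by blast
  qed
qed

theorem theorem4p13:
  shows "screen_class ` data_classes \<subseteq> data_classes_K \<and>
         Metric_space.mtopology data_classes_K box_dist closure_of (screen_class ` data_classes)
           = data_classes_K \<and>
         is_metric_completion data_classes box_tau_dist data_classes_K box_dist screen_class"
  unfolding is_metric_completion_def
  using screen_class_in screens_closure_of Metric_space_box_tau_dist Metric_space_box_dist mcomplete_box_dist
  by (auto simp: box_tau_dist_def)

end
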